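(* Let $1\le \ell\le k$ be integers and let $n\ge 187k$. Let $G$ be an $n$-vertex graph containing none of $C_3,C_5,\ldots,C_{2\ell-1},C_{2k+1}$ as a subgraph (for $\ell=1$ this means only that $G$ is $C_{2k+1}$-free). (a) If $\ell=k$ and $\lambda(G)\ge \lambda(S_{2k-1}(T_{n-2k+1,2}))$, then $G$ is bipartite, unless $G= S_{2k-1}(T_{n-2k+1,2})$. (b) If $\ell\le k-1$ and $\lambda(G)\ge \lambda(C_{2\ell+1}(T_{n-2\ell,2}))$, then $G$ is bipartite, unless $G= C_{2\ell+1}(T_{n-2\ell,2})$.
   Context: All graphs are simple; $C_m$ denotes the cycle of length $m$. $\lambda(G)$ denotes the spectral radius (largest eigenvalue) of the adjacency matrix of $G$. $T_{m,2}$ is the complete bipartite graph on $m$ vertices whose two parts have sizes $\lfloor m/2\rfloor$ and $\lceil m/2\rceil$. $S_{2k-1}(T_{n-2k+1,2})$ is the graph obtained from $T_{n-2k+1,2}$ by replacing one edge by a path on $2k+1$ vertices (i.e. subdividing that edge $2k-1$ times). $C_{2\ell+1}(T_{n-2\ell,2})$ is the graph obtained by identifying one vertex of a cycle $C_{2\ell+1}$ with one vertex of $T_{n-2\ell,2}$ lying in the part of smaller size $\lfloor (n-2\ell)/2\rfloor$ (so it has $n$ vertices). *)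

theory Defs
  imports "Jordan_Normal_Form.Char_Poly"
begin

definition simple_graph :: "nat \<Rightarrow> (nat \<Rightarrow> nat \<Rightarrow> bool) \<Rightarrow> bool" where
  "simple_graph n E \<longleftrightarrow> (\<forall>u v. E u v \<longrightarrow> u < n \<and> v < n \<and> u \<noteq> v \<and> E v u)"

definition adj_mat :: "nat \<Rightarrow> (nat \<Rightarrow> nat \<Rightarrow> bool) \<Rightarrow> real mat" where
  "adj_mat n E = mat n n (\<lambda>(i,j). if E i j then 1 else 0)"

definition spec_rad :: "nat \<Rightarrow> (nat \<Rightarrow> nat \<Rightarrow> bool) \<Rightarrow> real" where
  "spec_rad n E = Max {\<mu>. eigenvalue (adj_mat n E) \<mu>}"

definition has_cycle :: "nat \<Rightarrow> (nat \<Rightarrow> nat \<Rightarrow> bool) \<Rightarrow> nat \<Rightarrow> bool" where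
  "has_cycle n E m \<longleftrightarrow> (\<exists>f. inj_on f {0..<m} \<and> f ` {0..<m} \<subseteq> {0..<n} \<and>
      (\<forall>i<m. E (f i) (f ((i + 1) mod m))))"

definition bipartite :: "nat \<Rightarrow> (nat \<Rightarrow> nat \<Rightarrow> bool) \<Rightarrow> bool" where
  "bipartite n E \<longleftrightarrow> (\<exists>A \<subseteq> {0..<n}. \<forall>u<n. \<forall>v<n. E u v \<longrightarrow> (u \<in> A \<longleftrightarrow> v \<notin> A))"

definition graph_iso :: "nat \<Rightarrow> (nat \<Rightarrow> nat \<Rightarrow> bool) \<Rightarrow> (nat \<Rightarrow> nat \<Rightarrow> bool) \<Rightarrow> bool" where
  "graph_iso n E H \<longleftrightarrow> (\<exists>f. bij_betw f {0..<n} {0..<n} \<and>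
      (\<forall>u<n. \<forall>v<n. E u v \<longleftrightarrow> H (f u) (f v)))"

definition turan2 :: "nat \<Rightarrow> nat \<Rightarrow> nat \<Rightarrow> bool" where
  "turan2 m u v \<longleftrightarrow> u < m \<and> v < m \<and> ((u < m div 2) \<noteq> (v < m div 2))"

text \<open>S_{2k-1}(T_{n-2k+1,2}) on {0..<n}: with m = n-2k+1, remove edge {0, m div 2} of T_{m,2}
  and join 0 and m div 2 by the path 0, m, m+1, ..., m+2k-2 (= n-1), m div 2
  (2k+1 vertices in total).\<close>
definition path_edge :: "nat list \<Rightarrow> nat \<Rightarrow> nat \<Rightarrow> bool" where
  "path_edge xs u v \<longleftrightarrow> (\<exists>i. Suc i < length xs \<and>
     ((u = xs ! i \<and> v = xs ! Suc i) \<or> (v = xs ! i \<and> u = xs ! Suc i)))"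

definition S_graph :: "nat \<Rightarrow> nat \<Rightarrow> nat \<Rightarrow> nat \<Rightarrow> bool" where
  "S_graph n k u v \<longleftrightarrow>
     (let m = n - (2*k - 1) in
       (turan2 m u v \<and> \<not> ({u,v} = {0, m div 2})) \<or>
       path_edge ([0] @ [m..<n] @ [m div 2]) u v)"

text \<open>C_{2l+1}(T_{n-2l,2}) on {0..<n}: with m = n-2l, vertex 0 (in the smaller part
  {0..<m div 2}) lies on the cycle 0, m, m+1, ..., m+2l-1 (= n-1), 0.\<close>
definition C_graph :: "nat \<Rightarrow> nat \<Rightarrow> nat \<Rightarrow> nat \<Rightarrow> bool" where
  "C_graph n l u v \<longleftrightarrow>
     (let m = n - 2*l in turan2 m u v \<or> path_edge ([0] @ [m..<n] @ [0]) u v)"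

end

(* Let x be the Perron vector with maximum 1 at u, S the neighbourhood of u and T its complement.
   Erdos-Gallai bounds the edges inside S, and comparing the spectral radius with its bound by |S||T| shows
   that S and T are almost completely joined. The vertices adjacent to most of T or most of S form two
   independent sets A and B, since short paths of every admissible length join any two of them and would
   close a C_{2k+1}; only O(k) vertices remain. A minimal odd closed walk or ear in the remainder has forced
   length and attachment. Comparing quadratic forms, any vertex outside A, B and this ear costs about half a
   unit of spectral radius. So nothing else is left, and edge switching identifies the graph exactly. *)
theory Submission
  imports Defs "HOL-Analysis.Function_Topology" "HOL-Analysis.Convex"
begin

section \<open>Quadratic forms and the spectral radius\<close>

text \<open>Each reference graph has \<open>r0\<close> vertices outside its balanced classes, with
  \<open>r0\<close> equal to \<open>2 * k - 1\<close> or \<open>2 * l\<close>, so its spectral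
  radius is at least \<open>(n - r0) / 2 - 1 / 50\<close>. If the classes of a competitor leave out
  \<open>r0 + rho\<close> vertices, their edges yield at most \<open>(n - r0 - rho) / 2\<close> per
  unit of squared weight. The deficit, about \<open>rho / 2\<close> times a squared weight of at
  least 0.767 n, would have to be made up by at most \<open>rho\<close> surplus vertices worth at
  most 0.3203 n each; as 0.48 times 0.767 exceeds 0.3203, this fails. The factor 187 makes these
  constants fit. The obstacle is an end of the ear that is joined to many class vertices, since its
  contribution can grow with n. Excluding \<open>C_{2k+1}\<close> forbids edges between the class
  neighbours of the two ends, and this loss pays for the gain, unless one end outweighs all
  neighbours of the other end. In that case the heavy end and a class vertex trade places.
  Obstructions to bipartiteness are walks, which can be cut and joined freely; minimality makes
  their vertices distinct.\<close>

definition nsum :: "(nat \<Rightarrow> nat \<Rightarrow> bool) \<Rightarrow> (nat \<Rightarrow> real) \<Rightarrow> nat set \<Rightarrow> nat \<Rightarrow> real" where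
  "nsum E x Y v = (\<Sum>w\<in>Y. if E v w then x w else 0)"

text \<open>The bilinear form of the adjacency matrix: for \<open>X = Y\<close> each edge counts
  twice, for disjoint sets once.\<close>

definition qf :: "(nat \<Rightarrow> nat \<Rightarrow> bool) \<Rightarrow> (nat \<Rightarrow> real) \<Rightarrow> nat set \<Rightarrow> nat set \<Rightarrow> real" where
  "qf E x X Y = (\<Sum>v\<in>X. x v * nsum E x Y v)"

definition sqn :: "(nat \<Rightarrow> real) \<Rightarrow> nat set \<Rightarrow> real" where
  "sqn x X = (\<Sum>v\<in>X. (x v)\<^sup>2)"

lemma simple_graphD:
  assumes "simple_graph n E" "E u v"
  shows "u < n" "v < n" "u \<noteq> v" "E v u"
  using assms unfolding simple_graph_def by blast+

lemma simple_graph_irrefl: "simple_graph n E \<Longrightarrow> \<not> E v v"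
  unfolding simple_graph_def by blast

lemma simple_graph_commute: "simple_graph n E \<Longrightarrow> E u v \<longleftrightarrow> E v u"
  unfolding simple_graph_def by blast

lemma sqn_nonneg [simp]: "0 \<le> sqn x X"
  unfolding sqn_def by (simp add: sum_nonneg)

lemma nsum_nonneg: "(\<And>w. 0 \<le> x w) \<Longrightarrow> 0 \<le> nsum E x Y v"
  unfolding nsum_def by (simp add: sum_nonneg)

lemma qf_nonneg: "(\<And>w. 0 \<le> x w) \<Longrightarrow> 0 \<le> qf E x X Y"
  unfolding qf_def by (simp add: sum_nonneg nsum_nonneg)

lemma qf_scale: "qf E (\<lambda>v. c * x v) X Y = c\<^sup>2 * qf E x X Y"
proof -
  have "nsum E (\<lambda>v. c * x v) Y v = c * nsum E x Y v" for v
    unfolding nsum_def sum_distrib_left by (intro sum.cong) auto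
  thus ?thesis
    unfolding qf_def sum_distrib_left by (intro sum.cong) (auto simp: power2_eq_square)
qed

lemma sqn_scale: "sqn (\<lambda>v. c * x v) X = c\<^sup>2 * sqn x X"
  unfolding sqn_def sum_distrib_left by (simp add: power_mult_distrib)

text \<open>There is no term in the square of \<open>e\<close>, because a simple graph has no loop
  at \<open>v\<close>.\<close>

lemma qf_perturb:
  assumes G: "simple_graph n E" and v: "v < n"
  shows "qf E (x(v := x v + e)) {..<n} {..<n} = qf E x {..<n} {..<n} + 2 * e * nsum E x {..<n} v"
proof -
  let ?y = "x(v := x v + e)"
  define d where "d w = (if w = v then e else 0)" for w
  have y: "?y w = x w + d w" for w unfolding d_def by auto
  have ny: "nsum E ?y {..<n} u = nsum E x {..<n} u + (if E u v then e else 0)" for u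
  proof -
    have "nsum E ?y {..<n} u = (\<Sum>w<n. (if E u w then x w else 0) + (if w = v then (if E u v then e else 0) else 0))"
      unfolding nsum_def by (intro sum.cong) auto
    also have "\<dots> = nsum E x {..<n} u + (if E u v then e else 0)"
      using v by (simp add: sum.distrib nsum_def)
    finally show ?thesis .
  qed
  have "qf E ?y {..<n} {..<n} = (\<Sum>u<n. x u * nsum E x {..<n} u + x u * (if E u v then e else 0)
      + (if u = v then e * nsum E x {..<n} v else 0))"
    unfolding qf_def
  proof (intro sum.cong refl)
    fix u assume "u \<in> {..<n}"
    have irr: "\<not> E v v" using G simple_graph_irrefl by auto
    show "?y u * nsum E ?y {..<n} u = x u * nsum E x {..<n} u + x u * (if E u v then e else 0)
      + (if u = v then e * nsum E x {..<n} v else 0)"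
      unfolding ny using irr by (auto simp: algebra_simps)
  qed
  also have "\<dots> = qf E x {..<n} {..<n} + (\<Sum>u<n. x u * (if E u v then e else 0)) + e * nsum E x {..<n} v"
    using v by (simp add: sum.distrib qf_def)
  also have "(\<Sum>u<n. x u * (if E u v then e else 0)) = e * nsum E x {..<n} v"
    unfolding nsum_def sum_distrib_left
    by (intro sum.cong) (auto simp: simple_graph_commute[OF G, of v])
  finally show ?thesis by (simp add: fun_upd_def)
qed

lemma sqn_perturb:
  assumes v: "v < n"
  shows "sqn (x(v := x v + e)) {..<n} = sqn x {..<n} + 2 * e * x v + e\<^sup>2"
proof -
  have "sqn (x(v := x v + e)) {..<n} = (\<Sum>u<n. (x u)\<^sup>2 + (if u = v then 2 * e * x v + e\<^sup>2 else 0))"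
    unfolding sqn_def by (intro sum.cong) (auto simp: power2_eq_square algebra_simps)
  thus ?thesis using v by (simp add: sum.distrib sqn_def)
qed

text \<open>The first-order condition at a maximum: near 0 a nonzero linear term beats every
  quadratic one. The choice \<open>e = d / C\<close> with \<open>C\<close> positive and above
  \<open>c\<close> exhibits this.\<close>

lemma linear_le_quadratic_zero:
  fixes d c :: real
  assumes "\<And>e. d * e \<le> c * e\<^sup>2"
  shows "d = 0"
proof (rule ccontr)
  assume d: "d \<noteq> 0"
  define C where "C = \<bar>c\<bar> + 1"
  have C: "C > 0" "c < C" "c \<ge> -C" unfolding C_def by auto
  have "d * (d / C) \<le> c * (d / C)\<^sup>2" by (rule assms)
  also have "\<dots> < C * (d/C)\<^sup>2" using C d by (intro mult_strict_right_mono) auto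
  also have "\<dots> = d * (d / C)" using C by (simp add: power2_eq_square)
  finally show False by simp
qed

text \<open>A maximiser of the Rayleigh quotient is stationary under a change of one coordinate, and
  stationarity in coordinate \<open>v\<close> is the eigenvalue equation at \<open>v\<close>. This
  is also how equality is exploited after a switching of edges.\<close>

lemma rayleigh_eq_imp_eigen:
  assumes G: "simple_graph n E"
    and max: "\<And>y. qf E y {..<n} {..<n} \<le> \<mu> * sqn y {..<n}"
    and eq: "qf E x {..<n} {..<n} = \<mu> * sqn x {..<n}"
    and v: "v < n"
  shows "nsum E x {..<n} v = \<mu> * x v"
proof -
  have "2 * (nsum E x {..<n} v - \<mu> * x v) * e \<le> \<mu> * e\<^sup>2" for e
    using max[of "x(v := x v + e)"] unfolding qf_perturb[OF G v] sqn_perturb[OF v] eq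
    by (simp add: algebra_simps)
  hence "2 * (nsum E x {..<n} v - \<mu> * x v) = 0" by (rule linear_le_quadratic_zero)
  thus ?thesis by simp
qed

lemma rayleigh_max_exists:
  assumes n: "n > 0"
  obtains x where "sqn x {..<n} = 1" "\<And>y. qf E y {..<n} {..<n} \<le> qf E x {..<n} {..<n} * sqn y {..<n}"
proof -
  \<comment> \<open>Vectors are functions on all naturals. Pinning the coordinates from
    \<open>n\<close> on to 0 keeps the cube a product of compact sets, so Tychonoff applies.\<close>
  define K :: "(nat \<Rightarrow> real) set" where "K = PiE UNIV (\<lambda>i. if i < n then {-1..1} else {0})"
  define S where "S = K \<inter> {x. sqn x {..<n} = 1}"
  have "compactin (product_topology (\<lambda>i. euclidean) UNIV) K"
    unfolding K_def compactin_PiE by auto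
  hence K: "compact K" by (simp add: euclidean_product_topology)
  have cc: "continuous_on UNIV (\<lambda>x::nat \<Rightarrow> real. x i)" for i by simp
  have "continuous_on UNIV (\<lambda>x::nat \<Rightarrow> real. sqn x {..<n})"
    unfolding sqn_def by (intro continuous_intros cc)
  hence "closed {x. sqn x {..<n} = 1}"
    by (intro closed_Collect_eq) (auto intro: continuous_on_const)
  hence S: "compact S" unfolding S_def using K by (intro compact_Int_closed)
  have cq: "continuous_on S (\<lambda>x. qf E x {..<n} {..<n})"
  proof -
    have "continuous_on UNIV (\<lambda>x::nat \<Rightarrow> real. if E v w then x w else 0)" for v w
      by (cases "E v w") (simp_all add: cc)
    hence "continuous_on UNIV (\<lambda>x::nat \<Rightarrow> real. qf E x {..<n} {..<n})"
      unfolding qf_def nsum_def by (intro continuous_intros cc)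
    thus ?thesis by (rule continuous_on_subset) simp
  qed
  define z :: "nat \<Rightarrow> real" where "z i = (if i = 0 then 1 else 0)" for i
  have "sqn z {..<n} = (\<Sum>i<n. if i = 0 then 1 else 0)"
    unfolding sqn_def z_def by (intro sum.cong) auto
  hence "z \<in> S" using n unfolding S_def K_def z_def by auto
  hence "S \<noteq> {}" by auto
  then obtain x where x: "x \<in> S" and mx: "\<And>y. y \<in> S \<Longrightarrow> qf E y {..<n} {..<n} \<le> qf E x {..<n} {..<n}"
    using continuous_attains_sup[OF S _ cq] by auto
  have "qf E y {..<n} {..<n} \<le> qf E x {..<n} {..<n} * sqn y {..<n}" for y
  proof (cases "sqn y {..<n} = 0")
    case True
    hence "\<forall>i<n. y i = 0" unfolding sqn_def by (simp add: sum_nonneg_eq_0_iff)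
    hence "qf E y {..<n} {..<n} = 0" unfolding qf_def by simp
    thus ?thesis using True by simp
  next
    case False
    define s where "s = sqn y {..<n}"
    have s: "s > 0" using False sqn_nonneg[of y "{..<n}"] unfolding s_def by linarith
    define c where "c = 1 / sqrt s"
    have c2: "c\<^sup>2 * s = 1" unfolding c_def using s by (simp add: power_divide)
    define w where "w i = (if i < n then c * y i else 0)" for i
    have sw: "sqn w {..<n} = 1"
    proof -
      have "sqn w {..<n} = sqn (\<lambda>i. c * y i) {..<n}" unfolding sqn_def w_def by simp
      thus ?thesis using c2 by (simp add: sqn_scale s_def)
    qed
    have "\<bar>w i\<bar> \<le> 1" if "i < n" for i
    proof -
      have "(w i)\<^sup>2 \<le> sqn w {..<n}" unfolding sqn_def
        using that by (intro member_le_sum) auto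
      thus ?thesis using sw by (simp add: abs_square_le_1)
    qed
    hence "w \<in> S" unfolding S_def K_def using sw by (auto simp: w_def abs_le_iff minus_le_iff)
    hence "qf E w {..<n} {..<n} \<le> qf E x {..<n} {..<n}" by (rule mx)
    moreover have "qf E w {..<n} {..<n} = qf E (\<lambda>i. c * y i) {..<n} {..<n}"
      unfolding qf_def nsum_def w_def by (intro sum.cong) (auto intro!: sum.cong)
    ultimately have "c\<^sup>2 * qf E y {..<n} {..<n} \<le> qf E x {..<n} {..<n}" by (simp add: qf_scale)
    hence "s * (c\<^sup>2 * qf E y {..<n} {..<n}) \<le> s * qf E x {..<n} {..<n}"
      using s by (intro mult_left_mono) auto
    moreover have "s * (c\<^sup>2 * qf E y {..<n} {..<n}) = qf E y {..<n} {..<n}"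
      using c2 by (metis mult.assoc mult.commute mult.right_neutral)
    ultimately have "qf E y {..<n} {..<n} \<le> s * qf E x {..<n} {..<n}" by linarith
    thus ?thesis by (simp add: s_def mult.commute)
  qed
  thus ?thesis using that x unfolding S_def by blast
qed

lemma qf_abs_le: "qf E x X Y \<le> qf E (\<lambda>v. \<bar>x v\<bar>) X Y"
  unfolding qf_def nsum_def sum_distrib_left
proof (intro sum_mono)
  fix v w
  have "x v * x w \<le> \<bar>x v\<bar> * \<bar>x w\<bar>" by (metis abs_ge_self abs_mult)
  thus "x v * (if E v w then x w else 0) \<le> \<bar>x v\<bar> * (if E v w then \<bar>x w\<bar> else 0)" by simp
qed

lemma adj_mat_carrier: "adj_mat n E \<in> carrier_mat n n"
  unfolding adj_mat_def by simp

lemma adj_mat_mult_index: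
  assumes "v \<in> carrier_vec n" "i < n"
  shows "(adj_mat n E *\<^sub>v v) $ i = nsum E (\<lambda>j. if j < n then v $ j else 0) {..<n} i"
  using assms unfolding adj_mat_def nsum_def
  by (auto simp: scalar_prod_def lessThan_atLeast0 intro!: sum.cong)

lemma eigenvalue_adj_iff:
  "eigenvalue (adj_mat n E) \<mu> \<longleftrightarrow>
    (\<exists>x. sqn x {..<n} \<noteq> 0 \<and> (\<forall>v<n. nsum E x {..<n} v = \<mu> * x v))"
proof
  assume "eigenvalue (adj_mat n E) \<mu>"
  then obtain v where v: "v \<in> carrier_vec n" "v \<noteq> 0\<^sub>v n" "adj_mat n E *\<^sub>v v = \<mu> \<cdot>\<^sub>v v"
    unfolding eigenvalue_def eigenvector_def using adj_mat_carrier[of n E] by auto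
  let ?x = "\<lambda>j. if j < n then v $ j else 0"
  have "nsum E ?x {..<n} i = \<mu> * ?x i" if "i < n" for i
    using adj_mat_mult_index[OF v(1) that, of E] v that by simp
  moreover have "sqn ?x {..<n} \<noteq> 0"
  proof
    assume "sqn ?x {..<n} = 0"
    hence "\<forall>i<n. v $ i = 0" unfolding sqn_def by (auto simp: sum_nonneg_eq_0_iff)
    thus False using v(1,2) by (auto intro!: eq_vecI)
  qed
  ultimately show "\<exists>x. sqn x {..<n} \<noteq> 0 \<and> (\<forall>v<n. nsum E x {..<n} v = \<mu> * x v)" by blast
next
  assume "\<exists>x. sqn x {..<n} \<noteq> 0 \<and> (\<forall>v<n. nsum E x {..<n} v = \<mu> * x v)"
  then obtain x where x: "sqn x {..<n} \<noteq> 0" "\<And>v. v < n \<Longrightarrow> nsum E x {..<n} v = \<mu> * x v" by blast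
  define v where "v = vec n x"
  have v: "v \<in> carrier_vec n" unfolding v_def by simp
  have "nsum E (\<lambda>j. if j < n then v $ j else 0) {..<n} i = nsum E x {..<n} i" for i
    unfolding nsum_def v_def by (intro sum.cong) auto
  hence "adj_mat n E *\<^sub>v v = \<mu> \<cdot>\<^sub>v v"
    using adj_mat_mult_index[OF v, of _ E] x(2) adj_mat_carrier[of n E]
    by (intro eq_vecI) (auto simp: v_def)
  moreover have "v \<noteq> 0\<^sub>v n"
  proof
    assume "v = 0\<^sub>v n"
    hence "\<forall>i<n. x i = 0" unfolding v_def by (metis index_vec index_zero_vec(1))
    thus False using x(1) unfolding sqn_def by simp
  qed
  ultimately show "eigenvalue (adj_mat n E) \<mu>"
    unfolding eigenvalue_def eigenvector_def using v adj_mat_carrier[of n E] by auto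
qed

text \<open>Connects the definition by eigenvalues with Rayleigh quotients: the maximal quotient is
  an eigenvalue, every eigenvalue is the quotient of its eigenvector, and the set of eigenvalues is
  finite as a set of roots. Absolute values make the maximiser nonnegative.\<close>

lemma spec_rad_facts:
  assumes G: "simple_graph n E" and n: "n > 0"
  shows spec_rad_ge: "qf E y {..<n} {..<n} \<le> spec_rad n E * sqn y {..<n}"
    and spec_rad_perron: "\<exists>x. (\<forall>v. 0 \<le> x v) \<and> sqn x {..<n} \<noteq> 0 \<and> (\<forall>v<n. nsum E x {..<n} v = spec_rad n E * x v)"
proof -
  obtain x0 where x0: "sqn x0 {..<n} = 1"
    "\<And>y. qf E y {..<n} {..<n} \<le> qf E x0 {..<n} {..<n} * sqn y {..<n}"
    using rayleigh_max_exists[OF n] by blast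
  define \<mu> where "\<mu> = qf E x0 {..<n} {..<n}"
  define x where "x v = \<bar>x0 v\<bar>" for v
  have sx: "sqn x {..<n} = 1" using x0(1) unfolding x_def sqn_def by simp
  have "\<mu> \<le> qf E x {..<n} {..<n}" unfolding \<mu>_def x_def by (rule qf_abs_le)
  hence eq: "qf E x {..<n} {..<n} = \<mu> * sqn x {..<n}" using x0(2)[of x] sx unfolding \<mu>_def by simp
  have eig: "nsum E x {..<n} v = \<mu> * x v" if "v < n" for v
    using rayleigh_eq_imp_eigen[OF G x0(2)[folded \<mu>_def] eq that] .
  have ev: "eigenvalue (adj_mat n E) \<mu>"
    unfolding eigenvalue_adj_iff using eig sx by (intro exI[of _ x]) auto
  have ub: "\<nu> \<le> \<mu>" if \<nu>: "eigenvalue (adj_mat n E) \<nu>" for \<nu>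
  proof -
    obtain y where y: "sqn y {..<n} \<noteq> 0" "\<And>v. v < n \<Longrightarrow> nsum E y {..<n} v = \<nu> * y v"
      using \<nu> unfolding eigenvalue_adj_iff by blast
    have "qf E y {..<n} {..<n} = \<nu> * sqn y {..<n}"
      unfolding qf_def sqn_def sum_distrib_left
      by (intro sum.cong) (auto simp: y(2) power2_eq_square)
    hence "\<nu> * sqn y {..<n} \<le> \<mu> * sqn y {..<n}" using x0(2)[of y] unfolding \<mu>_def by simp
    moreover have "sqn y {..<n} > 0" using y(1) sqn_nonneg[of y "{..<n}"] by linarith
    ultimately show ?thesis by simp
  qed
  have fin: "finite {\<nu>. eigenvalue (adj_mat n E) \<nu>}"
  proof -
    have "char_poly (adj_mat n E) \<noteq> 0"
      using degree_monic_char_poly[OF adj_mat_carrier[of n E]] by auto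
    thus ?thesis
      unfolding eigenvalue_root_char_poly[OF adj_mat_carrier] by (rule poly_roots_finite)
  qed
  have "spec_rad n E = \<mu>" unfolding spec_rad_def
    using ev ub fin by (intro Max_eqI) auto
  thus "qf E y {..<n} {..<n} \<le> spec_rad n E * sqn y {..<n}"
    "\<exists>x. (\<forall>v. 0 \<le> x v) \<and> sqn x {..<n} \<noteq> 0 \<and> (\<forall>v<n. nsum E x {..<n} v = spec_rad n E * x v)"
    using x0(2)[of y] eig sx unfolding \<mu>_def by (auto intro!: exI[of _ x] simp: x_def)
qed

section \<open>The Erdos-Gallai theorem for paths\<close>

lemma has_cycle_of_list:
  assumes "distinct cs" "cs \<noteq> []" "set cs \<subseteq> {..<n}" "successively E cs" "E (last cs) (hd cs)"
  shows "has_cycle n E (length cs)"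
proof -
  have "E (cs ! i) (cs ! ((i + 1) mod length cs))" if i: "i < length cs" for i
  proof (cases "Suc i = length cs")
    case True
    hence "cs ! i = last cs" using assms(2) by (metis last_conv_nth diff_Suc_1)
    thus ?thesis using True assms(2,5) by (simp add: hd_conv_nth)
  next
    case False
    thus ?thesis using i assms(4) by (simp add: successively_conv_nth)
  qed
  moreover have "inj_on ((!) cs) {0..<length cs}"
    using assms(1) by (simp add: inj_on_def nth_eq_iff_index_eq)
  moreover have "(!) cs ` {0..<length cs} \<subseteq> {0..<n}" using assms(3) by (force simp: set_conv_nth)
  ultimately show ?thesis unfolding has_cycle_def by blast
qed

text \<open>Cut the cycle just before \<open>w\<close> and put \<open>v\<close> in front.\<close>

lemma longer_path_of_cycle:
  assumes "distinct cs" "successively E cs" "E (last cs) (hd cs)" "w \<in> set cs" "E v w" "v \<notin> set cs"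
  shows "\<exists>zs. distinct zs \<and> successively E zs \<and> set zs = insert v (set cs) \<and> length zs = Suc (length cs)"
proof -
  obtain ys us where cs: "cs = ys @ w # us" using assms(4) by (meson split_list)
  let ?zs = "v # w # us @ ys"
  have "successively E ?zs"
  proof (cases "ys = []")
    case True
    thus ?thesis using assms cs by simp
  next
    case False
    have "E (last (w # us)) (hd ys)" using assms(3) False unfolding cs by simp
    thus ?thesis using assms(2,5) False unfolding cs
      by (auto simp: successively_append_iff successively_Cons split: if_splits)
  qed
  moreover have "distinct ?zs" "set ?zs = insert v (set cs)" "length ?zs = Suc (length cs)"
    using assms(1,6) unfolding cs by auto
  ultimately show ?thesis by blast
qed

definition deg :: "(nat \<Rightarrow> nat \<Rightarrow> bool) \<Rightarrow> nat set \<Rightarrow> nat \<Rightarrow> nat" where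
  "deg E X v = card {w \<in> X. E v w}"

lemma deg_le_card: "finite X \<Longrightarrow> deg E X v \<le> card X"
  unfolding deg_def by (rule card_mono) auto

lemma deg_Un_disjoint:
  assumes "finite X" "finite Y" "X \<inter> Y = {}"
  shows "deg E (X \<union> Y) v = deg E X v + deg E Y v"
proof -
  have "{w \<in> X \<union> Y. E v w} = {w \<in> X. E v w} \<union> {w \<in> Y. E v w}" by auto
  thus ?thesis unfolding deg_def using assms by (simp add: card_Un_disjoint disjoint_iff)
qed

lemma deg_eq_sum: "finite X \<Longrightarrow> deg E X v = (\<Sum>w\<in>X. if E v w then 1 else 0)"
  unfolding deg_def by (simp add: sum.If_cases Int_def)

lemma sum_deg_commute:
  assumes "simple_graph n E" "finite X" "finite Y"
  shows "(\<Sum>v\<in>X. deg E Y v) = (\<Sum>w\<in>Y. deg E X w)"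
proof -
  have "(\<Sum>v\<in>X. deg E Y v) = (\<Sum>v\<in>X. \<Sum>w\<in>Y. if E v w then 1 else 0)"
    using assms by (simp add: deg_eq_sum)
  also have "\<dots> = (\<Sum>w\<in>Y. \<Sum>v\<in>X. if E v w then 1 else 0)" by (rule sum.swap)
  also have "\<dots> = (\<Sum>w\<in>Y. deg E X w)"
    using assms(2) by (simp add: deg_eq_sum simple_graph_commute[OF assms(1)])
  finally show ?thesis .
qed

text \<open>Posa's rotation argument: a longest path closes up to a cycle on the same vertices as soon as
  the degrees of its two ends add up to at least its number of vertices.\<close>
lemma longest_path_closes:
  assumes G: "simple_graph n E" and fin: "finite X"
    and zs: "distinct zs" "successively E zs" "set zs \<subseteq> X" "zs \<noteq> []"
    and longest: "\<And>us. distinct us \<Longrightarrow> successively E us \<Longrightarrow> set us \<subseteq> X \<Longrightarrow> length us \<le> length zs"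
    and deg: "deg E X (hd zs) + deg E X (last zs) \<ge> length zs"
  obtains cs where "distinct cs" "successively E cs" "set cs = set zs" "length cs = length zs" "E (last cs) (hd cs)"
proof -
  define p where "p = length zs"
  have p: "p > 0" using zs(4) unfolding p_def by simp
  have hdz: "hd zs = zs ! 0" and lastz: "last zs = zs ! (p - 1)"
    using zs(4) by (simp_all add: hd_conv_nth last_conv_nth p_def)
  have n1: "w \<in> set zs" if "w \<in> X" "E (hd zs) w" for w
  proof (rule ccontr)
    assume "w \<notin> set zs"
    hence "length (w # zs) \<le> length zs"
      using zs that G by (intro longest) (auto simp: successively_Cons simple_graph_commute[OF G])
    thus False by simp
  qed
  have n2: "w \<in> set zs" if "w \<in> X" "E (last zs) w" for w
  proof (rule ccontr)
    assume "w \<notin> set zs"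
    hence "length (zs @ [w]) \<le> length zs"
      using zs that by (intro longest) (auto simp: successively_append_iff)
    thus False by simp
  qed
  \<comment> \<open>Positions where the path can be rewired: in \<open>I\<close> the first vertex
    sees the successor, in \<open>J\<close> the last vertex sees the position itself. There are
    \<open>p - 1\<close> positions and at least \<open>p\<close> such adjacencies, so the two sets
    meet.\<close>
  define I where "I = {i. i < p - 1 \<and> E (hd zs) (zs ! Suc i)}"
  define J where "J = {i. i < p - 1 \<and> E (last zs) (zs ! i)}"
  have fI: "finite I" "finite J" unfolding I_def J_def by auto
  have "{w \<in> X. E (hd zs) w} \<subseteq> (\<lambda>i. zs ! Suc i) ` I"
  proof
    fix w assume w: "w \<in> {w \<in> X. E (hd zs) w}"
    then obtain i where i: "i < p" "w = zs ! i" using n1 by (auto simp: in_set_conv_nth p_def)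
    have "i \<noteq> 0" using w i simple_graph_irrefl[OF G] hdz by (metis mem_Collect_eq)
    then obtain j where "i = Suc j" using not0_implies_Suc by blast
    thus "w \<in> (\<lambda>i. zs ! Suc i) ` I" using i w unfolding I_def by auto
  qed
  hence cI: "deg E X (hd zs) \<le> card I" unfolding deg_def using fI by (rule_tac surj_card_le)
  have "{w \<in> X. E (last zs) w} \<subseteq> (\<lambda>i. zs ! i) ` J"
  proof
    fix w assume w: "w \<in> {w \<in> X. E (last zs) w}"
    then obtain i where i: "i < p" "w = zs ! i" using n2 by (auto simp: in_set_conv_nth p_def)
    have "i \<noteq> p - 1" using w i simple_graph_irrefl[OF G] lastz by auto
    thus "w \<in> (\<lambda>i. zs ! i) ` J" using i w unfolding J_def by auto
  qed
  hence cJ: "deg E X (last zs) \<le> card J" unfolding deg_def using fI by (rule_tac surj_card_le)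
  have "I \<inter> J \<noteq> {}"
  proof
    assume "I \<inter> J = {}"
    hence "card I + card J = card (I \<union> J)" using fI by (simp add: card_Un_disjoint)
    also have "\<dots> \<le> card {..<p - 1}" by (rule card_mono) (auto simp: I_def J_def)
    finally have "card I + card J \<le> p - 1" by simp
    thus False using cI cJ deg p unfolding p_def by linarith
  qed
  then obtain i where i: "i < p - 1" "E (hd zs) (zs ! Suc i)" "E (last zs) (zs ! i)"
    unfolding I_def J_def by auto
  \<comment> \<open>Run up to position \<open>i\<close>, jump to the last vertex and return along
    the reversed tail; the walk stops at the successor of position \<open>i\<close>, which is
    adjacent to the start.\<close>
  let ?cs = "take (Suc i) zs @ rev (drop (Suc i) zs)"
  have ne: "take (Suc i) zs \<noteq> []" "drop (Suc i) zs \<noteq> []" using i unfolding p_def by auto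
  have s: "successively E (take (Suc i) zs)" "successively E (drop (Suc i) zs)"
    using zs(2) by (metis append_take_drop_id successively_append_iff)+
  have "last (take (Suc i) zs) = zs ! i" using i unfolding p_def by (simp add: take_Suc_conv_app_nth)
  moreover have "hd (rev (drop (Suc i) zs)) = last zs" using i by (simp add: hd_rev p_def)
  moreover have "successively E (rev (drop (Suc i) zs))"
  proof -
    have "(\<lambda>x y. E y x) = E" using simple_graph_commute[OF G] by blast
    thus ?thesis using s(2) by (metis successively_rev)
  qed
  ultimately have "successively E ?cs"
    using s(1) i(3) simple_graph_commute[OF G] by (simp add: successively_append_iff)
  moreover have "distinct ?cs" using zs(1) by (simp add: set_take_disj_set_drop_if_distinct)
  moreover have "set ?cs = set zs" by (metis append_take_drop_id set_append set_rev)
  moreover have "length ?cs = length zs" by simp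
  moreover have "E (last ?cs) (hd ?cs)"
  proof -
    have "last ?cs = zs ! Suc i" using ne i unfolding p_def by (simp add: last_rev hd_drop_conv_nth)
    moreover have "hd ?cs = hd zs" using ne by simp
    ultimately show ?thesis using i simple_graph_commute[OF G] by simp
  qed
  ultimately show ?thesis using that by blast
qed

text \<open>A vertex of degree at most \<open>k - 1\<close> is deleted and lowers the degree sum by
  at most \<open>2 * (k - 1)\<close>. If there is none, the two ends of a longest path have degree
  sum at least \<open>2 * k\<close>, so the path closes to a cycle. By maximality no edge leaves the
  vertex set of that cycle; it has at most \<open>2 * k - 1\<close> vertices and is removed as a
  whole.\<close>

theorem erdos_gallai_path:
  assumes G: "simple_graph n E" and "finite X" and "k \<ge> 1"
    and "\<And>zs. distinct zs \<Longrightarrow> successively E zs \<Longrightarrow> set zs \<subseteq> X \<Longrightarrow> length zs < 2 * k"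
  shows "(\<Sum>v\<in>X. deg E X v) \<le> 2 * (k - 1) * card X"
  using assms(2,4)
proof (induction "card X" arbitrary: X rule: less_induct)
  case less
  note fin = less.prems(1) and short = less.prems(2)
  show ?case
  proof (cases "X = {}")
    case True thus ?thesis by simp
  next
    case ne: False
    show ?thesis
    proof (cases "\<exists>v\<in>X. deg E X v \<le> k - 1")
      case True
      then obtain v where v: "v \<in> X" "deg E X v \<le> k - 1" by blast
      let ?Y = "X - {v}"
      have X: "X = ?Y \<union> {v}" using v by auto
      have d: "deg E X w = deg E ?Y w + deg E {v} w" for w
        by (subst X, rule deg_Un_disjoint) (use fin in auto)
      have vv: "deg E {v} v = 0" unfolding deg_def using simple_graph_irrefl[OF G] by simp
      have "(\<Sum>w\<in>?Y. deg E X w) = (\<Sum>w\<in>?Y. deg E ?Y w) + (\<Sum>w\<in>?Y. deg E {v} w)"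
        by (simp add: d sum.distrib)
      also have "(\<Sum>w\<in>?Y. deg E {v} w) = deg E ?Y v"
        using sum_deg_commute[OF G, of ?Y "{v}"] fin by simp
      also have "deg E ?Y v = deg E X v" using d[of v] vv by simp
      finally have "(\<Sum>w\<in>X. deg E X w) = (\<Sum>w\<in>?Y. deg E ?Y w) + 2 * deg E X v"
        using sum.remove[OF fin v(1), of "deg E X"] by simp
      also have "(\<Sum>w\<in>?Y. deg E ?Y w) \<le> 2 * (k - 1) * card ?Y"
        proof (rule less.hyps)
          show "card ?Y < card X" using v fin by (metis card_Diff1_less)
        next
        show "finite ?Y" using fin by simp
      next
        fix zs assume "distinct zs" "successively E zs" "set zs \<subseteq> ?Y"
        thus "length zs < 2 * k" using short[of zs] by auto
      qed
      also have "2 * deg E X v \<le> 2 * (k - 1)" using v by simp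
      also have "2 * (k - 1) * card ?Y + 2 * (k - 1) = 2 * (k - 1) * card X"
        by (simp only: card.remove[OF fin v(1)] mult_Suc_right add.commute)
      finally show ?thesis by simp
    next
      case False
      hence big: "deg E X v \<ge> k" if "v \<in> X" for v using that by force
      define P where "P zs \<longleftrightarrow> distinct zs \<and> successively E zs \<and> set zs \<subseteq> X \<and> zs \<noteq> []" for zs
      obtain v0 where "v0 \<in> X" using ne by blast
      hence "P [v0]" unfolding P_def by simp
      moreover have "\<forall>zs. P zs \<longrightarrow> length zs < 2 * k" unfolding P_def using short by blast
      ultimately obtain zs where zs: "P zs" "\<And>us. P us \<Longrightarrow> length us \<le> length zs"
        using ex_has_greatest_nat[of P "[v0]" length "2 * k"] by blast
      have len: "length zs \<le> 2 * k - 1" using short[of zs] zs(1) unfolding P_def by simp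
      have mem: "hd zs \<in> X" "last zs \<in> X" using zs(1) unfolding P_def by auto
      obtain cs where cs: "distinct cs" "successively E cs" "set cs = set zs"
        "length cs = length zs" "E (last cs) (hd cs)"
      proof (rule longest_path_closes[OF G fin])
        show "distinct zs" "successively E zs" "set zs \<subseteq> X" "zs \<noteq> []" using zs(1) unfolding P_def by auto
        show "length us \<le> length zs" if "distinct us" "successively E us" "set us \<subseteq> X" for us
          using zs(2)[of us] that unfolding P_def by (cases "us = []") auto
        show "length zs \<le> deg E X (hd zs) + deg E X (last zs)"
          using big[OF mem(1)] big[OF mem(2)] len by simp
      qed blast
      let ?C = "set zs" and ?Y = "X - set zs"
      have C: "?C \<subseteq> X" "?C \<noteq> {}" using zs(1) unfolding P_def by auto
      have nocross: "\<not> E v w" if v: "v \<in> ?Y" and w: "w \<in> ?C" for v w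
      proof
        assume "E v w"
        then obtain us where us: "distinct us" "successively E us" "set us = insert v (set cs)"
          "length us = Suc (length cs)"
          using longer_path_of_cycle[OF cs(1,2,5), of w v] v w cs(3) by auto
        have "P us" unfolding P_def using us cs(3) C v by auto
        thus False using zs(2)[of us] us(4) cs(4) by simp
      qed
      have X: "X = ?Y \<union> ?C" using C by auto
      have "deg E X v = deg E ?C v" if "v \<in> ?C" for v
      proof -
        have "{w \<in> X. E v w} = {w \<in> ?C. E v w}"
          using that nocross C simple_graph_commute[OF G] by auto
        thus ?thesis unfolding deg_def by simp
      qed
      moreover have "deg E ?C v \<le> 2 * (k - 1)" if "v \<in> ?C" for v
      proof -
        have "{w \<in> ?C. E v w} \<subseteq> ?C - {v}" using simple_graph_irrefl[OF G] by auto
        hence "deg E ?C v \<le> card (?C - {v})" unfolding deg_def by (rule card_mono[rotated]) simp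
        also have "\<dots> = length zs - 1"
          using that zs(1) unfolding P_def by (simp add: distinct_card)
        finally show ?thesis using len by simp
      qed
      ultimately have 1: "(\<Sum>v\<in>?C. deg E X v) \<le> card ?C * (2 * (k - 1))"
        using sum_bounded_above[of ?C "deg E X" "2 * (k - 1)"] by simp
      have "deg E X v = deg E ?Y v" if "v \<in> ?Y" for v
      proof -
        have "{w \<in> X. E v w} = {w \<in> ?Y. E v w}" using that nocross by auto
        thus ?thesis unfolding deg_def by simp
      qed
      hence "(\<Sum>v\<in>?Y. deg E X v) = (\<Sum>v\<in>?Y. deg E ?Y v)" by (intro sum.cong) auto
      also have "\<dots> \<le> 2 * (k - 1) * card ?Y"
      proof (rule less.hyps)
        obtain z where "z \<in> ?C" using C(2) by (metis all_not_in_conv)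
        hence "?Y \<subset> X" using C(1) by blast
        thus "card ?Y < card X" using fin by (intro psubset_card_mono)
      next
        show "finite ?Y" using fin by simp
      next
        fix zs assume "distinct zs" "successively E zs" "set zs \<subseteq> ?Y"
        thus "length zs < 2 * k" using short[of zs] by auto
      qed
      finally have 2: "(\<Sum>v\<in>?Y. deg E X v) \<le> 2 * (k - 1) * card ?Y" .
      have "(\<Sum>v\<in>X. deg E X v) = (\<Sum>v\<in>?Y. deg E X v) + (\<Sum>v\<in>?C. deg E X v)"
        by (subst X, rule sum.union_disjoint) (use fin in auto)
      moreover have "card X = card ?Y + card ?C"
        by (subst X, rule card_Un_disjoint) (use fin in auto)
      ultimately show ?thesis using 1 2 by (simp add: algebra_simps)
    qed
  qed
qed

section \<open>Paths in dense bipartite graphs\<close>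

text \<open>Two vertices on the same side have at least \<open>N\<close> common neighbours, so
  \<open>N\<close> limits how long a path can be built greedily.\<close>

definition core :: "(nat \<Rightarrow> nat \<Rightarrow> bool) \<Rightarrow> nat set \<Rightarrow> nat set \<Rightarrow> nat \<Rightarrow> nat \<Rightarrow> bool" where
  "core E U W h N \<longleftrightarrow> finite U \<and> finite W \<and> U \<inter> W = {} \<and> 2 * h + N \<le> card U \<and> 2 * h + N \<le> card W \<and>
     (\<forall>u\<in>U. card {w\<in>W. \<not> E u w} \<le> h) \<and> (\<forall>w\<in>W. card {u\<in>U. \<not> E w u} \<le> h)"

lemma core_sym: "core E U W h N \<Longrightarrow> core E W U h N"
  unfolding core_def by auto

lemma ex_good_element:
  assumes "finite W" "finite F" "card {w\<in>W. \<not> P w} + card {w\<in>W. \<not> Q w} + card F < card W"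
  shows "\<exists>w\<in>W. P w \<and> Q w \<and> w \<notin> F"
proof (rule ccontr)
  assume "\<not> ?thesis"
  hence "W \<subseteq> {w\<in>W. \<not> P w} \<union> {w\<in>W. \<not> Q w} \<union> F" by auto
  hence "card W \<le> card ({w\<in>W. \<not> P w} \<union> {w\<in>W. \<not> Q w} \<union> F)"
    using assms by (intro card_mono) auto
  also have "\<dots> \<le> card {w\<in>W. \<not> P w} + card {w\<in>W. \<not> Q w} + card F"
    by (meson add_right_mono card_Un_le order_trans)
  finally show False using assms by simp
qed

text \<open>Here \<open>g\<close> counts edges. The path is grown greedily from \<open>u\<close>,
  the sides swapping roles at each step; only the last two edges are chosen together, through a
  common neighbour of the current vertex and \<open>v\<close>. The set \<open>F\<close> collects
  vertices already used.\<close>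

lemma core_path:
  assumes "core E U W h N" "simple_graph n E" "g \<ge> 2" "finite F" "card F + g \<le> N"
    "u \<in> U - F" "v \<in> (if even g then U else W) - F" "u \<noteq> v"
  shows "\<exists>zs. distinct (u # zs @ [v]) \<and> successively E (u # zs @ [v]) \<and>
     set zs \<subseteq> (U \<union> W) - F \<and> length zs = g - 1"
  using assms(3,1,2,4-)
proof (induction g arbitrary: U W u F rule: nat_induct_at_least)
  case base
  hence v: "v \<in> U" "v \<notin> F" by auto
  have "\<exists>w\<in>W. E u w \<and> E v w \<and> w \<notin> F"
  proof (rule ex_good_element)
    have "card {w\<in>W. \<not> E u w} \<le> h" "card {w\<in>W. \<not> E v w} \<le> h" "card W \<ge> 2 * h + N"
      using base v unfolding core_def by auto
    thus "card {w \<in> W. \<not> E u w} + card {w \<in> W. \<not> E v w} + card F < card W"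
      using base by linarith
  qed (use base in \<open>auto simp: core_def\<close>)
  then obtain w where w: "w \<in> W" "E u w" "E v w" "w \<notin> F" by blast
  have "w \<noteq> u" "w \<noteq> v" using w simple_graph_irrefl[OF base.prems(2)] by auto
  moreover have "E w v" using w simple_graph_commute[OF base.prems(2)] by blast
  ultimately show ?case using w base by (intro exI[of _ "[w]"]) auto
next
  case (Suc g)
  \<comment> \<open>The greedy step must not use up the prescribed endpoint
    \<open>v\<close>.\<close>
  let ?F = "insert v F"
  have cF: "card ?F \<le> Suc (card F)" using Suc.prems by (simp add: card_insert_if)
  have "\<exists>w\<in>W. E u w \<and> True \<and> w \<notin> ?F"
  proof (rule ex_good_element)
    have "card {w\<in>W. \<not> E u w} \<le> h" "card W \<ge> 2 * h + N"
      using Suc.prems unfolding core_def by auto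
    thus "card {w \<in> W. \<not> E u w} + card {w \<in> W. \<not> True} + card ?F < card W"
      using Suc.prems Suc.hyps cF by simp
  qed (use Suc.prems in \<open>auto simp: core_def\<close>)
  then obtain w where w: "w \<in> W" "E u w" "w \<noteq> v" "w \<notin> F" by blast
  have wu: "w \<noteq> u" using w simple_graph_irrefl[OF Suc.prems(2)] by auto
  have "\<exists>zs. distinct (w # zs @ [v]) \<and> successively E (w # zs @ [v]) \<and>
     set zs \<subseteq> (W \<union> U) - insert u F \<and> length zs = g - 1"
  proof (rule Suc.IH)
    show "core E W U h N" using Suc.prems(1) by (rule core_sym)
    show "card (insert u F) + g \<le> N"
      using Suc.prems by (simp add: card_insert_if)
    show "v \<in> (if even g then W else U) - insert u F" using Suc.prems by auto
  qed (use Suc.prems Suc.hyps w wu in auto)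
  then obtain zs where zs: "distinct (w # zs @ [v])" "successively E (w # zs @ [v])"
     "set zs \<subseteq> (W \<union> U) - insert u F" "length zs = g - 1" by blast
  show ?case
  proof (intro exI conjI)
    show "distinct (u # (w # zs) @ [v])" using zs wu Suc.prems by auto
    show "successively E (u # (w # zs) @ [v])" using zs(2) w by (simp add: successively_Cons)
    show "set (w # zs) \<subseteq> (U \<union> W) - F" using zs w by auto
    show "length (w # zs) = Suc g - 1" using zs Suc.hyps by simp
  qed
qed

text \<open>A strict majority, so that any two such neighbourhoods in \<open>W\<close> intersect.
  This weaker condition replaces membership in the core for the ends of a path.\<close>

definition maj :: "(nat \<Rightarrow> nat \<Rightarrow> bool) \<Rightarrow> nat set \<Rightarrow> nat \<Rightarrow> bool" where
  "maj E W v \<longleftrightarrow> card W < 2 * card {w\<in>W. E v w}"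

lemma card_split_pred: "finite W \<Longrightarrow> card {w\<in>W. P w} + card {w\<in>W. \<not> P w} = card W"
proof -
  assume "finite W"
  moreover have "W = {w\<in>W. P w} \<union> {w\<in>W. \<not> P w}" by auto
  moreover have "{w\<in>W. P w} \<inter> {w\<in>W. \<not> P w} = {}" by auto
  ultimately show ?thesis by (metis card_Un_disjoint finite_Un)
qed

lemma core_maj:
  assumes "core E U W h N" "N > 0" "u \<in> U" shows "maj E W u"
proof -
  have "card {w\<in>W. \<not> E u w} \<le> h" "2 * h + N \<le> card W" "finite W" using assms unfolding core_def by auto
  thus ?thesis using card_split_pred[of W "E u"] assms(2) unfolding maj_def by linarith
qed

lemma maj_ex:
  assumes "finite W" "maj E W u" "finite F" "2 * card F < card W"
  shows "\<exists>w\<in>W. E u w \<and> w \<notin> F"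
proof -
  have "\<exists>w\<in>W. E u w \<and> True \<and> w \<notin> F"
    using assms card_split_pred[of W "E u"] unfolding maj_def by (intro ex_good_element) auto
  thus ?thesis by blast
qed

text \<open>Two strict majorities share a vertex, which settles \<open>g = 2\<close>. A longer link
  enters the core through one neighbour of each end and continues with a core path of length
  \<open>g - 2\<close>.\<close>

lemma link_same:
  assumes c: "core E U W h N" and G: "simple_graph n E" and u: "maj E W u" "maj E W u'" "u \<noteq> u'"
    and g: "even g" "2 \<le> g" "g + 6 \<le> N + 2"
  shows "\<exists>zs. distinct (u # zs @ [u']) \<and> successively E (u # zs @ [u']) \<and> set zs \<subseteq> U \<union> W \<and> length zs = g - 1"
proof -
  have fin: "finite W" "finite U" "U \<inter> W = {}" and cW: "2 * h + N \<le> card W" "2 * h + N \<le> card U"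
    using c unfolding core_def by auto
  show ?thesis
  proof (cases "g = 2")
    case True
    have "\<exists>w\<in>W. E u w \<and> E u' w \<and> w \<notin> {}"
      using u card_split_pred[OF fin(1), of "E u"] card_split_pred[OF fin(1), of "E u'"] fin(1)
      unfolding maj_def by (intro ex_good_element) auto
    then obtain w where w: "w \<in> W" "E u w" "E u' w" by blast
    have "w \<noteq> u" "w \<noteq> u'" using w simple_graph_irrefl[OF G] by auto
    moreover have "E w u'" using w simple_graph_commute[OF G] by blast
    ultimately show ?thesis using w u True by (intro exI[of _ "[w]"]) auto
  next
    case False
    hence g4: "g \<ge> 4" using g by presburger
    obtain w where w: "w \<in> W" "E u w" "w \<noteq> u'"
      using maj_ex[OF fin(1) u(1), of "{u'}"] cW g g4 by auto
    have cc: "card {u, w} \<le> 2" by (simp add: card_insert_if)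
    obtain w' where w': "w' \<in> W" "E u' w'" "w' \<noteq> u" "w' \<noteq> w"
      using maj_ex[OF fin(1) u(2), of "{u,w}"] cW g g4 cc by auto
    have ne: "w \<noteq> u" "w' \<noteq> u'" using w w' simple_graph_irrefl[OF G] by auto
    have "\<exists>zs. distinct (w # zs @ [w']) \<and> successively E (w # zs @ [w']) \<and>
      set zs \<subseteq> (W \<union> U) - {u,u'} \<and> length zs = (g - 2) - 1"
      using core_sym[OF c] G g g4 w w' ne u
      by (intro core_path[where h=h and N=N and n=n]) (auto simp: card_insert_if)
    then obtain zs where zs: "distinct (w # zs @ [w'])" "successively E (w # zs @ [w'])"
      "set zs \<subseteq> (W \<union> U) - {u,u'}" "length zs = (g - 2) - 1" by blast
    have "E w' u'" using w' simple_graph_commute[OF G] by blast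
    hence "successively E ((w # zs @ [w']) @ [u'])"
    using zs(2) by (subst successively_append_iff) simp
  hence "successively E (u # (w # zs @ [w']) @ [u'])"
      using w by (simp add: successively_Cons)
    moreover have "distinct (u # (w # zs @ [w']) @ [u'])" using zs u w w' ne by auto
    ultimately show ?thesis using zs w w' g4 by (intro exI[of _ "w # zs @ [w']"]) auto
  qed
qed

text \<open>The entry points \<open>w\<close> and \<open>t\<close> are chosen adjacent, which
  already gives a link of length 3. For larger \<open>g\<close> the edge between them is replaced by
  a core path of odd length \<open>g - 2\<close>.\<close>

lemma link_opposite:
  assumes c: "core E U W h N" and G: "simple_graph n E" and u: "maj E W u" "maj E U u'" "u \<noteq> u'"
    and g: "odd g" "3 \<le> g" "g + 6 \<le> N + 2"
  shows "\<exists>zs. distinct (u # zs @ [u']) \<and> successively E (u # zs @ [u']) \<and> set zs \<subseteq> U \<union> W \<and> length zs = g - 1"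
proof -
  have fin: "finite W" "finite U" "U \<inter> W = {}" and cW: "2 * h + N \<le> card W" "2 * h + N \<le> card U"
    using c unfolding core_def by auto
  obtain w where w: "w \<in> W" "E u w" "w \<noteq> u'"
      using maj_ex[OF fin(1) u(1), of "{u'}"] cW g by auto
  have "\<exists>t\<in>U. E u' t \<and> E w t \<and> t \<notin> {u}"
  proof (rule ex_good_element)
    have "card {t\<in>U. \<not> E w t} \<le> h" using c w unfolding core_def by auto
    thus "card {t \<in> U. \<not> E u' t} + card {t \<in> U. \<not> E w t} + card {u} < card U"
      using u(2) card_split_pred[OF fin(2), of "E u'"] cW g unfolding maj_def by simp
  qed (use fin in auto)
  then obtain t where t: "t \<in> U" "E u' t" "E w t" "t \<noteq> u" by blast
  have ne: "w \<noteq> u" "t \<noteq> u'" "w \<noteq> t" using w t fin simple_graph_irrefl[OF G] by auto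
  have "\<exists>zs. distinct (w # zs @ [t]) \<and> successively E (w # zs @ [t]) \<and>
      set zs \<subseteq> (W \<union> U) - {u,u'} \<and> length (w # zs @ [t]) = g - 1"
  proof (cases "g = 3")
    case True
    thus ?thesis using t ne by (intro exI[of _ "[]"]) auto
  next
    case False
    hence g5: "g \<ge> 5" using g by presburger
    have "\<exists>zs. distinct (w # zs @ [t]) \<and> successively E (w # zs @ [t]) \<and>
      set zs \<subseteq> (W \<union> U) - {u,u'} \<and> length zs = (g - 2) - 1"
      using core_sym[OF c] G g g5 w t ne u
      by (intro core_path[where h=h and N=N and n=n]) (auto simp: card_insert_if)
    thus ?thesis using g5 by auto
  qed
  then obtain zs where zs: "distinct (w # zs @ [t])" "successively E (w # zs @ [t])"
      "set zs \<subseteq> (W \<union> U) - {u,u'}" "length (w # zs @ [t]) = g - 1" by blast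
  have "E t u'" using t simple_graph_commute[OF G] by blast
  hence "successively E ((w # zs @ [t]) @ [u'])"
    using zs(2) by (subst successively_append_iff) simp
  hence "successively E (u # (w # zs @ [t]) @ [u'])"
    using w by (simp add: successively_Cons)
  moreover have "distinct (u # (w # zs @ [t]) @ [u'])" using zs u w t ne by auto
  ultimately show ?thesis using zs w t by (intro exI[of _ "w # zs @ [t]"]) auto
qed

section \<open>Quadratic forms over vertex sets, paths and complete bipartite graphs\<close>

lemma nsum_Un:
  assumes "finite X" "finite Y" "X \<inter> Y = {}"
  shows "nsum E x (X \<union> Y) v = nsum E x X v + nsum E x Y v"
  unfolding nsum_def using assms by (rule sum.union_disjoint)

lemma qf_Un_left:
  assumes "finite X" "finite Y" "X \<inter> Y = {}"
  shows "qf E x (X \<union> Y) Z = qf E x X Z + qf E x Y Z"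
  unfolding qf_def using assms by (rule sum.union_disjoint)

lemma qf_Un_right:
  assumes "finite X" "finite Y" "X \<inter> Y = {}"
  shows "qf E x Z (X \<union> Y) = qf E x Z X + qf E x Z Y"
  unfolding qf_def nsum_Un[OF assms] by (simp add: algebra_simps sum.distrib)

lemma sqn_Un:
  assumes "finite X" "finite Y" "X \<inter> Y = {}"
  shows "sqn x (X \<union> Y) = sqn x X + sqn x Y"
  unfolding sqn_def using assms by (rule sum.union_disjoint)

lemma qf_alt: "qf E x X Y = (\<Sum>v\<in>X. \<Sum>w\<in>Y. if E v w then x v * x w else 0)"
  unfolding qf_def nsum_def sum_distrib_left by (intro sum.cong) auto

lemma qf_commute:
  assumes "simple_graph n E" shows "qf E x X Y = qf E x Y X"
  unfolding qf_alt
  by (subst sum.swap, intro sum.cong refl)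
     (use simple_graph_commute[OF assms] in \<open>auto simp: mult.commute\<close>)

lemma qf_Un_square:
  assumes "simple_graph n E" "finite X" "finite Y" "X \<inter> Y = {}"
  shows "qf E x (X \<union> Y) (X \<union> Y) = qf E x X X + 2 * qf E x X Y + qf E x Y Y"
  using qf_commute[OF assms(1), of x Y X] by (simp add: qf_Un_left qf_Un_right assms)

lemma nsum_le_sum: "finite Y \<Longrightarrow> (\<And>w. 0 \<le> x w) \<Longrightarrow> nsum E x Y v \<le> sum x Y"
  unfolding nsum_def by (intro sum_mono) auto

lemma qf_le_sum_mult: "finite Y \<Longrightarrow> (\<And>w. 0 \<le> x w) \<Longrightarrow> qf E x X Y \<le> sum x X * sum x Y"
  unfolding qf_def sum_distrib_right by (intro sum_mono mult_left_mono nsum_le_sum) auto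

lemma qf_eq_0: "(\<And>u v. u \<in> X \<Longrightarrow> v \<in> Y \<Longrightarrow> \<not> E u v) \<Longrightarrow> qf E x X Y = 0"
  unfolding qf_alt by (intro sum.neutral ballI) simp

lemma nsum_eq_0: "(\<And>w. w \<in> Y \<Longrightarrow> \<not> E v w) \<Longrightarrow> nsum E x Y v = 0"
  unfolding nsum_def by (intro sum.neutral ballI) simp

lemma nsum_eq_sum_filter: "finite Y \<Longrightarrow> nsum E x Y v = sum x {w\<in>Y. E v w}"
  unfolding nsum_def by (simp add: sum.If_cases Int_def)

lemma qf_disj:
  assumes "\<And>u v. u \<in> X \<Longrightarrow> v \<in> Y \<Longrightarrow> \<not> (P u v \<and> Q u v)"
  shows "qf (\<lambda>u v. P u v \<or> Q u v) x X Y = qf P x X Y + qf Q x X Y"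
  unfolding qf_alt sum.distrib[symmetric]
  by (intro sum.cong refl) (use assms in auto)

lemma qf_cong:
  assumes "\<And>u v. u \<in> X \<Longrightarrow> v \<in> Y \<Longrightarrow> P u v \<longleftrightarrow> Q u v"
  shows "qf P x X Y = qf Q x X Y"
  unfolding qf_alt by (intro sum.cong refl) (simp add: assms)

lemma qf_eigen:
  assumes "\<And>v. v \<in> X \<Longrightarrow> nsum E x Y v = c * x v"
  shows "qf E x X Y = c * sqn x X"
  unfolding qf_def sqn_def sum_distrib_left
  by (intro sum.cong refl) (simp add: assms power2_eq_square)

text \<open>The weight of a path given by its vertex list: half of its quadratic form when the
  entries are distinct.\<close>

fun psum :: "(nat \<Rightarrow> real) \<Rightarrow> nat list \<Rightarrow> real" where
  "psum x (a # b # zs) = x a * x b + psum x (b # zs)"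
| "psum x _ = 0"

lemma psum_append: "psum x (xs @ y # ys) = psum x (xs @ [y]) + psum x (y # ys)"
proof (induction xs)
  case Nil
  show ?case by (cases ys) auto
next
  case (Cons a xs)
  thus ?case by (cases xs) auto
qed

lemma psum_rev: "psum x (rev zs) = psum x zs"
proof (induction zs)
  case (Cons a zs)
  show ?case
  proof (cases zs)
    case (Cons b us)
    have "psum x (rev zs @ [a]) = psum x (rev us @ [b, a])" using Cons by simp
    also have "\<dots> = psum x (rev us @ [b]) + psum x [b, a]" by (rule psum_append)
    also have "rev us @ [b] = rev zs" using Cons by simp
    finally show ?thesis using Cons.IH Cons by simp
  qed simp
qed simp

lemma psum_nonneg: "(\<And>v. 0 \<le> x v) \<Longrightarrow> 0 \<le> psum x zs"
  by (induction x zs rule: psum.induct) auto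

text \<open>Lets a test vector on a reference graph copy the entries that an eigenvector has along a
  path of another graph.\<close>

lemma psum_map_cong: "map x zs = map y us \<Longrightarrow> psum x zs = psum y us"
proof (induction x zs arbitrary: us rule: psum.induct)
  case (1 x a b zs)
  then obtain a' b' vs where us: "us = a' # b' # vs" by (cases us; cases "tl us") auto
  show ?case using 1 unfolding us by auto
next
  case ("2_1" x)
  thus ?case by simp
next
  case ("2_2" x v)
  then obtain v' where "us = [v']" by (cases us) auto
  thus ?case by simp
qed

lemma path_edge_Nil [simp]: "\<not> path_edge [] u v"
  unfolding path_edge_def by simp

lemma path_edge_singleton [simp]: "\<not> path_edge [a] u v"
  unfolding path_edge_def by simp

lemma path_edge_Cons:
  "path_edge (a # b # zs) u v \<longleftrightarrow> (u = a \<and> v = b) \<or> (v = a \<and> u = b) \<or> path_edge (b # zs) u v"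
proof
  assume "path_edge (a # b # zs) u v"
  then obtain i where i: "Suc i < length (a # b # zs)" "(u = (a # b # zs) ! i \<and> v = (a # b # zs) ! Suc i)
    \<or> (v = (a # b # zs) ! i \<and> u = (a # b # zs) ! Suc i)" unfolding path_edge_def by blast
  show "(u = a \<and> v = b) \<or> (v = a \<and> u = b) \<or> path_edge (b # zs) u v"
  proof (cases i)
    case 0 thus ?thesis using i by auto
  next
    case (Suc j)
    thus ?thesis using i unfolding path_edge_def by auto
  qed
next
  assume *: "(u = a \<and> v = b) \<or> (v = a \<and> u = b) \<or> path_edge (b # zs) u v"
  show "path_edge (a # b # zs) u v"
  proof (cases "path_edge (b # zs) u v")
    case True
    then obtain i where "Suc i < length (b # zs)" "(u = (b # zs) ! i \<and> v = (b # zs) ! Suc i)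
      \<or> (v = (b # zs) ! i \<and> u = (b # zs) ! Suc i)" unfolding path_edge_def by blast
    thus ?thesis unfolding path_edge_def by (intro exI[of _ "Suc i"]) auto
  next
    case False
    thus ?thesis using * unfolding path_edge_def by (intro exI[of _ 0]) auto
  qed
qed

lemma path_edge_sym: "path_edge zs u v \<longleftrightarrow> path_edge zs v u"
  unfolding path_edge_def by blast

lemma path_edge_set: "path_edge zs u v \<Longrightarrow> u \<in> set zs \<and> v \<in> set zs"
  unfolding path_edge_def using nth_mem Suc_lessD by blast

lemma path_edge_irrefl: "distinct zs \<Longrightarrow> \<not> path_edge zs u u"
  unfolding path_edge_def by (auto simp: nth_eq_iff_index_eq)

lemma path_edge_append:
  "path_edge (xs @ y # ys) u v \<longleftrightarrow> path_edge (xs @ [y]) u v \<or> path_edge (y # ys) u v"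
proof (induction xs)
  case (Cons a xs)
  show ?case
  proof (cases xs)
    case Nil thus ?thesis by (auto simp: path_edge_Cons)
  next
    case (Cons b us)
    thus ?thesis using Cons.IH by (auto simp: path_edge_Cons)
  qed
qed simp

lemma path_edge_rev: "path_edge (rev zs) u v \<longleftrightarrow> path_edge zs u v"
proof (induction zs)
  case (Cons a zs)
  show ?case
  proof (cases zs)
    case (Cons b us)
    have "path_edge (rev zs @ [a]) u v \<longleftrightarrow> path_edge (rev us @ [b, a]) u v" using Cons by simp
    also have "\<dots> \<longleftrightarrow> path_edge (rev us @ [b]) u v \<or> path_edge [b, a] u v" by (rule path_edge_append)
    also have "rev us @ [b] = rev zs" using Cons by simp
    finally show ?thesis using Cons.IH Cons by (auto simp: path_edge_Cons)
  qed simp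
qed simp

lemma qf_path_edge:
  assumes "finite V"
  shows "distinct zs \<Longrightarrow> set zs \<subseteq> V \<Longrightarrow> qf (path_edge zs) x V V = 2 * psum x zs"
proof (induction zs)
  case (Cons a zs)
  show ?case
  proof (cases zs)
    case Nil
    thus ?thesis by (simp add: qf_alt)
  next
    case (Cons b us)
    have ab: "a \<noteq> b" "a \<in> V" "b \<in> V" using Cons.prems Cons by auto
    let ?P = "\<lambda>u v. u = a \<and> v = b" and ?P' = "\<lambda>u v. u = b \<and> v = a"
    have one: "qf (\<lambda>u v. u = c \<and> v = d) x V V = x c * x d" if "c \<in> V" "d \<in> V" for c d
    proof -
      have "qf (\<lambda>u v. u = c \<and> v = d) x V V = (\<Sum>v\<in>V. if v = c then x c * x d else 0)"
        unfolding qf_alt using assms that by (intro sum.cong refl) (auto simp: if_distrib)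
      thus ?thesis using assms that by simp
    qed
    have na: "\<not> path_edge zs a v" "\<not> path_edge zs v a" for v
      using Cons.prems path_edge_set[of zs] by auto
    have "qf (path_edge (a # zs)) x V V = qf (\<lambda>u v. ?P u v \<or> (?P' u v \<or> path_edge zs u v)) x V V"
      unfolding Cons by (intro qf_cong) (auto simp: path_edge_Cons)
    also have "\<dots> = qf ?P x V V + (qf ?P' x V V + qf (path_edge zs) x V V)"
      using na ab by (subst qf_disj, blast, subst qf_disj, blast) simp
    also have "\<dots> = 2 * psum x (a # zs)"
      using Cons.IH Cons.prems Cons ab by (simp add: one algebra_simps)
    finally show ?thesis .
  qed
qed (simp add: qf_alt)

definition bipK :: "nat set \<Rightarrow> nat set \<Rightarrow> nat \<Rightarrow> nat \<Rightarrow> bool" where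
  "bipK A B u v \<longleftrightarrow> (u \<in> A \<and> v \<in> B) \<or> (u \<in> B \<and> v \<in> A)"

lemma qf_bipK:
  assumes "finite V" "A \<subseteq> V" "B \<subseteq> V" "A \<inter> B = {}"
  shows "qf (bipK A B) x V V = 2 * (sum x A * sum x B)"
proof -
  have one: "qf (\<lambda>u v. u \<in> X \<and> v \<in> Y) x V V = sum x X * sum x Y" if "X \<subseteq> V" "Y \<subseteq> V" for X Y
  proof -
    have "qf (\<lambda>u v. u \<in> X \<and> v \<in> Y) x V V = (\<Sum>u\<in>V. if u \<in> X then x u * sum x Y else 0)"
      unfolding qf_alt
    proof (intro sum.cong refl)
      fix u
      have "(\<Sum>v\<in>V. if v \<in> Y then x u * x v else 0) = x u * sum x Y"
        using assms(1) that(2) unfolding sum_distrib_left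
        by (simp add: sum.If_cases Int_absorb1)
      thus "(\<Sum>w\<in>V. if u \<in> X \<and> w \<in> Y then x u * x w else 0) = (if u \<in> X then x u * sum x Y else 0)"
        by simp
    qed
    also have "\<dots> = (\<Sum>u\<in>X. x u * sum x Y)"
      using assms(1) that(1) by (simp add: sum.If_cases Int_absorb1)
    finally show ?thesis by (simp add: sum_distrib_right)
  qed
  have "qf (bipK A B) x V V = qf (\<lambda>u v. (u \<in> A \<and> v \<in> B) \<or> (u \<in> B \<and> v \<in> A)) x V V"
    unfolding bipK_def by simp
  also have "\<dots> = sum x A * sum x B + sum x B * sum x A"
    using assms by (subst qf_disj) (auto simp: one)
  finally show ?thesis by simp
qed

section \<open>Complete bipartite graphs with one edge replaced by a path\<close>

definition SG :: "nat set \<Rightarrow> nat set \<Rightarrow> nat \<Rightarrow> nat \<Rightarrow> nat list \<Rightarrow> nat \<Rightarrow> nat \<Rightarrow> bool" where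
  "SG A B a b ps u v \<longleftrightarrow> (bipK A B u v \<and> {u,v} \<noteq> {a,b}) \<or> path_edge (a # ps @ [b]) u v"

definition arr :: "nat \<Rightarrow> nat set \<Rightarrow> nat set \<Rightarrow> nat list \<Rightarrow> bool" where
  "arr n A B ps \<longleftrightarrow> A \<union> B \<union> set ps = {..<n} \<and> A \<inter> B = {} \<and> set ps \<inter> (A \<union> B) = {} \<and> distinct ps \<and> ps \<noteq> []"

lemma arr_finite: "arr n A B ps \<Longrightarrow> finite A \<and> finite B"
  unfolding arr_def by (metis finite_Un finite_lessThan)

lemma arr_swap: "arr n A B ps \<Longrightarrow> arr n B A (rev ps)"
  unfolding arr_def by auto

lemma bipK_swap: "bipK A B u v \<longleftrightarrow> bipK B A u v"
  unfolding bipK_def by blast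

lemma SG_swap: "SG A B a b ps u v \<longleftrightarrow> SG B A b a (rev ps) u v"
proof -
  have "b # rev ps @ [a] = rev (a # ps @ [b])" by simp
  hence "path_edge (b # rev ps @ [a]) u v \<longleftrightarrow> path_edge (a # ps @ [b]) u v"
    by (metis path_edge_rev)
  thus ?thesis unfolding SG_def using bipK_swap by (auto simp: insert_commute)
qed

text \<open>Keeps the path edges apart from the bipartite edges, so that the quadratic forms of the
  two pieces add up.\<close>

lemma path_ends_not_adjacent:
  assumes "ps \<noteq> []" "distinct (a # ps @ [b])" "path_edge (a # ps @ [b]) u v"
  shows "u \<in> set ps \<or> v \<in> set ps"
proof -
  obtain c qs where ps: "ps = c # qs" using assms(1) by (cases ps) auto
  have "path_edge (a # ps @ [b]) u v \<longleftrightarrow> (u = a \<and> v = c) \<or> (v = a \<and> u = c) \<or> path_edge (ps @ [b]) u v"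
    unfolding ps by (simp add: path_edge_Cons)
  moreover have "u \<in> set ps \<or> v \<in> set ps" if "path_edge (ps @ [b]) u v"
    using path_edge_set[OF that] path_edge_irrefl[of "ps @ [b]" b] that assms(2) by auto
  ultimately show ?thesis using assms(3) ps by auto
qed

lemma SG_simple:
  assumes "arr n A B ps" "a \<in> A" "b \<in> B"
  shows "simple_graph n (SG A B a b ps)"
proof -
  have d: "distinct (a # ps @ [b])" and s: "set (a # ps @ [b]) \<subseteq> {..<n}" using assms unfolding arr_def by auto
  show ?thesis
    unfolding simple_graph_def
  proof (intro allI impI)
    fix u v assume e: "SG A B a b ps u v"
    have "SG A B a b ps v u" using e path_edge_sym unfolding SG_def bipK_def by (auto simp: insert_commute)
    moreover have "u < n \<and> v < n \<and> u \<noteq> v"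
      using e
    proof (cases "path_edge (a # ps @ [b]) u v")
      case True
      thus ?thesis using path_edge_set[OF True] path_edge_irrefl[OF d] s by blast
    next
      case False
      hence "bipK A B u v" using e unfolding SG_def by blast
      thus ?thesis using assms(1) unfolding arr_def bipK_def by blast
    qed
    ultimately show "u < n \<and> v < n \<and> u \<noteq> v \<and> SG A B a b ps v u" by blast
  qed
qed

lemma qf_SG:
  assumes "arr n A B ps" "a \<in> A" "b \<in> B"
  shows "qf (SG A B a b ps) x {..<n} {..<n} =
    2 * (sum x A * sum x B - x a * x b) + 2 * psum x (a # ps @ [b])"
proof -
  let ?V = "{..<n}"
  have d: "distinct (a # ps @ [b])" and s: "set (a # ps @ [b]) \<subseteq> ?V" and ne: "ps \<noteq> []"
    and sub: "A \<subseteq> ?V" "B \<subseteq> ?V" "A \<inter> B = {}" and dis: "set ps \<inter> (A \<union> B) = {}"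
    using assms unfolding arr_def by auto
  let ?K = "\<lambda>u v. bipK A B u v \<and> {u,v} \<noteq> {a,b}"
  have "qf (SG A B a b ps) x ?V ?V = qf (\<lambda>u v. ?K u v \<or> path_edge (a # ps @ [b]) u v) x ?V ?V"
    by (rule qf_cong) (simp add: SG_def)
  also have "\<dots> = qf ?K x ?V ?V + qf (path_edge (a # ps @ [b])) x ?V ?V"
    using path_ends_not_adjacent[OF ne d] dis by (intro qf_disj) (auto simp: bipK_def)
  also have "qf (path_edge (a # ps @ [b])) x ?V ?V = 2 * psum x (a # ps @ [b])"
    by (rule qf_path_edge[OF _ d s]) simp
  also have "qf ?K x ?V ?V = 2 * (sum x A * sum x B) - 2 * (x a * x b)"
  proof -
    \<comment> \<open>The deleted edge is treated as a path with two vertices: the complete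
      bipartite graph is the disjoint union of it and the remaining edges.\<close>
    have "qf (bipK A B) x ?V ?V = qf (\<lambda>u v. ?K u v \<or> path_edge [a,b] u v) x ?V ?V"
      using assms(2,3) by (intro qf_cong) (auto simp: bipK_def path_edge_Cons doubleton_eq_iff)
    also have "\<dots> = qf ?K x ?V ?V + qf (path_edge [a,b]) x ?V ?V"
      by (intro qf_disj) (auto simp: path_edge_Cons)
    also have "qf (path_edge [a,b]) x ?V ?V = 2 * psum x [a,b]"
      using d s by (intro qf_path_edge) auto
    also have "qf (bipK A B) x ?V ?V = 2 * (sum x A * sum x B)"
      using sub by (intro qf_bipK) auto
    finally show ?thesis by simp
  qed
  finally show ?thesis by (simp add: algebra_simps)
qed

section \<open>Minimal odd walks and ears\<close>

locale bip_part =
  fixes n :: nat and E :: "nat \<Rightarrow> nat \<Rightarrow> bool" and A B :: "nat set"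
  assumes G: "simple_graph n E"
    and AB: "A \<subseteq> {..<n}" "B \<subseteq> {..<n}" "A \<inter> B = {}"
    and indep: "\<And>u v. u \<in> A \<Longrightarrow> v \<in> A \<Longrightarrow> \<not> E u v" "\<And>u v. u \<in> B \<Longrightarrow> v \<in> B \<Longrightarrow> \<not> E u v"
begin

definition rest :: "nat set" where "rest = {..<n} - (A \<union> B)"

definition rwalk :: "nat list \<Rightarrow> bool" where
  "rwalk ws \<longleftrightarrow> ws \<noteq> [] \<and> set ws \<subseteq> rest \<and> successively E ws"

text \<open>The first vertex is not repeated at the end of the list, so the length of the list is
  the number of edges of the closed walk.\<close>

definition closed_odd :: "nat list \<Rightarrow> bool" where
  "closed_odd ws \<longleftrightarrow> rwalk ws \<and> odd (length ws) \<and> E (last ws) (hd ws)"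

text \<open>The list holds the inner vertices only; the ear has \<open>length ws + 1\<close> edges.
  Its parity contradicts the colouring by \<open>A\<close> and \<open>B\<close>: odd between equal
  sides, even between different sides. The case \<open>u = v\<close> is included.\<close>

definition bad_ear :: "nat \<Rightarrow> nat list \<Rightarrow> nat \<Rightarrow> bool" where
  "bad_ear u ws v \<longleftrightarrow> rwalk ws \<and> u \<in> A \<union> B \<and> v \<in> A \<union> B \<and> E u (hd ws) \<and> E (last ws) v \<and>
     ((u \<in> A \<longleftrightarrow> v \<in> A) \<longleftrightarrow> even (length ws))"

definition odd_str :: "nat list \<Rightarrow> bool" where
  "odd_str ws \<longleftrightarrow> closed_odd ws \<or> (\<exists>u v. bad_ear u ws v)"

lemma sym: "E u v \<longleftrightarrow> E v u"
  by (rule simple_graph_commute[OF G])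

lemma sym_fun: "(\<lambda>x y. E y x) = E"
  using sym by blast

lemma rwalk_rev: "rwalk ws \<Longrightarrow> rwalk (rev ws)"
  unfolding rwalk_def by (simp add: sym_fun) (metis successively_rev sym_fun)

lemma bad_ear_rev: "bad_ear u ws v \<Longrightarrow> bad_ear v (rev ws) u"
  unfolding bad_ear_def using rwalk_rev sym by (auto simp: hd_rev last_rev)

lemma rwalk_join:
  assumes "rwalk ws1" "rwalk ws2" "last ws1 = hd ws2"
  shows "rwalk (ws1 @ tl ws2)" "hd (ws1 @ tl ws2) = hd ws1" "last (ws1 @ tl ws2) = last ws2"
    "length (ws1 @ tl ws2) = length ws1 + length ws2 - 1"
proof -
  have ne: "ws1 \<noteq> []" "ws2 \<noteq> []" using assms unfolding rwalk_def by auto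
  then obtain w us where ws2: "ws2 = w # us" by (meson list.exhaust)
  show "hd (ws1 @ tl ws2) = hd ws1" "length (ws1 @ tl ws2) = length ws1 + length ws2 - 1"
    using ne ws2 by auto
  show "last (ws1 @ tl ws2) = last ws2" using ne ws2 assms(3) by auto
  show "rwalk (ws1 @ tl ws2)"
    using assms unfolding rwalk_def ws2 by (auto simp: successively_append_iff successively_Cons)
qed

lemma closed_walk_odd_str:
  assumes "rwalk ws" "hd ws = last ws" "even (length ws)"
  shows "odd_str (butlast ws)"
proof -
  obtain us w where ws: "ws = us @ [w]" using assms(1) unfolding rwalk_def by (metis rev_exhaust)
  have us: "us \<noteq> []" using assms(3) ws by auto
  have "closed_odd us"
    unfolding closed_odd_def rwalk_def using assms us unfolding ws rwalk_def
    by (auto simp: successively_append_iff)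
  thus ?thesis unfolding ws odd_str_def by simp
qed

text \<open>Without an obstruction the colouring by \<open>A\<close> and \<open>B\<close> extends to
  the remainder: a vertex from which \<open>A \<union> B\<close> can be reached is coloured by the
  parity of a walk leading out, any other vertex by the parity of a walk from a base point of its
  component. The absence of obstructions makes both parities independent of the walk.\<close>

lemma not_bipartite_odd_str:
  assumes "\<not> bipartite n E"
  shows "\<exists>ws. odd_str ws"
proof (rule ccontr)
  assume no: "\<not> ?thesis"
  define exit where "exit v u ws \<longleftrightarrow> rwalk ws \<and> hd ws = v \<and> u \<in> A \<union> B \<and> E (last ws) u" for v u ws
  \<comment> \<open>Reversing the first exit walk and continuing along the second gives an ear
    between the two exits; since it is not bad, both exits prescribe the same colour.\<close>
  have exit_cons: "(u1 \<in> A \<longleftrightarrow> even (length ws1)) \<longleftrightarrow> (u2 \<in> A \<longleftrightarrow> even (length ws2))"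
    if w1: "exit v u1 ws1" and w2: "exit v u2 ws2" for v u1 ws1 u2 ws2
  proof -
    let ?ws = "rev ws1 @ tl ws2"
    have ne: "ws1 \<noteq> []" "ws2 \<noteq> []" using w1 w2 unfolding exit_def rwalk_def by auto
    have j: "last (rev ws1) = hd ws2" using w1 w2 ne unfolding exit_def by (simp add: last_rev)
    have r: "rwalk (rev ws1)" "rwalk ws2" using w1 w2 rwalk_rev unfolding exit_def by auto
    note J = rwalk_join[OF r j]
    have "\<not> bad_ear u1 ?ws u2" using no unfolding odd_str_def by blast
    hence "\<not> ((u1 \<in> A \<longleftrightarrow> u2 \<in> A) \<longleftrightarrow> even (length ws1 + length ws2 - 1))"
      unfolding bad_ear_def using J w1 w2 ne sym unfolding exit_def by (auto simp: hd_rev)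
    thus ?thesis using ne by (auto simp: even_diff_nat neq_Nil_conv)
  qed
  define conn where "conn v w \<longleftrightarrow> (\<exists>ws. rwalk ws \<and> hd ws = v \<and> last ws = w)" for v w
  have conn_sym: "conn v w \<Longrightarrow> conn w v" for v w
    unfolding conn_def using rwalk_rev by (metis hd_rev last_rev rwalk_def)
  have conn_trans: "conn v w \<Longrightarrow> conn w z \<Longrightarrow> conn v z" for v w z
    unfolding conn_def using rwalk_join by metis
  have conn_refl: "v \<in> rest \<Longrightarrow> conn v v" for v
    unfolding conn_def rwalk_def by (intro exI[of _ "[v]"]) auto
  have conn_edge: "v \<in> rest \<Longrightarrow> w \<in> rest \<Longrightarrow> E v w \<Longrightarrow> conn v w" for v w
    unfolding conn_def rwalk_def by (intro exI[of _ "[v,w]"]) auto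
  \<comment> \<open>The least vertex connected to \<open>v\<close> serves as base point of its
    component.\<close>
  define rep where "rep v = (LEAST w. conn w v)" for v
  have rep: "conn (rep v) v" if "v \<in> rest" for v
    unfolding rep_def using conn_refl[OF that] by (rule LeastI)
  have rep_eq: "rep v = rep w" if "conn v w" for v w
  proof -
    have "conn z v \<longleftrightarrow> conn z w" for z using that conn_trans conn_sym by blast
    thus ?thesis unfolding rep_def by simp
  qed
  define att where "att v \<longleftrightarrow> (\<exists>u ws. exit v u ws)" for v
  have exit_Cons: "exit v u (v # ws)" if "exit w u ws" "v \<in> rest" "E v w" for v w u ws
    using that unfolding exit_def rwalk_def by (auto simp: successively_Cons)
  define walk where "walk v w ws \<longleftrightarrow> rwalk ws \<and> hd ws = v \<and> last ws = w" for v w ws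
  have walk_cons: "even (length ws1) \<longleftrightarrow> even (length ws2)"
    if w1: "walk v w ws1" and w2: "walk v w ws2" for v w ws1 ws2
  proof (rule ccontr)
    assume par: "\<not> ?thesis"
    have ne: "ws1 \<noteq> []" "ws2 \<noteq> []" using w1 w2 unfolding walk_def rwalk_def by auto
    have j: "last ws1 = hd (rev ws2)" using w1 w2 ne unfolding walk_def by (simp add: hd_rev)
    have r: "rwalk ws1" "rwalk (rev ws2)" using w1 w2 rwalk_rev unfolding walk_def by auto
    note J = rwalk_join[OF r j]
    have "odd_str (butlast (ws1 @ tl (rev ws2)))"
      using J w1 w2 ne par unfolding walk_def
      by (intro closed_walk_odd_str) (auto simp: last_rev neq_Nil_conv)
    thus False using no by blast
  qed
  define col where "col v \<longleftrightarrow> (if att v then \<exists>u ws. exit v u ws \<and> (u \<in> A \<longleftrightarrow> even (length ws))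
      else \<exists>ws. walk (rep v) v ws \<and> odd (length ws))" for v
  have col_att: "col v \<longleftrightarrow> (u \<in> A \<longleftrightarrow> even (length ws))" if "exit v u ws" for v u ws
    using that exit_cons unfolding col_def att_def by meson
  define X where "X = {v \<in> {..<n}. v \<in> A \<or> (v \<in> rest \<and> col v)}"
  have key: "v \<in> X \<longleftrightarrow> w \<notin> X" if e: "E v w" and v: "v \<in> A \<union> B" and w: "w \<in> rest" for v w
  proof -
    have "exit w v [w]" using e v w sym unfolding exit_def rwalk_def by auto
    from col_att[OF this] have "col w \<longleftrightarrow> v \<notin> A" by simp
    thus ?thesis using v w AB unfolding X_def rest_def by auto
  qed
  have "v \<in> X \<longleftrightarrow> w \<notin> X" if vn: "v < n" "w < n" and e: "E v w" for v w
  proof -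
    consider "v \<in> A \<union> B" "w \<in> A \<union> B" | "v \<in> A \<union> B" "w \<in> rest" | "v \<in> rest" "w \<in> A \<union> B" | "v \<in> rest" "w \<in> rest"
      using vn unfolding rest_def by blast
    thus ?thesis
    proof cases
      case 1
      thus ?thesis using indep[of v w] e vn AB unfolding X_def rest_def by auto
    next
      case 2 thus ?thesis using key e by blast
    next
      case 3 thus ?thesis using key[of w v] e sym by blast
    next
      case 4
      have "col v \<longleftrightarrow> \<not> col w"
      proof (cases "att w")
        case True
        then obtain u ws where ws: "exit w u ws" unfolding att_def by blast
        have "exit v u (v # ws)" using exit_Cons[OF ws] 4 e by blast
        from col_att[OF this] col_att[OF ws] show ?thesis by auto
      next
        case False
        hence "\<not> att v" using exit_Cons[of v _ _ w] 4 e sym unfolding att_def by blast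
        hence cv: "col v \<longleftrightarrow> (\<exists>ws. walk (rep v) v ws \<and> odd (length ws))" unfolding col_def by simp
        have r: "rep w = rep v" using rep_eq[OF conn_edge] 4 e by metis
        have cw: "col w \<longleftrightarrow> (\<exists>ws. walk (rep v) w ws \<and> odd (length ws))"
          using False r unfolding col_def by simp
        obtain ws where ws: "walk (rep v) v ws" using rep[OF 4(1)] unfolding conn_def walk_def by blast
        have ws': "walk (rep v) w (ws @ [w])"
          using ws 4 e unfolding walk_def rwalk_def by (auto simp: successively_append_iff)
        have "col v \<longleftrightarrow> odd (length ws)" using cv ws walk_cons by meson
        moreover have "col w \<longleftrightarrow> odd (length (ws @ [w]))" using cw ws' walk_cons by meson
        ultimately show ?thesis by simp
      qed
      thus ?thesis using 4 vn AB unfolding X_def rest_def by auto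
    qed
  qed
  hence "bipartite n E" unfolding bipartite_def
    by (intro exI[of _ X]) (auto simp: X_def)
  thus False using assms by blast
qed

section \<open>Consequences of minimality of an obstruction\<close>

context
  fixes N :: nat
  assumes least: "\<forall>ws. odd_str ws \<longrightarrow> N \<le> length ws"
begin

lemma odd_str_short: "length ws < N \<Longrightarrow> \<not> odd_str ws"
  using least by fastforce

lemma least_distinct:
  assumes ws: "odd_str ws" and len: "length ws = N"
  shows "distinct ws"
proof (rule ccontr)
  assume "\<not> distinct ws"
  then obtain xs ys zs y where dec: "ws = xs @ [y] @ ys @ [y] @ zs"
    using not_distinct_decomp by blast
  have rw: "rwalk ws" using ws unfolding odd_str_def closed_odd_def bad_ear_def by blast
  show False
  proof (cases "even (length ys)")
    case True
    have "closed_odd (y # ys)"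
      using rw True unfolding closed_odd_def rwalk_def dec
      by (auto simp: successively_append_iff successively_Cons)
    thus False using odd_str_short[of "y # ys"] len unfolding odd_str_def dec by simp
  next
    case False
    let ?w = "xs @ [y] @ zs"
    have h: "hd ?w = hd ws" "last ?w = last ws" unfolding dec by (auto simp: hd_append)
    have "rwalk ?w"
      using rw unfolding rwalk_def dec by (auto simp: successively_append_iff successively_Cons)
    moreover have "even (length ?w) \<longleftrightarrow> even (length ws)" using False unfolding dec by auto
    ultimately have "odd_str ?w" using ws h unfolding odd_str_def closed_odd_def bad_ear_def by metis
    moreover have "length ?w < N" using len unfolding dec by simp
    ultimately show False using odd_str_short by blast
  qed
qed

lemma rwalk_take: "rwalk ws \<Longrightarrow> rwalk (take (Suc i) ws)"
  unfolding rwalk_def by (metis append_take_drop_id successively_append_iff set_take_subset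
      subset_trans take_eq_Nil nat.distinct(1))

lemma rwalk_drop: "rwalk ws \<Longrightarrow> i < length ws \<Longrightarrow> rwalk (drop i ws)"
  unfolding rwalk_def by (metis append_take_drop_id successively_append_iff set_drop_subset
      subset_trans drop_eq_Nil linorder_not_le)

lemma last_take_Suc: "i < length ws \<Longrightarrow> last (take (Suc i) ws) = ws ! i"
  by (simp add: take_Suc_conv_app_nth)

text \<open>An attachment at an inner vertex splits the ear into two shorter ears. Their parities
  add up to that of the whole, so one of them is bad.\<close>

lemma ear_interior_unattached:
  assumes ear: "bad_ear u ws v" and len: "length ws = N" and i: "0 < i" "i < N - 1"
    and q: "q \<in> A \<union> B" "E (ws ! i) q"
  shows False
proof -
  have rw: "rwalk ws" using ear unfolding bad_ear_def by blast
  let ?a = "take (Suc i) ws" and ?b = "drop i ws"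
  have iw: "i < length ws" using i len by simp
  have ends: "hd ?a = hd ws" "last ?a = ws ! i" "hd ?b = ws ! i" "last ?b = last ws"
    using iw by (simp_all add: last_take_Suc hd_drop_conv_nth)
  have l: "length ?a = Suc i" "length ?b = N - i" using iw len by auto
  have "bad_ear u ?a q \<or> bad_ear q ?b v"
  proof (rule ccontr)
    assume "\<not> ?thesis"
    hence "\<not> ((u \<in> A \<longleftrightarrow> q \<in> A) \<longleftrightarrow> even (Suc i))" "\<not> ((q \<in> A \<longleftrightarrow> v \<in> A) \<longleftrightarrow> even (N - i))"
      using ear q sym rwalk_take[OF rw, of i] rwalk_drop[OF rw iw] unfolding bad_ear_def ends l by auto
    moreover have "(u \<in> A \<longleftrightarrow> v \<in> A) \<longleftrightarrow> even N" using ear len unfolding bad_ear_def by blast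
    ultimately show False using i by (auto simp: even_diff_nat)
  qed
  thus False using odd_str_short[of ?a] odd_str_short[of ?b] i l unfolding odd_str_def by force
qed

text \<open>Otherwise the first vertex alone would be a bad ear, running between different
  sides.\<close>

lemma ear_first_side:
  assumes ear: "bad_ear u ws v" and len: "length ws = N" and N: "N \<ge> 2"
    and q: "q \<in> A \<union> B" "E (hd ws) q"
  shows "q \<in> A \<longleftrightarrow> u \<in> A"
proof (rule ccontr)
  assume "\<not> ?thesis"
  moreover have "rwalk [hd ws]" using ear unfolding bad_ear_def rwalk_def by (cases ws) auto
  ultimately have "bad_ear u [hd ws] q" using ear q unfolding bad_ear_def by auto
  thus False using odd_str_short[of "[hd ws]"] N unfolding odd_str_def by auto
qed

lemma ear_last_side:
  assumes ear: "bad_ear u ws v" and len: "length ws = N" and N: "N \<ge> 2"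
    and q: "q \<in> A \<union> B" "E (last ws) q"
  shows "q \<in> A \<longleftrightarrow> v \<in> A"
proof -
  have ne: "ws \<noteq> []" using ear unfolding bad_ear_def rwalk_def by blast
  show ?thesis
    using ear_first_side[OF bad_ear_rev[OF ear]] len N q ne by (simp add: hd_rev)
qed

text \<open>A chord over an even number of steps closes an odd closed walk; a chord over an odd
  number of steps is a shortcut that keeps the parity. Minimality leaves only consecutive vertices
  and, for odd \<open>N\<close>, the edge that closes the whole list.\<close>

lemma no_chord:
  assumes ws: "odd_str ws" and len: "length ws = N" and ij: "i < j" "j < N" and e: "E (ws ! i) (ws ! j)"
  shows "j = Suc i \<or> (i = 0 \<and> j = N - 1 \<and> odd N)"
proof (rule ccontr)
  assume neg: "\<not> ?thesis"
  have rw: "rwalk ws" using ws unfolding odd_str_def closed_odd_def bad_ear_def by blast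
  have jw: "j < length ws" "i < length ws" using ij len by auto
  show False
  proof (cases "even (j - i)")
    case True
    let ?s = "take (Suc (j - i)) (drop i ws)"
    have l: "length ?s = Suc (j - i)" using jw ij by simp
    have "rwalk ?s" using rwalk_take[OF rwalk_drop[OF rw jw(2)]] .
    moreover have "hd ?s = ws ! i" using jw by (simp add: hd_drop_conv_nth)
    moreover have "last ?s = ws ! j" using jw ij by (subst last_take_Suc) auto
    ultimately have "closed_odd ?s" using True e sym unfolding closed_odd_def l by auto
    hence "N \<le> Suc (j - i)" using least[rule_format, of ?s] l unfolding odd_str_def by simp
    hence "i = 0" "j = N - 1" using ij by auto
    thus False using neg True ij by (cases N) auto
  next
    case False
    let ?s = "take (Suc i) ws @ drop j ws"
    have l: "length ?s = N - (j - i - 1)" using jw ij len by simp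
    have h: "hd ?s = hd ws" "last ?s = last ws" using jw rw unfolding rwalk_def by auto
    have "successively E ?s"
      using rwalk_take[OF rw, of i] rwalk_drop[OF rw jw(1)] e jw
      unfolding rwalk_def by (simp add: successively_append_iff last_take_Suc hd_drop_conv_nth)
    moreover have "set ?s \<subseteq> rest"
      using rw set_take_subset[of "Suc i" ws] set_drop_subset[of j ws] unfolding rwalk_def by auto
    ultimately have "rwalk ?s" using jw rw unfolding rwalk_def by auto
    moreover have "even (length ?s) \<longleftrightarrow> even (length ws)"
      unfolding l len using False ij by (auto simp: even_diff_nat)
    ultimately have "odd_str ?s" using ws h unfolding odd_str_def closed_odd_def bad_ear_def by metis
    moreover have "length ?s < N" unfolding l using ij neg by auto
    ultimately show False using odd_str_short by blast
  qed
qed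

text \<open>Two attached vertices cut the cycle into two arcs that list \<open>N + 2\<close>
  vertices in total, an odd number. Hence exactly one arc has the parity of a bad ear, and neither
  is longer than \<open>N\<close>.\<close>

lemma closed_odd_attached_once:
  assumes ws: "closed_odd ws" and len: "length ws = N"
    and noear: "\<forall>u us v. bad_ear u us v \<longrightarrow> length us \<noteq> N"
    and ij: "i < j" "j < N" and q: "q \<in> A \<union> B" "q' \<in> A \<union> B" "E (ws ! i) q" "E (ws ! j) q'"
  shows False
proof -
  have rw: "rwalk ws" and cl: "E (last ws) (hd ws)" and od: "odd N"
    using ws len unfolding closed_odd_def by auto
  have jw: "j < length ws" "i < length ws" using ij len by auto
  let ?s = "take (Suc (j - i)) (drop i ws)" and ?t = "drop j ws @ take (Suc i) ws"
  have ls: "length ?s = Suc (j - i)" using jw ij by simp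
  have lt: "length ?t = N - j + Suc i" using jw ij len by simp
  have rs: "rwalk ?s" using rwalk_take[OF rwalk_drop[OF rw jw(2)]] .
  have es: "hd ?s = ws ! i" "last ?s = ws ! j"
    using jw ij by (simp add: hd_drop_conv_nth, subst last_take_Suc) auto
  have "take (Suc i) ws \<noteq> []" using jw by auto
  hence et: "hd ?t = ws ! j" "last ?t = ws ! i"
    using jw by (auto simp: hd_append hd_drop_conv_nth last_append last_take_Suc)
  have "rwalk ?t"
    using rwalk_take[OF rw, of i] rwalk_drop[OF rw jw(1)] cl jw
    unfolding rwalk_def by (auto simp: successively_append_iff)
  have "bad_ear q ?s q' \<or> bad_ear q' ?t q"
  proof (rule ccontr)
    assume "\<not> ?thesis"
    hence "\<not> ((q \<in> A \<longleftrightarrow> q' \<in> A) \<longleftrightarrow> even (Suc (j - i)))" "\<not> ((q' \<in> A \<longleftrightarrow> q \<in> A) \<longleftrightarrow> even (N - j + Suc i))"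
      using q sym rs \<open>rwalk ?t\<close> unfolding bad_ear_def es et ls lt by auto
    thus False using od ij by (auto simp: even_diff_nat)
  qed
  moreover have "length ?s \<le> N" "length ?t \<le> N" unfolding ls lt using ij by auto
  ultimately show False using noear least unfolding odd_str_def by (metis le_antisym)
qed

text \<open>An attachment of an end at another vertex \<open>q\<close> would give a bad ear of the
  same length with the distinct ends \<open>q\<close> and \<open>a\<close>.\<close>

lemma closed_ear_attached_at:
  assumes ear: "bad_ear a ws a" and len: "length ws = N" and N: "N \<ge> 2"
    and noear: "\<forall>u us v. bad_ear u us v \<longrightarrow> u \<noteq> v \<longrightarrow> length us \<noteq> N"
    and q: "q \<in> A \<union> B" and e: "E (hd ws) q \<or> E (last ws) q"
  shows "q = a"
proof -
  have *: "q = a" if ear: "bad_ear a us a" "length us = N" and e: "E (hd us) q" for us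
  proof -
    have "q \<in> A \<longleftrightarrow> a \<in> A" using ear_first_side[OF ear N q e] .
    hence "bad_ear q us a" using ear q e sym unfolding bad_ear_def by auto
    thus ?thesis using noear ear by blast
  qed
  have ne: "ws \<noteq> []" using ear unfolding bad_ear_def rwalk_def by blast
  show ?thesis
    using e *[OF ear len] *[OF bad_ear_rev[OF ear]] len ne by (auto simp: hd_rev)
qed

end

end

section \<open>Eigenvectors of \<open>SG\<close> and optimality of balanced classes\<close>

lemma arr_card:
  assumes "arr n A B ps" shows "card A + card B + length ps = n"
proof -
  have fin: "finite A" "finite B" using arr_finite[OF assms] by auto
  have "card (A \<union> B \<union> set ps) = card (A \<union> B) + card (set ps)"
    using assms fin unfolding arr_def by (intro card_Un_disjoint) auto
  also have "card (A \<union> B) = card A + card B"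
    using assms fin unfolding arr_def by (intro card_Un_disjoint) auto
  also have "card (set ps) = length ps" using assms unfolding arr_def by (simp add: distinct_card)
  finally show ?thesis using assms unfolding arr_def by simp
qed

lemma spec_rad_lower:
  assumes "simple_graph n E" "n > 0" "c * sqn y {..<n} \<le> qf E y {..<n} {..<n}" "sqn y {..<n} > 0"
  shows "c \<le> spec_rad n E"
proof -
  have "c * sqn y {..<n} \<le> spec_rad n E * sqn y {..<n}"
    using assms(3) spec_rad_ge[OF assms(1,2), of y] by linarith
  thus ?thesis using assms(4) by simp
qed

lemma iso_spec_rad_le:
  assumes "simple_graph n E" "simple_graph n H" "n > 0" "graph_iso n E H"
  shows "spec_rad n E \<le> spec_rad n H"
proof -
  obtain x where x: "\<And>v. 0 \<le> x v" "sqn x {..<n} \<noteq> 0" "\<And>v. v < n \<Longrightarrow> nsum E x {..<n} v = spec_rad n E * x v"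
    using spec_rad_perron[OF assms(1,3)] by blast
  obtain f where f: "bij_betw f {0..<n} {0..<n}" "\<And>u v. u < n \<Longrightarrow> v < n \<Longrightarrow> E u v \<longleftrightarrow> H (f u) (f v)"
    using assms(4) unfolding graph_iso_def by blast
  have f': "bij_betw f {..<n} {..<n}" using f(1) by (simp add: lessThan_atLeast0)
  define y where "y w = x (inv_into {..<n} f w)" for w
  have y: "y (f v) = x v" if "v < n" for v
    unfolding y_def using f' that by (metis bij_betw_inv_into_left lessThan_iff)
  define g where "g v w = (if H v w then y v * y w else 0)" for v w
  have "qf H y {..<n} {..<n} = (\<Sum>v<n. \<Sum>w<n. g v w)"
    unfolding qf_alt g_def ..
  also have "\<dots> = (\<Sum>v<n. \<Sum>w<n. g (f v) w)"
    by (rule sum.reindex_bij_betw[OF f', symmetric])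
  also have "\<dots> = (\<Sum>v<n. \<Sum>w<n. g (f v) (f w))"
    by (intro sum.cong refl sum.reindex_bij_betw[OF f', symmetric])
  also have "\<dots> = qf E x {..<n} {..<n}"
    unfolding qf_alt g_def by (intro sum.cong refl) (simp add: y f(2))
  also have "\<dots> = spec_rad n E * sqn x {..<n}"
    using x(3) by (intro qf_eigen) simp
  finally have q: "spec_rad n E * sqn x {..<n} \<le> qf H y {..<n} {..<n}" by simp
  have "sqn y {..<n} = (\<Sum>v<n. (y (f v))\<^sup>2)"
    unfolding sqn_def by (rule sum.reindex_bij_betw[OF f', symmetric])
  hence sxy: "sqn y {..<n} = sqn x {..<n}"
    unfolding sqn_def by (simp add: y)
  hence "sqn y {..<n} > 0" using x(2) sqn_nonneg[of x "{..<n}"] by linarith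
  thus ?thesis using spec_rad_lower[OF assms(2,3) q[folded sxy]] by simp
qed

lemma path_edge_card_le_2:
  assumes "distinct zs"
  shows "finite {w. path_edge zs p w}" "card {w. path_edge zs p w} \<le> 2"
proof -
  have "\<exists>i. {w. path_edge zs p w} \<subseteq> {zs ! (i - 1), zs ! Suc i}"
  proof (cases "p \<in> set zs")
    case True
    then obtain i where i: "i < length zs" "p = zs ! i" by (metis in_set_conv_nth)
    have "w = zs ! (i - 1) \<or> w = zs ! Suc i" if pw: "path_edge zs p w" for w
    proof -
      obtain j where j: "Suc j < length zs" "(p = zs ! j \<and> w = zs ! Suc j) \<or> (w = zs ! j \<and> p = zs ! Suc j)"
        using pw unfolding path_edge_def by blast
      hence "(j = i \<and> w = zs ! Suc j) \<or> (Suc j = i \<and> w = zs ! j)"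
        using i assms by (auto simp: nth_eq_iff_index_eq)
      thus ?thesis by auto
    qed
    thus ?thesis by blast
  next
    case False
    thus ?thesis using path_edge_set by fastforce
  qed
  then obtain i where i: "{w. path_edge zs p w} \<subseteq> {zs ! (i - 1), zs ! Suc i}" by blast
  show "finite {w. path_edge zs p w}" by (rule finite_subset[OF i]) simp
  have "card {w. path_edge zs p w} \<le> card {zs ! (i - 1), zs ! Suc i}" by (rule card_mono[OF _ i]) simp
  also have "\<dots> \<le> 2" by (simp add: card_insert_if)
  finally show "card {w. path_edge zs p w} \<le> 2" .
qed

lemma path_edge_hd:
  assumes "distinct (a # zs)" "zs \<noteq> []"
  shows "path_edge (a # zs) a w \<longleftrightarrow> w = hd zs"
proof -
  obtain c qs where zs: "zs = c # qs" using assms(2) by (cases zs) auto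
  have "\<not> path_edge zs a w" using path_edge_set assms(1) by fastforce
  thus ?thesis using assms(1) unfolding zs by (auto simp: path_edge_Cons)
qed

lemma SG_nsum_A:
  assumes "arr n A B ps" "a \<in> A" "b \<in> B" "v \<in> A" "v \<noteq> a"
  shows "nsum (SG A B a b ps) x {..<n} v = sum x B"
proof -
  have "v \<noteq> b" "v \<notin> set ps" using assms unfolding arr_def by auto
  hence "\<not> path_edge (a # ps @ [b]) v w" for w using path_edge_set[of "a # ps @ [b]" v w] assms by auto
  hence "{w\<in>{..<n}. SG A B a b ps v w} = B"
    using assms \<open>v \<noteq> b\<close> unfolding SG_def bipK_def arr_def by (auto simp: doubleton_eq_iff)
  thus ?thesis by (simp add: nsum_eq_sum_filter)
qed

lemma SG_nsum_a:
  assumes "arr n A B ps" "a \<in> A" "b \<in> B"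
  shows "nsum (SG A B a b ps) x {..<n} a = sum x (B - {b}) + x (hd ps)"
proof -
  have d: "distinct (a # ps @ [b])" and ne: "ps \<noteq> []" and ab: "a \<noteq> b" "a \<notin> B"
    using assms unfolding arr_def by auto
  have hd: "hd ps \<in> set ps" using ne by simp
  have "path_edge (a # ps @ [b]) a w \<longleftrightarrow> w = hd ps" for w
    using path_edge_hd[OF d] ne by simp
  hence "{w\<in>{..<n}. SG A B a b ps a w} = insert (hd ps) (B - {b})"
    using assms ab hd unfolding SG_def bipK_def arr_def by (auto simp: doubleton_eq_iff)
  moreover have "hd ps \<notin> B" using assms hd unfolding arr_def by blast
  moreover have "finite B" using arr_finite[OF assms(1)] by simp
  ultimately show ?thesis by (simp add: nsum_eq_sum_filter)
qed

lemma SG_nsum_ps: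
  assumes "arr n A B ps" "a \<in> A" "b \<in> B" "p \<in> set ps" "\<And>z. z \<in> set (a # ps @ [b]) \<Longrightarrow> x z \<le> t" "0 \<le> t"
  shows "nsum (SG A B a b ps) x {..<n} p \<le> 2 * t"
proof -
  have d: "distinct (a # ps @ [b])" using assms unfolding arr_def by auto
  let ?N = "{w. path_edge (a # ps @ [b]) p w}"
  note N = path_edge_card_le_2[OF d, of p]
  have "p \<notin> A \<union> B" using assms unfolding arr_def by auto
  hence "{w\<in>{..<n}. SG A B a b ps p w} = ?N"
    using path_edge_set[of "a # ps @ [b]" p] assms unfolding SG_def bipK_def arr_def by auto
  hence "nsum (SG A B a b ps) x {..<n} p = sum x ?N" by (simp add: nsum_eq_sum_filter)
  also have "\<dots> \<le> real (card ?N) * t"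
    using path_edge_set[of "a # ps @ [b]" p] assms(5) by (intro sum_bounded_above) auto
  also have "\<dots> \<le> 2 * t" using N assms(6) by (intro mult_right_mono) auto
  finally show ?thesis .
qed

text \<open>Consider the largest entry \<open>t\<close> on the path with its ends. At an inner
  vertex the equation gives \<open>L * t \<le> 2 * t\<close>, hence \<open>t = 0\<close>; at
  \<open>a\<close> it gives \<open>L * t \<le> sum x B + t\<close>; at \<open>b\<close> the bound is
  immediate.\<close>

lemma SG_eigen_bounds:
  assumes arr: "arr n A B ps" and ab: "a \<in> A" "b \<in> B"
    and x: "\<And>v. 0 \<le> x v" "\<And>v. v < n \<Longrightarrow> nsum (SG A B a b ps) x {..<n} v = L * x v" and L: "4 < L"
  shows "\<And>z. z \<in> set (a # ps @ [b]) \<Longrightarrow> x z \<le> sum x B"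
    and "L * x (hd ps) \<le> 2 * sum x B"
proof -
  let ?Z = "set (a # ps @ [b])"
  have sub: "?Z \<subseteq> {..<n}" and ne: "ps \<noteq> []" using arr ab unfolding arr_def by auto
  have fB: "finite B" using arr_finite[OF arr] by simp
  define t where "t = Max (x ` ?Z)"
  have tz: "x z \<le> t" if "z \<in> ?Z" for z unfolding t_def using that by (intro Max_ge) auto
  have t0: "0 \<le> t" using tz[of a] x(1)[of a] by auto
  have s0: "0 \<le> sum x B" using x(1) by (simp add: sum_nonneg)
  have bs: "x b \<le> sum x B" using ab fB x(1) by (intro member_le_sum) auto
  have "t \<in> x ` ?Z" unfolding t_def by (intro Max_in) auto
  then obtain z where z: "z \<in> ?Z" "t = x z" by blast
  have hdz: "hd ps \<in> set ps" using ne by simp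
  have "t \<le> sum x B"
  proof -
    consider "z = b" | "z = a" | "z \<in> set ps" using z by auto
    thus ?thesis
    proof cases
      case 1 thus ?thesis using bs z by simp
    next
      case 2
      have "L * t = sum x (B - {b}) + x (hd ps)"
        using SG_nsum_a[OF arr ab, of x] x(2)[of a] sub z 2 by auto
      moreover have "sum x (B - {b}) \<le> sum x B" using fB x(1) by (intro sum_mono2) auto
      moreover have "x (hd ps) \<le> t" using tz hdz by auto
      moreover have "4 * t \<le> L * t" using L t0 by (intro mult_right_mono) auto
      ultimately show ?thesis using t0 by linarith
    next
      case 3
      have "L * t \<le> 2 * t"
        using SG_nsum_ps[where x=x and t=t, OF arr ab 3 tz t0] x(2)[of z] sub z by auto
      moreover have "4 * t \<le> L * t" using L t0 by (intro mult_right_mono) auto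
      ultimately show ?thesis using t0 s0 by linarith
    qed
  qed
  thus "x z \<le> sum x B" if "z \<in> ?Z" for z using tz[OF that] by linarith
  have "L * x (hd ps) \<le> 2 * t"
    using SG_nsum_ps[where x=x and t=t, OF arr ab hdz tz t0] x(2)[of "hd ps"] sub hdz by auto
  thus "L * x (hd ps) \<le> 2 * sum x B" using \<open>t \<le> sum x B\<close> by linarith
qed

text \<open>If the entries on \<open>B\<close> vanished, the bounds on the path and the equations on
  \<open>A\<close> would force the whole vector to be 0.\<close>

lemma SG_sum_pos:
  assumes arr: "arr n A B ps" and ab: "a \<in> A" "b \<in> B"
    and x: "\<And>v. 0 \<le> x v" "\<And>v. v < n \<Longrightarrow> nsum (SG A B a b ps) x {..<n} v = L * x v" and L: "4 < L"
    and nz: "sqn x {..<n} \<noteq> 0"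
  shows "0 < sum x B"
proof (rule ccontr)
  assume "\<not> ?thesis"
  hence s0: "sum x B = 0" using sum_nonneg[of B x] x(1) by force
  have fB: "finite B" using arr_finite[OF arr] by simp
  have "x v = 0" if v: "v < n" for v
  proof -
    have "v \<in> A \<union> B \<union> set ps" using v arr unfolding arr_def by auto
    then consider "v \<in> set (a # ps @ [b])" | "v \<in> B" | "v \<in> A" "v \<noteq> a" by auto
    thus ?thesis
    proof cases
      case 1
      thus ?thesis using SG_eigen_bounds(1)[OF arr ab x L 1] s0 x(1)[of v] by linarith
    next
      case 2
      thus ?thesis using s0 fB x(1) by (simp add: sum_nonneg_eq_0_iff)
    next
      case 3
      have "L * x v = 0" using SG_nsum_A[OF arr ab 3, of x] x(2)[OF v] s0 by simp
      thus ?thesis using L by simp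
    qed
  qed
  hence "sqn x {..<n} = 0" unfolding sqn_def by simp
  thus False using nz by blast
qed

text \<open>Positivity is read off from the eigenvalue equations once both class sums are known to
  be positive. It is what turns equality of neighbour sums into equality of edge sets later
  on.\<close>

lemma SG_pos:
  assumes arr: "arr n A B ps" and ab: "a \<in> A" "b \<in> B"
    and x: "\<And>v. 0 \<le> x v" "\<And>v. v < n \<Longrightarrow> nsum (SG A B a b ps) x {..<n} v = L * x v" and L: "4 < L"
    and nz: "sqn x {..<n} \<noteq> 0" and c: "2 \<le> card A" "2 \<le> card B"
  shows "v \<in> A \<union> B \<Longrightarrow> 0 < x v"
proof -
  have L0: "0 < L" using L by linarith
  have main: "0 < x v" if arr: "arr n A B ps" and ab: "a \<in> A" "b \<in> B"
    and x: "\<And>v. 0 \<le> x v" "\<And>v. v < n \<Longrightarrow> nsum (SG A B a b ps) x {..<n} v = L * x v"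
    and v: "v \<in> A" and sA: "0 < sum x A" and sB: "0 < sum x B" and cB: "2 \<le> card B" for A B a b ps v
  proof (cases "v = a")
    case False
    have "v < n" using v arr unfolding arr_def by auto
    hence "L * x v = sum x B" using SG_nsum_A[OF arr ab v False, of x] x(2) by simp
    thus ?thesis using sB L0 by (metis zero_less_mult_pos)
  next
    case True
    have an: "a < n" using ab arr unfolding arr_def by auto
    have fB: "finite B" using arr_finite[OF arr] by simp
    \<comment> \<open>The vertex \<open>a\<close> has lost its edge to \<open>b\<close>, so its
      positivity has to come from a second vertex of \<open>B\<close>.\<close>
    have "\<not> B \<subseteq> {b}" using cB card_mono[of "{b}" B] by auto
    then obtain b' where b': "b' \<in> B" "b' \<noteq> b" by blast
    have b'n: "b' < n" using b' arr unfolding arr_def by auto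
    have e: "SG A B a b ps u v \<longleftrightarrow> SG B A b a (rev ps) u v" for u v by (rule SG_swap)
    have "nsum (SG A B a b ps) x {..<n} b' = nsum (SG B A b a (rev ps)) x {..<n} b'"
      unfolding nsum_def e ..
    also have "\<dots> = sum x A" by (rule SG_nsum_A[OF arr_swap[OF arr] ab(2,1) b'])
    finally have "L * x b' = sum x A" using x(2)[OF b'n] by simp
    hence "0 < x b'" using sA L0 by (metis zero_less_mult_pos)
    also have "x b' \<le> sum x (B - {b})" using b' fB x(1) by (intro member_le_sum) auto
    also have "\<dots> \<le> L * x a" using SG_nsum_a[OF arr ab, of x] x(2)[OF an] x(1)[of "hd ps"] by linarith
    finally show ?thesis using True L0 by (metis zero_less_mult_pos)
  qed
  have e: "SG A B a b ps = SG B A b a (rev ps)" using SG_swap by blast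
  note x' = x(2)[unfolded e]
  have sB: "0 < sum x B" using SG_sum_pos[OF arr ab x L nz] .
  have sA: "0 < sum x A" using SG_sum_pos[OF arr_swap[OF arr] ab(2,1) x(1) x' L nz] .
  show "0 < x v" if "v \<in> A \<union> B"
    using that main[OF arr ab x _ sA sB c(2)] main[OF arr_swap[OF arr] ab(2,1) x(1) x' _ sB sA c(1)] by blast
qed

lemma S_graph_eq:
  assumes "m = n - (2 * k - 1)" "2 \<le> m" "m \<le> n"
  shows "S_graph n k = SG {..<m div 2} {m div 2..<m} 0 (m div 2) [m..<n]"
proof (intro ext)
  fix u v
  have "turan2 m u v \<longleftrightarrow> bipK {..<m div 2} {m div 2..<m} u v"
    unfolding turan2_def bipK_def by auto
  thus "S_graph n k u v = SG {..<m div 2} {m div 2..<m} 0 (m div 2) [m..<n] u v"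
    unfolding S_graph_def SG_def Let_def assms(1)[symmetric] by simp
qed

lemma turan_arr:
  assumes "2 \<le> m" "m < n"
  shows "arr n {..<m div 2} {m div 2..<m} [m..<n]"
  using assms unfolding arr_def by auto

lemma half_product_bound: "real (m div 2) * real (m - m div 2) \<ge> ((real m)\<^sup>2 - 1) / 4"
proof -
  define h where "h = m div 2"
  have "m = 2 * h \<or> m = 2 * h + 1" unfolding h_def by presburger
  thus ?thesis unfolding h_def[symmetric] by (auto simp: field_simps power2_eq_square)
qed

lemma spec_rad_S_ge:
  assumes m: "m = n - (2 * k - 1)" "185 \<le> m" "m < n"
  shows "real m / 2 - 1 / 50 \<le> spec_rad n (S_graph n k)"
proof -
  let ?A = "{..<m div 2}" and ?B = "{m div 2..<m}" and ?V = "{..<n}"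
  have a: "arr n ?A ?B [m..<n]" using turan_arr m(2,3) by auto
  have ab: "0 \<in> ?A" "m div 2 \<in> ?B" using m(2) by auto
  \<comment> \<open>The indicator vector of the bipartite part. The missing edge and the rounding of
    \<open>m / 2\<close> cost at most 5/2 in the form, hence 5/(2m) in the quotient, which is below
    1/50 for \<open>m\<close> at least 185.\<close>
  define y :: "nat \<Rightarrow> real" where "y v = (if v < m then 1 else 0)" for v
  have "sum y ?A = (\<Sum>v\<in>?A. 1)" "sum y ?B = (\<Sum>v\<in>?B. 1)"
    by (rule sum.cong[OF refl]; auto simp: y_def)+
  hence "sum y ?A = real (m div 2)" "sum y ?B = real (m - m div 2)" by simp_all
  hence "qf (S_graph n k) y ?V ?V = 2 * (real (m div 2) * real (m - m div 2) - 1) + 2 * psum y (0 # [m..<n] @ [m div 2])"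
  proof -
    have "y 0 = 1" "y (m div 2) = 1" using m(2) unfolding y_def by auto
    thus ?thesis using \<open>sum y ?A = real (m div 2)\<close> \<open>sum y ?B = real (m - m div 2)\<close> m(2,3)
      by (simp add: S_graph_eq[OF m(1)] qf_SG[OF a ab])
  qed
  moreover have "0 \<le> psum y (0 # [m..<n] @ [m div 2])" by (rule psum_nonneg) (simp add: y_def)
  moreover define P where "P = psum y (0 # [m..<n] @ [m div 2])"
  moreover define z where "z = real (m div 2) * real (m - m div 2)"
  ultimately have "qf (S_graph n k) y ?V ?V = 2 * (z - 1) + 2 * P" "0 \<le> P" by simp_all
  hence "qf (S_graph n k) y ?V ?V \<ge> 2 * (((real m)\<^sup>2 - 1) / 4 - 1)"
    using half_product_bound[of m, folded z_def] by simp
  also have "2 * (((real m)\<^sup>2 - 1) / 4 - 1) = real m * (real m / 2) - 5/2"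
    by (simp add: power2_eq_square field_simps)
  finally have q: "real m * (real m / 2) - 5/2 \<le> qf (S_graph n k) y ?V ?V" .
  have "sqn y ?V = (\<Sum>v\<in>{..<m}. 1)"
    unfolding sqn_def y_def using m(3) by (intro sum.mono_neutral_cong_right) auto
  hence s: "sqn y ?V = real m" by simp
  have "(real m / 2 - 1/50) * sqn y ?V \<le> qf (S_graph n k) y ?V ?V"
    using q m(2) unfolding s by (simp add: algebra_simps)
  moreover have "simple_graph n (S_graph n k)"
    using SG_simple[OF a ab] S_graph_eq[OF m(1)] m(2,3) by simp
  ultimately show ?thesis using s m(2,3) by (intro spec_rad_lower[of n _ _ y]) auto
qed

text \<open>The arithmetic of balancing. The balanced classes have sizes \<open>a\<close> and
  \<open>b\<close>, the smaller class lacks \<open>d\<close> vertices, \<open>p\<close> and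
  \<open>s\<close> are the eigenvector entries on the unbalanced classes, and \<open>q\<close> is
  the new entry on the larger class. Each side is a quadratic form minus \<open>L\<close> times a
  squared norm, for the old vector and for the test vector, with the common terms cancelled.\<close>

lemma SG_real_ineq:
  fixes L p q s d a b xb :: real
  assumes L: "0 < L" and d: "1 \<le> d" and ab: "2 \<le> a" "a + d \<le> b + d" and p: "0 < p"
    and dp: "d * p = L * (q - s)" and xb: "xb = L * p - (b + d - 1) * s"
    and q: "L * q \<le> (a + 1/5) * p" and La: "a - 1/50 \<le> L" and q0: "0 \<le> q"
  shows "2 * (L * s * (L * p)) - L * ((a - d - 1) * p\<^sup>2 + (b + d - 1) * s\<^sup>2)
    < 2 * (L * q * ((b - 1) * q + xb)) - L * ((a - 1) * p\<^sup>2 + (b - 1) * q\<^sup>2)"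
proof -
  let ?l = "2 * (L * s * (L * p)) - L * ((a - d - 1) * p\<^sup>2 + (b + d - 1) * s\<^sup>2)"
  let ?r = "2 * (L * q * ((b - 1) * q + xb)) - L * ((a - 1) * p\<^sup>2 + (b - 1) * q\<^sup>2)"
  have "?r - ?l = L * (2 * p * (L * (q - s)) - d * p\<^sup>2 - d * q\<^sup>2 + (b + d - 1) * (q - s)\<^sup>2)"
    unfolding xb by (simp add: algebra_simps power2_eq_square)
  also have "\<dots> = L * (d * p\<^sup>2 - d * q\<^sup>2 + (b + d - 1) * (q - s)\<^sup>2)"
    unfolding dp[symmetric] by (simp add: algebra_simps power2_eq_square)
  finally have e: "?r - ?l = L * (d * p\<^sup>2 - d * q\<^sup>2 + (b + d - 1) * (q - s)\<^sup>2)" .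
  \<comment> \<open>The squares of \<open>a + 1/5\<close> and \<open>a - 1/50\<close> differ by
    about 0.44 times \<open>a\<close>, which is less than the gain of at least \<open>a\<close> from
    the factor \<open>(b + d - 1) * d\<close>.\<close>
  have "(L * q)\<^sup>2 \<le> ((a + 1/5) * p)\<^sup>2" using q q0 L by (intro power_mono) auto
  also have "\<dots> = (a + 1/5)\<^sup>2 * p\<^sup>2" by (simp add: power_mult_distrib)
  also have "\<dots> < (L\<^sup>2 + a) * p\<^sup>2"
  proof -
    have "(a - 1/50)\<^sup>2 \<le> L\<^sup>2" using La ab by (intro power_mono) auto
    moreover have "(a + 1/5)\<^sup>2 < (a - 1/50)\<^sup>2 + a" using ab by (simp add: power2_eq_square algebra_simps)
    ultimately show ?thesis using p by (intro mult_strict_right_mono) auto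
  qed
  also have "\<dots> \<le> L\<^sup>2 * p\<^sup>2 + (b + d - 1) * d * p\<^sup>2"
  proof -
    have "a * 1 \<le> (b + d - 1) * d" using ab d by (intro mult_mono) auto
    hence "a * p\<^sup>2 \<le> (b + d - 1) * d * p\<^sup>2" by (intro mult_right_mono) auto
    thus ?thesis by (simp add: algebra_simps)
  qed
  finally have k: "0 < L\<^sup>2 * p\<^sup>2 + (b + d - 1) * d * p\<^sup>2 - (L * q)\<^sup>2" by simp
  have "L\<^sup>2 * (d * p\<^sup>2 - d * q\<^sup>2 + (b + d - 1) * (q - s)\<^sup>2)
    = d * (L\<^sup>2 * p\<^sup>2 - (L * q)\<^sup>2) + (b + d - 1) * (L * (q - s))\<^sup>2"
    by (simp add: algebra_simps power2_eq_square)
  also have "\<dots> = d * (L\<^sup>2 * p\<^sup>2 + (b + d - 1) * d * p\<^sup>2 - (L * q)\<^sup>2)"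
    unfolding dp[symmetric] by (simp add: algebra_simps power2_eq_square)
  also have "\<dots> > 0" using k d by (intro mult_pos_pos) auto
  finally have "0 < d * p\<^sup>2 - d * q\<^sup>2 + (b + d - 1) * (q - s)\<^sup>2"
    using L by (simp add: zero_less_mult_iff)
  thus ?thesis using e L mult_pos_pos[of L "d * p\<^sup>2 - d * q\<^sup>2 + (b + d - 1) * (q - s)\<^sup>2"] by linarith
qed

text \<open>If the smaller class had \<open>d\<close> vertices too few, a test vector on
  \<open>S_graph n k\<close> built from the eigenvector of the unbalanced graph would have a
  Rayleigh quotient above \<open>L\<close>.\<close>

lemma SG_extremal_aux:
  assumes arr: "arr n A B ps" and ab: "a \<in> A" "b \<in> B" and len: "length ps = 2 * k - 1" and k: "1 \<le> k"
    and nk: "187 * k \<le> n" and card: "card A \<le> card B"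
    and sr: "spec_rad n (S_graph n k) \<le> spec_rad n (SG A B a b ps)"
  shows "card A = (n - (2 * k - 1)) div 2"
proof (rule ccontr)
  assume neq: "\<not> ?thesis"
  define m where "m = n - (2 * k - 1)"
  define h where "h = m div 2"
  have m: "185 \<le> m" "m < n" using nk k unfolding m_def by auto
  have fin: "finite A" "finite B" using arr_finite[OF arr] by auto
  have cm: "card A + card B = m" using arr_card[OF arr] len unfolding m_def by simp
  hence "card A < h" using neq card unfolding m_def[symmetric] h_def by linarith
  then obtain d where d: "card A + d = h" "1 \<le> d" by (metis add_diff_inverse_nat less_imp_le_nat linorder_not_le zero_less_diff Suc_leI One_nat_def)
  have cB: "card B = m - h + d" using cm d unfolding h_def by linarith
  have hm: "h \<le> m - h" "2 \<le> h" "h < m" using m unfolding h_def by auto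
  let ?V = "{..<n}" and ?G = "SG A B a b ps"
  define L where "L = spec_rad n ?G"
  have n0: "n > 0" using m by simp
  have sg: "simple_graph n ?G" by (rule SG_simple[OF arr ab])
  obtain x where x: "\<And>v. 0 \<le> x v" "sqn x ?V \<noteq> 0" "\<And>v. v < n \<Longrightarrow> nsum ?G x ?V v = L * x v"
    using spec_rad_perron[OF sg n0] unfolding L_def by blast
  have Lm: "real m / 2 - 1 / 50 \<le> L"
    using spec_rad_S_ge[OF m_def m] sr unfolding L_def by linarith
  hence L4: "90 < L" using m by simp
  hence L4': "4 < L" "0 < L" by simp_all
  let ?A = "{..<m div 2}" and ?B = "{m div 2..<m}"
  have H: "S_graph n k = SG ?A ?B 0 (m div 2) [m..<n]" using S_graph_eq[OF m_def] m by simp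
  have aH: "arr n ?A ?B [m..<n]" using turan_arr m by simp
  have abH: "0 \<in> ?A" "m div 2 \<in> ?B" using m by auto
  define sB where "sB = sum x B"
  define sA where "sA = sum x A"
  define p where "p = sB / L"
  define s where "s = sA / L"
  \<comment> \<open>Chosen so that \<open>L * q\<close> is the sum of the test vector over the
    enlarged class, that is, so that the eigenvalue equation holds at ordinary vertices of the other
    class.\<close>
  define q where "q = ((real h - 1) * p + x a) / L"
  have sB0: "0 < sB" unfolding sB_def using SG_sum_pos[OF arr ab x(1,3) L4'(1) x(2)] .
  have an: "a < n" and bn: "b < n" using arr ab unfolding arr_def by auto
  have xA: "x v = p" if "v \<in> A" "v \<noteq> a" for v
  proof -
    have "v < n" using that arr unfolding arr_def by auto
    thus ?thesis using SG_nsum_A[OF arr ab that, of x] x(3) L4' unfolding p_def sB_def by (simp add: field_simps)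
  qed
  have xB: "x v = s" if v: "v \<in> B" "v \<noteq> b" for v
  proof -
    have "v < n" using v arr unfolding arr_def by auto
    hence "nsum ?G x ?V v = L * x v" using x(3) by simp
    moreover have "?G = SG B A b a (rev ps)" by (intro ext) (rule SG_swap)
    moreover have "nsum (SG B A b a (rev ps)) x ?V v = sum x A" by (rule SG_nsum_A[OF arr_swap[OF arr] ab(2,1) v])
    ultimately show ?thesis using L4' unfolding s_def sA_def by (simp add: field_simps)
  qed
  have c1: "1 \<le> card A" "1 \<le> card B" using fin ab by (auto simp: Suc_le_eq card_gt_0_iff)
  have cA1: "real (card (A - {a})) = real h - real d - 1"
  proof -
    have "real h = real (card A) + real d" using d by (metis of_nat_add)
    thus ?thesis using fin ab c1 by (simp add: card_Diff_singleton of_nat_diff)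
  qed
  have cB1: "real (card (B - {b})) = real (m - h) + real d - 1"
    using fin ab cB c1 by (simp add: card_Diff_singleton of_nat_diff)
  have sumA: "sA = (real h - real d - 1) * p + x a"
  proof -
    have "sum x (A - {a}) = (\<Sum>v\<in>A - {a}. p)" by (rule sum.cong) (auto simp: xA)
    thus ?thesis unfolding sA_def using sum.remove[OF fin(1) ab(1), of x] cA1 by simp
  qed
  have sumB: "sB = (real (m - h) + real d - 1) * s + x b"
  proof -
    have "sum x (B - {b}) = (\<Sum>v\<in>B - {b}. s)" by (rule sum.cong) (auto simp: xB)
    thus ?thesis unfolding sB_def using sum.remove[OF fin(2) ab(2), of x] cB1 by simp
  qed
  have sqA: "sqn x A = (real h - real d - 1) * p\<^sup>2 + (x a)\<^sup>2"
  proof -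
    have "(\<Sum>v\<in>A - {a}. (x v)\<^sup>2) = (\<Sum>v\<in>A - {a}. p\<^sup>2)" by (rule sum.cong) (auto simp: xA)
    thus ?thesis unfolding sqn_def using sum.remove[OF fin(1) ab(1), of "\<lambda>v. (x v)\<^sup>2"] cA1 by simp
  qed
  have sqB: "sqn x B = (real (m - h) + real d - 1) * s\<^sup>2 + (x b)\<^sup>2"
  proof -
    have "(\<Sum>v\<in>B - {b}. (x v)\<^sup>2) = (\<Sum>v\<in>B - {b}. s\<^sup>2)" by (rule sum.cong) (auto simp: xB)
    thus ?thesis unfolding sqn_def using sum.remove[OF fin(2) ab(2), of "\<lambda>v. (x v)\<^sup>2"] cB1 by simp
  qed
  have dis: "A \<inter> B = {}" "(A \<union> B) \<inter> set ps = {}" "?V = (A \<union> B) \<union> set ps" using arr unfolding arr_def by auto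
  have sqV: "sqn x ?V = sqn x A + sqn x B + sqn x (set ps)"
    unfolding dis(3) using fin dis by (simp add: sqn_Un)
  have qfG: "L * sqn x ?V = 2 * (sA * sB - x a * x b) + 2 * psum x (a # ps @ [b])"
    using qf_eigen[of ?V ?G x ?V L] x(3) qf_SG[OF arr ab, of x] unfolding sA_def sB_def by simp

  \<comment> \<open>The vertices added to the smaller class receive its common entry
    \<open>p\<close>; \<open>a\<close>, \<open>b\<close> and the path keep their entries; the rest
    of the larger class gets \<open>q\<close>.\<close>
  define y where "y j = (if j = 0 then x a else if j < h then p else if j = h then x b
      else if j < m then q else x (ps ! (j - m)))" for j
  have ylen: "length [m..<n] = length ps" using len k m nk unfolding m_def by simp
  have "map y (0 # [m..<n] @ [h]) = map x (a # ps @ [b])"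
  proof -
    have "map y [m..<n] = map x ps"
    proof (rule nth_equalityI)
      show "length (map y [m..<n]) = length (map x ps)" using ylen by simp
      fix i assume "i < length (map y [m..<n])"
      hence i: "i < length [m..<n]" by simp
      hence "y ([m..<n] ! i) = x (ps ! i)" using hm by (simp add: y_def)
      thus "map y [m..<n] ! i = map x ps ! i" using i ylen by simp
    qed
    moreover have "y 0 = x a" "y h = x b" using hm unfolding y_def by auto
    ultimately show ?thesis by simp
  qed
  hence psy: "psum y (0 # [m..<n] @ [h]) = psum x (a # ps @ [b])" by (rule psum_map_cong)
  have ysum: "(\<Sum>v\<in>{..<m div 2}. f (y v)) = f (x a) + (real h - 1) * f p"
    "(\<Sum>v\<in>{m div 2..<m}. f (y v)) = f (x b) + (real (m - h) - 1) * f q" for f :: "real \<Rightarrow> real"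
  proof -
    have "{..<m div 2} = insert 0 {1..<h}" using hm unfolding h_def by auto
    moreover have "(\<Sum>v\<in>{1..<h}. f (y v)) = (\<Sum>v\<in>{1..<h}. f p)"
      by (rule sum.cong[OF refl]) (auto simp: y_def)
    moreover have "y 0 = x a" unfolding y_def by simp
    ultimately show "(\<Sum>v\<in>{..<m div 2}. f (y v)) = f (x a) + (real h - 1) * f p"
      using hm by (simp add: of_nat_diff)
    have "{m div 2..<m} = insert h {Suc h..<m}" using hm unfolding h_def by auto
    moreover have "(\<Sum>v\<in>{Suc h..<m}. f (y v)) = (\<Sum>v\<in>{Suc h..<m}. f q)"
      by (rule sum.cong[OF refl]) (auto simp: y_def)
    moreover have "y h = x b" using hm unfolding y_def by simp
    ultimately show "(\<Sum>v\<in>{m div 2..<m}. f (y v)) = f (x b) + (real (m - h) - 1) * f q"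
      using hm by (simp add: of_nat_diff algebra_simps)
  qed
  have y0: "y 0 = x a" "y (m div 2) = x b" using hm unfolding y_def h_def by auto
  have ysA: "sum y ?A = L * q" using ysum(1)[of "\<lambda>z. z"] L4' unfolding q_def by simp
  have ysB: "sum y ?B = (real (m - h) - 1) * q + x b" using ysum(2)[of "\<lambda>z. z"] by simp
  have yqA: "sqn y ?A = (real h - 1) * p\<^sup>2 + (x a)\<^sup>2" using ysum(1)[of "\<lambda>z. z\<^sup>2"] unfolding sqn_def by simp
  have yqB: "sqn y ?B = (real (m - h) - 1) * q\<^sup>2 + (x b)\<^sup>2" using ysum(2)[of "\<lambda>z. z\<^sup>2"] unfolding sqn_def by simp
  have yqP: "sqn y {m..<n} = sqn x (set ps)"
  proof -
    have "sqn x (set ps) = (\<Sum>v\<leftarrow>ps. (x v)\<^sup>2)"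
      unfolding sqn_def using arr by (simp add: arr_def sum_list_distinct_conv_sum_set)
    also have "\<dots> = (\<Sum>i<length ps. (x (ps ! i))\<^sup>2)"
      by (simp add: sum_list_sum_nth lessThan_atLeast0)
    also have "\<dots> = (\<Sum>i<length ps. (y (m + i))\<^sup>2)"
      using hm by (intro sum.cong refl) (simp add: y_def)
    also have "\<dots> = (\<Sum>j\<in>{m..<n}. (y j)\<^sup>2)"
      using ylen by (intro sum.reindex_bij_witness[of _ "\<lambda>j. j - m" "\<lambda>i. m + i"]) auto
    finally show ?thesis unfolding sqn_def by simp
  qed
  have yV: "sqn y ?V = sqn y ?A + sqn y ?B + sqn y {m..<n}"
  proof -
    have "?V = (?A \<union> ?B) \<union> {m..<n}" using m by auto
    moreover have "?A \<inter> ?B = {}" "(?A \<union> ?B) \<inter> {m..<n} = {}" by auto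
    ultimately show ?thesis by (simp only: sqn_Un finite_Un finite_lessThan finite_atLeastLessThan)
  qed
  have qfH: "qf (S_graph n k) y ?V ?V = 2 * (L * q * ((real (m - h) - 1) * q + x b) - x a * x b) + 2 * psum x (a # ps @ [b])"
    unfolding H qf_SG[OF aH abH] ysA ysB y0 using psy unfolding h_def by simp
  \<comment> \<open>Since \<open>L\<close> exceeds 90, the first path vertex weighs at most 2/90 of
    \<open>sB\<close>, well within the allowance of 1/5.\<close>
  have xaL: "L * x a \<le> 6/5 * sB"
  proof -
    have "L * x a = sum x (B - {b}) + x (hd ps)" using SG_nsum_a[OF arr ab, of x] x(3)[OF an] by simp
    moreover have "sum x (B - {b}) \<le> sB" unfolding sB_def using fin x(1) by (intro sum_mono2) auto
    moreover have "90 * x (hd ps) \<le> L * x (hd ps)" using L4 x(1) by (intro mult_right_mono) auto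
    moreover have "L * x (hd ps) \<le> 2 * sB" unfolding sB_def using SG_eigen_bounds(2)[OF arr ab x(1,3) L4'(1)] .
    ultimately show ?thesis using sB0 by linarith
  qed
  have pL: "L * p = sB" and sL: "L * s = sA" unfolding p_def s_def using L4' by simp_all
  have "2 * (L * s * (L * p)) - L * ((real h - real d - 1) * p\<^sup>2 + (real (m - h) + real d - 1) * s\<^sup>2)
    < 2 * (L * q * ((real (m - h) - 1) * q + x b)) - L * ((real h - 1) * p\<^sup>2 + (real (m - h) - 1) * q\<^sup>2)"
  proof (rule SG_real_ineq)
    show "0 < L" "1 \<le> real d" "2 \<le> real h" using L4' d hm by auto
    show "real h + real d \<le> real (m - h) + real d" using hm by simp
    show p0: "0 < p" unfolding p_def using sB0 L4' by simp
    have Lq: "L * q = (real h - 1) * p + x a" unfolding q_def using L4' by simp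
    show "real d * p = L * (q - s)" using Lq sL sumA by (simp add: algebra_simps)
    show "x b = L * p - (real (m - h) + real d - 1) * s" using pL sumB by simp
    have "x a \<le> 6/5 * p" unfolding p_def using xaL L4' by (simp add: field_simps)
    thus "L * q \<le> (real h + 1/5) * p" using Lq by (simp add: algebra_simps)
    show "real h - 1/50 \<le> L" using Lm hm(1) unfolding h_def by linarith
    show "0 \<le> q" unfolding q_def using p0 x(1)[of a] L4' hm by simp
  qed
  hence "L * sqn y ?V < qf (S_graph n k) y ?V ?V"
    using qfG unfolding qfH yV sqV yqA yqB yqP sqA sqB pL sL by (simp add: algebra_simps)
  also have "\<dots> \<le> spec_rad n (S_graph n k) * sqn y ?V"
    using SG_simple[OF aH abH] n0 unfolding H by (intro spec_rad_ge) auto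
  also have "\<dots> \<le> L * sqn y ?V" using sr unfolding L_def by (intro mult_right_mono) auto
  finally show False by simp
qed

section \<open>Isomorphisms between arrangements of the same sizes\<close>

lemma graph_iso_arr:
  assumes arr: "arr n A B ps" "arr n A' B' ps'" and ab: "a \<in> A" "b \<in> B" "a' \<in> A'" "b' \<in> B'"
    and c: "card A = card A'" "card B = card B'" "length ps = length ps'"
  obtains f where "bij_betw f {0..<n} {0..<n}" "f ` A = A'" "f ` B = B'" "f a = a'" "f b = b'" "map f ps = ps'"
proof -
  have fin: "finite A" "finite B" "finite A'" "finite B'" using arr_finite[OF arr(1)] arr_finite[OF arr(2)] by auto
  have "card (A - {a}) = card (A' - {a'})" "card (B - {b}) = card (B' - {b'})"
    using fin ab c by auto
  then obtain g1 g2 where g: "bij_betw g1 (A - {a}) (A' - {a'})" "bij_betw g2 (B - {b}) (B' - {b'})"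
    using fin finite_same_card_bij by (metis finite_Diff)
  have dps: "distinct ps" "distinct ps'" using arr unfolding arr_def by auto
  have "\<exists>g3. map g3 ps = ps' \<and> bij_betw g3 (set ps) (set ps')"
  proof -
    define g3 where "g3 v = ps' ! (THE i. i < length ps \<and> ps ! i = v)" for v
    have e: "g3 (ps ! i) = ps' ! i" if "i < length ps" for i
    proof -
      have "(THE j. j < length ps \<and> ps ! j = ps ! i) = i"
        using that dps(1) by (intro the_equality) (auto simp: nth_eq_iff_index_eq)
      thus ?thesis unfolding g3_def by simp
    qed
    have m: "map g3 ps = ps'" using e c(3) by (intro nth_equalityI) auto
    have "inj_on g3 (set ps)"
      using e dps c(3) by (auto simp: inj_on_def in_set_conv_nth nth_eq_iff_index_eq)
    moreover have "g3 ` set ps = set ps'" using m by (metis list.set_map)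
    ultimately show ?thesis using m unfolding bij_betw_def by blast
  qed
  then obtain g3 where g3: "map g3 ps = ps'" "bij_betw g3 (set ps) (set ps')" by blast
  define f where "f v = (if v = a then a' else if v \<in> A then g1 v else if v = b then b' else if v \<in> B then g2 v else g3 v)" for v
  have dis: "A \<inter> B = {}" "set ps \<inter> (A \<union> B) = {}" "A' \<inter> B' = {}" "set ps' \<inter> (A' \<union> B') = {}"
    using arr unfolding arr_def by auto
  have ib: "inj_on f A" "f ` A = A'"
  proof -
    have "f ` (A - {a}) = A' - {a'}" using g(1) unfolding bij_betw_def f_def by auto
    moreover have "f a = a'" unfolding f_def by simp
    ultimately show "f ` A = A'" using ab by (metis image_insert insert_Diff)
    thus "inj_on f A" using fin c by (simp add: eq_card_imp_inj_on)
  qed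
  have ib2: "inj_on f B" "f ` B = B'"
  proof -
    have "f v = g2 v" if "v \<in> B - {b}" for v using that dis ab unfolding f_def by auto
    hence "f ` (B - {b}) = B' - {b'}" using g(2) unfolding bij_betw_def by auto
    moreover have "f b = b'" using dis ab unfolding f_def by auto
    ultimately show "f ` B = B'" using ab by (metis image_insert insert_Diff)
    thus "inj_on f B" using fin c by (simp add: eq_card_imp_inj_on)
  qed
  have f3: "f v = g3 v" if "v \<in> set ps" for v using that dis ab unfolding f_def by auto
  have ib3: "inj_on f (set ps)" "f ` set ps = set ps'"
    using g3(2) f3 unfolding bij_betw_def by (auto simp: inj_on_def)
  have injU: "inj_on f (X \<union> Y)" if "inj_on f X" "inj_on f Y" "f ` X \<inter> f ` Y = {}" for X Y
    using that by (simp add: inj_on_Un) blast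
  have "inj_on f (A \<union> B \<union> set ps)"
    using ib ib2 ib3 dis by (intro injU) (auto simp: image_Un)
  moreover have "f ` (A \<union> B \<union> set ps) = A' \<union> B' \<union> set ps'" using ib ib2 ib3 by (simp add: image_Un)
  ultimately have "bij_betw f {0..<n} {0..<n}"
    using arr unfolding arr_def bij_betw_def by (simp add: lessThan_atLeast0)
  moreover have "map f ps = ps'" using g3(1) f3 by (metis map_cong)
  moreover have "f a = a'" "f b = b'" using dis ab unfolding f_def by auto
  ultimately show ?thesis using that ib ib2 by blast
qed

lemma path_edge_map:
  assumes "inj_on f (insert u (insert v (set zs)))"
  shows "path_edge (map f zs) (f u) (f v) \<longleftrightarrow> path_edge zs u v"
proof -
  have e: "f w = f (zs ! i) \<longleftrightarrow> w = zs ! i" if "w \<in> {u, v}" "i < length zs" for w i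
    using assms that by (auto simp: inj_on_eq_iff)
  show ?thesis unfolding path_edge_def
    by (intro iff_exI) (use e in \<open>auto simp: Suc_lessD\<close>)
qed

lemma SG_iso:
  assumes arr: "arr n A B ps" "arr n A' B' ps'" and ab: "a \<in> A" "b \<in> B" "a' \<in> A'" "b' \<in> B'"
    and c: "card A = card A'" "card B = card B'" "length ps = length ps'"
  shows "graph_iso n (SG A B a b ps) (SG A' B' a' b' ps')"
proof -
  obtain f where f: "bij_betw f {0..<n} {0..<n}" "f ` A = A'" "f ` B = B'" "f a = a'" "f b = b'" "map f ps = ps'"
    using graph_iso_arr[OF arr ab c] by blast
  have inj: "inj_on f {..<n}" using f(1) unfolding bij_betw_def by (simp add: lessThan_atLeast0)
  have sub: "A \<subseteq> {..<n}" "B \<subseteq> {..<n}" "set ps \<subseteq> {..<n}" using arr(1) unfolding arr_def by auto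
  have "SG A B a b ps u v \<longleftrightarrow> SG A' B' a' b' ps' (f u) (f v)" if uv: "u < n" "v < n" for u v
  proof -
    have "w \<in> A \<longleftrightarrow> f w \<in> A'" "w \<in> B \<longleftrightarrow> f w \<in> B'" if "w < n" for w
      using that inj sub unfolding f(2,3)[symmetric] by (simp_all add: inj_on_image_mem_iff)
    moreover have "{u,v} = {a,b} \<longleftrightarrow> {f u, f v} = {a',b'}"
    proof -
      have "{f u, f v} = {a',b'} \<longleftrightarrow> f ` {u,v} = f ` {a,b}" using f by simp
      also have "\<dots> \<longleftrightarrow> {u,v} = {a,b}" using inj uv ab sub by (intro inj_on_image_eq_iff) auto
      finally show ?thesis by simp
    qed
    moreover have "path_edge (a # ps @ [b]) u v \<longleftrightarrow> path_edge (a' # ps' @ [b']) (f u) (f v)"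
    proof -
      have "a' # ps' @ [b'] = map f (a # ps @ [b])" using f by simp
      moreover have "inj_on f (insert u (insert v (set (a # ps @ [b]))))"
        by (rule inj_on_subset[OF inj]) (use uv ab sub in auto)
      ultimately show ?thesis using path_edge_map by metis
    qed
    ultimately show ?thesis using uv unfolding SG_def bipK_def by auto
  qed
  thus ?thesis unfolding graph_iso_def using f(1) by blast
qed

text \<open>Reversing the path exchanges the two classes, so \<open>A\<close> may be taken as the
  smaller one.\<close>

lemma SG_extremal:
  assumes arr: "arr n A B ps" and ab: "a \<in> A" "b \<in> B" and len: "length ps = 2 * k - 1" and k: "1 \<le> k"
    and nk: "187 * k \<le> n"
    and sr: "spec_rad n (S_graph n k) \<le> spec_rad n (SG A B a b ps)"
  shows "graph_iso n (SG A B a b ps) (S_graph n k)"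
proof -
  have main: "graph_iso n (SG A B a b ps) (S_graph n k)"
    if arr: "arr n A B ps" and ab: "a \<in> A" "b \<in> B" and len: "length ps = 2 * k - 1"
    and sr: "spec_rad n (S_graph n k) \<le> spec_rad n (SG A B a b ps)" and card: "card A \<le> card B"
    for A B a b ps
  proof -
    define m where "m = n - (2 * k - 1)"
    have m: "185 \<le> m" "m < n" using nk k unfolding m_def by auto
    have cA: "card A = m div 2" unfolding m_def by (rule SG_extremal_aux[OF arr ab len k nk card sr])
    have "card A + card B = m" using arr_card[OF arr] len unfolding m_def by linarith
    hence cB: "card B = m - m div 2" using cA by linarith
    have "S_graph n k = SG {..<m div 2} {m div 2..<m} 0 (m div 2) [m..<n]" using S_graph_eq[OF m_def] m by simp
    moreover have "graph_iso n (SG A B a b ps) (SG {..<m div 2} {m div 2..<m} 0 (m div 2) [m..<n])"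
      using m len k nk ab cA cB turan_arr[of m n] by (intro SG_iso[OF arr]) (auto simp: m_def)
    ultimately show ?thesis by simp
  qed
  show ?thesis
  proof (cases "card A \<le> card B")
    case True
    thus ?thesis using main[OF arr ab len sr] by blast
  next
    case False
    have e: "SG A B a b ps = SG B A b a (rev ps)" by (intro ext) (rule SG_swap)
    show ?thesis using main[OF arr_swap[OF arr] ab(2,1) _ sr[unfolded e]] False len unfolding e by simp
  qed
qed

section \<open>The subdivided complete bipartite graph\<close>

text \<open>The possible shapes of a near-extremal graph in part (a): a subgraph of a bipartite graph with an edge
  replaced by a path. Adjacent neighbours of the two ends of \<open>ps\<close> would close a cycle of length \<open>length ps + 2\<close>.\<close>
definition typeS :: "nat \<Rightarrow> (nat \<Rightarrow> nat \<Rightarrow> bool) \<Rightarrow> nat set \<Rightarrow> nat set \<Rightarrow> nat list \<Rightarrow> bool" where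
  "typeS n E A B ps \<longleftrightarrow> A \<union> B \<union> set ps \<subseteq> {..<n} \<and> A \<inter> B = {} \<and> set ps \<inter> (A \<union> B) = {} \<and> distinct ps \<and> ps \<noteq> [] \<and>
     (\<forall>u\<in>A. \<forall>v\<in>A. \<not> E u v) \<and> (\<forall>u\<in>B. \<forall>v\<in>B. \<not> E u v) \<and>
     (\<forall>p\<in>set ps. \<forall>a\<in>A. E p a \<longrightarrow> p = hd ps) \<and> (\<forall>p\<in>set ps. \<forall>b\<in>B. E p b \<longrightarrow> p = last ps) \<and>
     (\<forall>a\<in>A. \<forall>b\<in>B. E (hd ps) a \<longrightarrow> E (last ps) b \<longrightarrow> \<not> E a b) \<and>
     (\<exists>a\<in>A. E (hd ps) a) \<and> (\<exists>b\<in>B. E (last ps) b)"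

lemma typeSD:
  assumes "typeS n E A B ps"
  shows "A \<union> B \<union> set ps \<subseteq> {..<n}" "A \<inter> B = {}" "set ps \<inter> (A \<union> B) = {}" "distinct ps" "ps \<noteq> []"
    "\<And>u v. u \<in> A \<Longrightarrow> v \<in> A \<Longrightarrow> \<not> E u v" "\<And>u v. u \<in> B \<Longrightarrow> v \<in> B \<Longrightarrow> \<not> E u v"
    "\<And>p a. p \<in> set ps \<Longrightarrow> a \<in> A \<Longrightarrow> E p a \<Longrightarrow> p = hd ps" "\<And>p b. p \<in> set ps \<Longrightarrow> b \<in> B \<Longrightarrow> E p b \<Longrightarrow> p = last ps"
    "\<And>a b. a \<in> A \<Longrightarrow> b \<in> B \<Longrightarrow> E (hd ps) a \<Longrightarrow> E (last ps) b \<Longrightarrow> \<not> E a b"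
    "\<exists>a\<in>A. E (hd ps) a" "\<exists>b\<in>B. E (last ps) b"
  using assms unfolding typeS_def by blast+

lemma typeS_swap:
  assumes "simple_graph n E" "typeS n E A B ps"
  shows "typeS n E B A (rev ps)"
proof -
  note S = typeSD[OF assms(2)]
  have hl: "hd (rev ps) = last ps" "last (rev ps) = hd ps" using S(5) by (simp_all add: hd_rev last_rev)
  have "\<forall>a\<in>B. \<forall>b\<in>A. E (last ps) a \<longrightarrow> E (hd ps) b \<longrightarrow> \<not> E a b"
    using S(10) simple_graph_commute[OF assms(1)] by meson
  moreover have "B \<union> A \<union> set ps \<subseteq> {..<n}" "B \<inter> A = {}" "set ps \<inter> (B \<union> A) = {}" using S(1-3) by auto
  ultimately show ?thesis unfolding typeS_def hl set_rev distinct_rev rev_is_Nil_conv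
    using S(4-9,11,12) by (intro conjI ballI impI) (assumption | metis)+
qed

lemma sum_attached:
  assumes "finite P" "c \<in> P" "finite A" "\<And>p a. p \<in> P \<Longrightarrow> a \<in> A \<Longrightarrow> E p a \<Longrightarrow> p = c"
  shows "(\<Sum>p\<in>P. f p * nsum E x A p) = f c * sum x {a\<in>A. E c a}"
proof -
  have "(\<Sum>p\<in>P. f p * nsum E x A p) = (\<Sum>p\<in>P. if p = c then f c * nsum E x A c else 0)"
    using assms(4) by (intro sum.cong refl) (auto intro!: nsum_eq_0)
  thus ?thesis using assms(1-3) by (simp add: nsum_eq_sum_filter)
qed

context
  fixes n E A B ps
  assumes G: "simple_graph n E" and S: "typeS n E A B ps"
begin

lemma typeS_finite: "finite A" "finite B" "A \<inter> B = {}" "(A \<union> B) \<inter> set ps = {}"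
  "hd ps \<in> set ps" "last ps \<in> set ps"
proof -
  note T = typeSD[OF S]
  have "finite (A \<union> B \<union> set ps)" using finite_subset[OF T(1)] by simp
  thus "finite A" "finite B" by auto
  show "A \<inter> B = {}" "(A \<union> B) \<inter> set ps = {}" "hd ps \<in> set ps" "last ps \<in> set ps"
    using T(2,3,5) by auto
qed

lemma qf_typeS:
  "qf E x (A \<union> B \<union> set ps) (A \<union> B \<union> set ps) = 2 * qf E x A B
    + 2 * x (hd ps) * sum x {a\<in>A. E (hd ps) a} + 2 * x (last ps) * sum x {b\<in>B. E (last ps) b} + qf E x (set ps) (set ps)"
proof -
  note fin = typeS_finite
  have "qf E x (A \<union> B \<union> set ps) (A \<union> B \<union> set ps)
    = qf E x (A \<union> B) (A \<union> B) + 2 * qf E x (A \<union> B) (set ps) + qf E x (set ps) (set ps)"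
    using fin by (intro qf_Un_square[OF G]) auto
  also have "qf E x (A \<union> B) (A \<union> B) = qf E x A A + 2 * qf E x A B + qf E x B B"
    using fin by (intro qf_Un_square[OF G]) auto
  also have "qf E x A A = 0" using typeSD[OF S] by (intro qf_eq_0) blast
  also have "qf E x B B = 0" using typeSD[OF S] by (intro qf_eq_0) blast
  also have "qf E x (A \<union> B) (set ps) = qf E x (set ps) (A \<union> B)" by (rule qf_commute[OF G])
  also have "\<dots> = qf E x (set ps) A + qf E x (set ps) B" using fin by (intro qf_Un_right) auto
  also have "qf E x (set ps) A = x (hd ps) * sum x {a\<in>A. E (hd ps) a}"
    unfolding qf_def using fin typeSD(8,9)[OF S] by (intro sum_attached) auto
  also have "qf E x (set ps) B = x (last ps) * sum x {b\<in>B. E (last ps) b}"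
    unfolding qf_def using fin typeSD(8,9)[OF S] by (intro sum_attached) auto
  finally show ?thesis by (simp add: algebra_simps)
qed

text \<open>No edge joins a neighbour of \<open>hd ps\<close> in \<open>A\<close> to a neighbour of
  \<open>last ps\<close> in \<open>B\<close>, so the product of these two weights is lost. This loss
  pays for additional edges at the ends of the path.\<close>

lemma qf_AB_le:
  assumes x0: "\<And>v. 0 \<le> x v"
  shows "qf E x A B \<le> sum x A * sum x B - sum x {a\<in>A. E (hd ps) a} * sum x {b\<in>B. E (last ps) b}"
proof -
  note fin = typeS_finite
  let ?A = "{a\<in>A. E (hd ps) a}" and ?B = "{b\<in>B. E (last ps) b}"
  have A: "A = ?A \<union> (A - ?A)" and B: "B = ?B \<union> (B - ?B)" by auto
  have "qf E x A B = qf E x ?A B + qf E x (A - ?A) B"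
    by (subst A, rule qf_Un_left) (use fin in auto)
  also have "qf E x ?A B = qf E x ?A ?B + qf E x ?A (B - ?B)"
    by (subst (1) B, rule qf_Un_right) (use fin in auto)
  also have "qf E x ?A ?B = 0" using typeSD[OF S] by (intro qf_eq_0) blast
  also have "qf E x ?A (B - ?B) \<le> sum x ?A * sum x (B - ?B)" using fin x0 by (intro qf_le_sum_mult) auto
  also have "qf E x (A - ?A) B \<le> sum x (A - ?A) * sum x B" using fin x0 by (intro qf_le_sum_mult) auto
  also have "sum x (B - ?B) = sum x B - sum x ?B" using fin by (intro sum_diff) auto
  also have "sum x (A - ?A) = sum x A - sum x ?A" using fin by (intro sum_diff) auto
  finally show ?thesis by (simp add: algebra_simps)
qed

end

lemma nsum_path_sum_le:
  assumes "finite P" "\<And>v. 0 \<le> x v" "\<And>u v. u \<in> P \<Longrightarrow> v \<in> P \<Longrightarrow> E u v \<longleftrightarrow> path_edge zs u v" "distinct zs"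
  shows "(\<Sum>p\<in>P. nsum E x P p) \<le> 2 * sum x P"
proof -
  have "(\<Sum>p\<in>P. nsum E x P p) = (\<Sum>w\<in>P. \<Sum>p\<in>P. if E p w then x w else 0)"
    unfolding nsum_def by (rule sum.swap)
  also have "\<dots> \<le> (\<Sum>w\<in>P. 2 * x w)"
  proof (rule sum_mono)
    fix w assume w: "w \<in> P"
    have "{p\<in>P. E p w} \<subseteq> {p. path_edge zs w p}" using assms(3) w path_edge_sym by blast
    hence "card {p\<in>P. E p w} \<le> 2"
      using path_edge_card_le_2[OF assms(4), of w] card_mono by (meson order_trans)
    hence "real (card {p\<in>P. E p w}) * x w \<le> 2 * x w" using assms(2) by (intro mult_right_mono) auto
    thus "(\<Sum>p\<in>P. if E p w then x w else 0) \<le> 2 * x w"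
      using assms(1) by (simp add: sum.If_cases Int_def)
  qed
  finally show ?thesis by (simp add: sum_distrib_left)
qed

lemma sum_ge_two:
  assumes "finite P" "c \<in> P" "d \<in> P" "\<And>v. 0 \<le> (x v :: real)"
  shows "x c + x d \<le> 2 * sum x P"
  using member_le_sum[of c P x] member_le_sum[of d P x] assms by auto

lemma ex_max_elem:
  assumes "finite X" "X \<noteq> {}"
  shows "\<exists>a\<in>X. \<forall>b\<in>X. (x b :: real) \<le> x a"
proof -
  have "Max (x ` X) \<in> x ` X" using assms by (intro Max_in) auto
  then obtain a where "a \<in> X" "Max (x ` X) = x a" by blast
  thus ?thesis using assms by (metis Max_ge finite_imageI imageI)
qed

text \<open>Switching: remove the edges from the ends of \<open>ps\<close> except those to \<open>a\<close> and \<open>b\<close>, and complete the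
  bipartite graph. Under the hypotheses \<open>le\<close> this does not decrease the Rayleigh quotient.\<close>
lemma typeS_standard:
  assumes G: "simple_graph n E" and S: "typeS n E A B ps" and cov: "A \<union> B \<union> set ps = {..<n}"
    and ind: "\<And>u v. u \<in> set ps \<Longrightarrow> v \<in> set ps \<Longrightarrow> E u v \<longleftrightarrow> path_edge ps u v"
    and len: "length ps = 2 * k - 1" and k: "1 \<le> k" and nk: "187 * k \<le> n"
    and card: "2 \<le> card A" "2 \<le> card B"
    and sr: "spec_rad n (S_graph n k) \<le> spec_rad n E"
    and x: "\<And>v. 0 \<le> x v" "sqn x {..<n} \<noteq> 0" "\<And>v. v < n \<Longrightarrow> nsum E x {..<n} v = spec_rad n E * x v"
    and a: "a \<in> A" "E (hd ps) a" and b: "b \<in> B" "E (last ps) b"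
    and le: "x (hd ps) \<le> x b" "x (last ps) \<le> x a" and L: "4 < spec_rad n E"
  shows "graph_iso n E (S_graph n k)"
proof -
  let ?V = "{..<n}" and ?c = "hd ps" and ?d = "last ps" and ?L = "spec_rad n E"
  let ?A = "{a\<in>A. E ?c a}" and ?B = "{b\<in>B. E ?d b}" and ?G = "SG A B a b ps"
  have n0: "0 < n" using k nk by simp
  note fin = typeS_finite[OF G S]
  have ne: "ps \<noteq> []" and dps: "distinct ps" using typeSD[OF S] by auto
  have arr: "arr n A B ps" unfolding arr_def using cov typeSD(2-5)[OF S] by blast
  have sg: "simple_graph n ?G" by (rule SG_simple[OF arr a(1) b(1)])
  have q1: "qf E x (set ps) (set ps) = 2 * psum x ps"
  proof -
    have "qf E x (set ps) (set ps) = qf (path_edge ps) x (set ps) (set ps)" by (rule qf_cong) (use ind in auto)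
    thus ?thesis using qf_path_edge[OF _ dps order_refl, of x] by simp
  qed
  have qE: "?L * sqn x ?V = 2 * qf E x A B + 2 * x ?c * sum x ?A + 2 * x ?d * sum x ?B + 2 * psum x ps"
    using qf_eigen[of ?V E x ?V ?L] x(3) qf_typeS[OF G S, of x] unfolding cov q1 by simp
  have ps1: "psum x (a # ps @ [b]) = x a * x ?c + psum x ps + x ?d * x b"
  proof -
    have "psum x (a # ps @ [b]) = x a * x ?c + psum x (ps @ [b])" using ne by (cases ps) auto
    moreover have "psum x (ps @ [b]) = psum x ps + x ?d * x b"
    proof -
      have e: "ps = butlast ps @ [?d]" using ne by simp
      have "psum x (butlast ps @ ?d # [b]) = psum x (butlast ps @ [?d]) + psum x [?d, b]" by (rule psum_append)
      thus ?thesis using e by (metis append.assoc append_Cons append_Nil psum.simps(1,3) add.right_neutral)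
    qed
    ultimately show ?thesis by simp
  qed
  have aA: "x a \<le> sum x ?A" using a fin x(1) by (intro member_le_sum) auto
  have bB: "x b \<le> sum x ?B" using b fin x(1) by (intro member_le_sum) auto
  \<comment> \<open>Once the end weights are replaced by the larger \<open>x b\<close> and
    \<open>x a\<close>, half of the gain from switching is at least this product.\<close>
  have "0 \<le> (sum x ?A - x a) * (sum x ?B - x b)" using aA bB by simp
  moreover have "x ?c * (sum x ?A - x a) \<le> x b * (sum x ?A - x a)" using le aA by (intro mult_right_mono) auto
  moreover have "x ?d * (sum x ?B - x b) \<le> x a * (sum x ?B - x b)" using le bB by (intro mult_right_mono) auto
  ultimately have ge: "?L * sqn x ?V \<le> qf ?G x ?V ?V"
    using qf_AB_le[OF G S, of x, OF x(1)] unfolding qE qf_SG[OF arr a(1) b(1)] ps1 by (simp add: algebra_simps)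
  have "sqn x ?V > 0" using x(2) sqn_nonneg[of x ?V] by linarith
  hence "?L \<le> spec_rad n ?G" using spec_rad_lower[OF sg n0 ge] by blast
  hence iso: "graph_iso n ?G (S_graph n k)"
    using sr by (intro SG_extremal[OF arr a(1) b(1) len k nk]) simp
  define m where "m = n - (2 * k - 1)"
  have m: "185 \<le> m" "m < n" using nk k unfolding m_def by auto
  have abH: "0 \<in> {..<m div 2}" "m div 2 \<in> {m div 2..<m}" using m by auto
  have sH: "simple_graph n (S_graph n k)"
    using SG_simple[OF turan_arr abH] S_graph_eq[OF m_def] m by simp
  have "spec_rad n ?G \<le> spec_rad n (S_graph n k)" by (rule iso_spec_rad_le[OF sg sH n0 iso])
  hence eqL: "spec_rad n ?G = ?L" using \<open>?L \<le> spec_rad n ?G\<close> sr by simp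
  have eig: "nsum ?G x ?V v = ?L * x v" if "v < n" for v
  proof (rule rayleigh_eq_imp_eigen[OF sg _ _ that])
    show "qf ?G y ?V ?V \<le> ?L * sqn y ?V" for y using spec_rad_ge[OF sg n0, of y] eqL by simp
    thus "qf ?G x ?V ?V = ?L * sqn x ?V" using ge by (meson antisym)
  qed
  have pos: "0 < x v" if "v \<in> A \<union> B" for v
    using SG_pos[OF arr a(1) b(1) x(1) eig L x(2) card that] .
  have split: "nsum F x ?V v = nsum F x A v + nsum F x B v + nsum F x (set ps) v" for F v
    unfolding cov[symmetric] using fin by (simp add: nsum_Un)
  have GE: "nsum ?G x ?V v = nsum E x ?V v" if "v < n" for v using eig x(3) that by simp
  have pe: "path_edge (a # ps @ [b]) u v \<longleftrightarrow> path_edge ps u v \<or> (u = a \<and> v = ?c) \<or> (v = a \<and> u = ?c) \<or> (u = ?d \<and> v = b) \<or> (v = ?d \<and> u = b)" for u v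
  proof -
    have "path_edge (a # ps @ [b]) u v \<longleftrightarrow> (u = a \<and> v = ?c) \<or> (v = a \<and> u = ?c) \<or> path_edge (ps @ [b]) u v"
      using ne by (cases ps) (auto simp: path_edge_Cons)
    moreover have "path_edge (ps @ [b]) u v \<longleftrightarrow> path_edge ps u v \<or> path_edge [?d, b] u v"
    proof -
      have e: "ps = butlast ps @ [?d]" using ne by simp
      have "path_edge (butlast ps @ ?d # [b]) u v \<longleftrightarrow> path_edge (butlast ps @ [?d]) u v \<or> path_edge [?d, b] u v"
        by (rule path_edge_append)
      thus ?thesis using e by (metis append.assoc append_Cons append_Nil)
    qed
    ultimately show ?thesis by (auto simp: path_edge_Cons)
  qed
  have disj: "u \<notin> A" "u \<notin> B" if "u \<in> set ps" for u using that fin by auto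
  have pp: "?G u v \<longleftrightarrow> E u v" if uv: "u \<in> set ps" "v \<in> set ps" for u v
    using disj[OF uv(1)] disj[OF uv(2)] ind[OF uv] a b unfolding SG_def bipK_def pe by auto
  have cA: "?G ?c v \<longleftrightarrow> v = a" if v: "v \<in> A" for v
  proof -
    have "\<not> path_edge ps ?c v" using path_edge_set v fin by blast
    moreover have "v \<noteq> ?c" "v \<noteq> ?d" "v \<noteq> b" using v fin b by auto
    ultimately show ?thesis using disj[OF fin(5)] a b unfolding SG_def bipK_def pe by auto
  qed
  have dB: "?G ?d v \<longleftrightarrow> v = b" if v: "v \<in> B" for v
  proof -
    have "\<not> path_edge ps ?d v" using path_edge_set v fin by blast
    moreover have "v \<noteq> ?c" "v \<noteq> ?d" "v \<noteq> a" using v fin a by auto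
    ultimately show ?thesis using disj[OF fin(6)] a b unfolding SG_def bipK_def pe by auto
  qed
  have pA: "?G p v \<Longrightarrow> p = ?c" if "v \<in> A" "p \<in> set ps" for p v
    using that disj[OF that(2)] path_edge_set[of ps p v] fin a b unfolding SG_def bipK_def pe by auto
  have pB: "?G p v \<Longrightarrow> p = ?d" if "v \<in> B" "p \<in> set ps" for p v
    using that disj[OF that(2)] path_edge_set[of ps p v] fin a b unfolding SG_def bipK_def pe by auto
  text \<open>Comparing the eigenvector equations of both graphs on the whole path.\<close>
  have "(\<Sum>p\<in>set ps. 1 * nsum ?G x A p) = 1 * sum x {v\<in>A. ?G ?c v}"
    using fin pA by (intro sum_attached) auto
  moreover have "(\<Sum>p\<in>set ps. 1 * nsum E x A p) = 1 * sum x ?A"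
    using fin typeSD(8,9)[OF S] by (intro sum_attached) auto
  moreover have "(\<Sum>p\<in>set ps. 1 * nsum ?G x B p) = 1 * sum x {v\<in>B. ?G ?d v}"
    using fin pB by (intro sum_attached) auto
  moreover have "(\<Sum>p\<in>set ps. 1 * nsum E x B p) = 1 * sum x ?B"
    using fin typeSD(8,9)[OF S] by (intro sum_attached) auto
  moreover have "{v\<in>A. ?G ?c v} = {a}" "{v\<in>B. ?G ?d v} = {b}" using cA dB a b by auto
  moreover have "(\<Sum>p\<in>set ps. nsum ?G x (set ps) p) = (\<Sum>p\<in>set ps. nsum E x (set ps) p)"
    unfolding nsum_def using pp by (intro sum.cong refl) auto
  moreover have "(\<Sum>p\<in>set ps. nsum ?G x ?V p) = (\<Sum>p\<in>set ps. nsum E x ?V p)"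
    using GE cov by (intro sum.cong refl) auto
  \<comment> \<open>Only the sum of the two equalities is obtained at first, because
    \<open>hd ps\<close> and \<open>last ps\<close> coincide for \<open>k = 1\<close>. The
    inequalities \<open>aA\<close> and \<open>bB\<close> then separate it.\<close>
  ultimately have "x a + x b = sum x ?A + sum x ?B"
    unfolding split by (simp add: sum.distrib)
  hence eqs: "sum x ?A = x a" "sum x ?B = x b" using aA bB by auto
  have A1: "?A = {a}"
  proof (rule ccontr)
    assume "?A \<noteq> {a}"
    then obtain v where v: "v \<in> ?A - {a}" using a by blast
    hence "x v \<le> sum x (?A - {a})" using fin x(1) by (intro member_le_sum) auto
    also have "\<dots> = sum x ?A - x a" using a fin by (simp add: sum_diff1)
    finally show False using eqs pos[of v] v by auto
  qed
  have B1: "?B = {b}"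
  proof (rule ccontr)
    assume "?B \<noteq> {b}"
    then obtain v where v: "v \<in> ?B - {b}" using b by blast
    hence "x v \<le> sum x (?B - {b})" using fin x(1) by (intro member_le_sum) auto
    also have "\<dots> = sum x ?B - x b" using b fin by (simp add: sum_diff1)
    finally show False using eqs pos[of v] v by auto
  qed
  \<comment> \<open>The switched graph contains \<open>E\<close>. Both have the same neighbour sums,
    so an extra edge with an end of positive entry is impossible, and inside the path the graphs
    agree.\<close>
  have EG: "E u v \<Longrightarrow> ?G u v" if uv: "u < n" "v < n" for u v
  proof -
    assume e: "E u v"
    have *: "?G u v" if e: "E u v" and u: "u \<in> A" for u v
    proof -
      have "v < n" using e simple_graphD[OF G] by blast
      then consider "v \<in> A" | "v \<in> B" | "v \<in> set ps" using cov by blast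
      thus ?thesis
      proof cases
        case 1 thus ?thesis using typeSD(6)[OF S u] e by blast
      next
        case 2
        have "\<not> E a b" using typeSD(10)[OF S] a b by blast
        hence "{u,v} \<noteq> {a,b}" using e 2 u fin by (auto simp: doubleton_eq_iff simple_graph_commute[OF G])
        thus ?thesis using 2 u unfolding SG_def bipK_def by auto
      next
        case 3
        have "E v u" using e simple_graph_commute[OF G] by blast
        hence "v = ?c" using typeSD(8)[OF S 3 u] by blast
        moreover have "u = a" using A1 u \<open>E v u\<close> \<open>v = ?c\<close> by blast
        ultimately show ?thesis unfolding SG_def pe by blast
      qed
    qed
    have **: "?G u v" if e: "E u v" and u: "u \<in> set ps" and v: "v \<in> B" for u v
    proof -
      have "u = ?d" using typeSD(9)[OF S u v e] .
      moreover have "v = b" using B1 v e \<open>u = ?d\<close> by blast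
      ultimately show ?thesis unfolding SG_def pe by blast
    qed
    have sG: "?G u v \<longleftrightarrow> ?G v u" for u v by (rule simple_graph_commute[OF sg])
    have sE: "E u v \<longleftrightarrow> E v u" for u v by (rule simple_graph_commute[OF G])
    consider "u \<in> A" | "v \<in> A" | "u \<in> B" "v \<in> B" | "u \<in> set ps" "v \<in> set ps" | "u \<in> set ps" "v \<in> B" | "u \<in> B" "v \<in> set ps"
      using uv cov by blast
    thus "?G u v"
    proof cases
      case 3 thus ?thesis using typeSD(7)[OF S 3] e by blast
    next
      case 4 thus ?thesis using pp e by blast
    qed (use * ** sG sE e in blast)+
  qed
  have GEe: "?G u v \<Longrightarrow> E u v" if uv: "u < n" "v < n" for u v
  proof (rule ccontr)
    assume g: "?G u v" and ne: "\<not> E u v"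
    have lt: "nsum E x ?V u < nsum ?G x ?V u" if "u < n" "v < n" "?G u v" "\<not> E u v" "0 < x v" for u v
      unfolding nsum_def using that EG[OF that(1)] x(1)
      by (intro sum_strict_mono_ex1) (auto intro!: bexI[of _ v])
    have "u \<in> A \<union> B \<or> v \<in> A \<union> B" using pp g ne uv cov by blast
    moreover have "?G v u" "\<not> E v u" using g ne simple_graph_commute[OF sg] simple_graph_commute[OF G] by blast+
    ultimately show False using lt[of u v] lt[of v u] g ne uv pos[of u] pos[of v] GE[of u] GE[of v] by force
  qed
  have "\<forall>u<n. \<forall>v<n. E u v \<longleftrightarrow> ?G u v" using EG GEe by blast
  thus ?thesis using iso unfolding graph_iso_def by simp
qed

text \<open>If \<open>x a < x (last ps)\<close>, one exchanges the roles of \<open>a\<close> and \<open>last ps\<close> before switching.\<close>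
lemma typeS_swapped:
  assumes G: "simple_graph n E" and S: "typeS n E A B ps" and cov: "A \<union> B \<union> set ps = {..<n}"
    and ind: "\<And>u v. u \<in> set ps \<Longrightarrow> v \<in> set ps \<Longrightarrow> E u v \<longleftrightarrow> path_edge ps u v"
    and len: "length ps = 2 * k - 1" and k: "1 \<le> k" and nk: "187 * k \<le> n"
    and card: "2 \<le> card A" "2 \<le> card {b\<in>B. \<not> E (last ps) b}"
    and sr: "spec_rad n (S_graph n k) \<le> spec_rad n E"
    and x: "\<And>v. 0 \<le> x v" "sqn x {..<n} \<noteq> 0" "\<And>v. v < n \<Longrightarrow> nsum E x {..<n} v = spec_rad n E * x v"
    and a: "a \<in> A" "E (hd ps) a"
    and lt: "x a < x (last ps)" "x (hd ps) \<le> sum x {b\<in>B. E (last ps) b}" and L: "4 < spec_rad n E"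
  shows False
proof -
  let ?V = "{..<n}" and ?c = "hd ps" and ?d = "last ps" and ?L = "spec_rad n E"
  let ?A = "{a\<in>A. E ?c a}" and ?B = "{b\<in>B. E ?d b}"
  have n0: "0 < n" using k nk by simp
  note fin = typeS_finite[OF G S]
  have ne: "ps \<noteq> []" and dps: "distinct ps" using typeSD(4,5)[OF S] by auto
  define A1 where "A1 = insert ?d (A - {a})"
  \<comment> \<open>The vertex \<open>last ps\<close> has taken the place of \<open>a\<close>; the
    new path starts at it, runs back along \<open>ps\<close> and passes through \<open>a\<close> to
    a vertex \<open>b0\<close> of \<open>B\<close>.\<close>
  define ps1 where "ps1 = rev (butlast ps) @ [a]"
  have dA: "?d \<notin> A" "?d \<notin> B" "?d \<noteq> a" using fin a by auto
  have e: "ps = butlast ps @ [?d]" using ne by simp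
  have dbl: "distinct (butlast ps)" "?d \<notin> set (butlast ps)" "set ps = insert ?d (set (butlast ps))"
    using dps e by (metis distinct_butlast, metis not_distinct_conv_prefix append_is_Nil_conv distinct_append[of "butlast ps" "[?d]"] disjoint_insert(1) list.simps(15) , metis Un_insert_right list.simps(15) set_append sup_bot.right_neutral empty_set)
  have arr: "arr n A1 B ps1"
    unfolding arr_def
  proof (intro conjI)
    show "A1 \<union> B \<union> set ps1 = {..<n}" using cov dbl a unfolding A1_def ps1_def by auto
    show "A1 \<inter> B = {}" using fin dA unfolding A1_def by auto
    have "set (butlast ps) \<inter> (A \<union> B) = {}" using fin dbl by auto
    thus "set ps1 \<inter> (A1 \<union> B) = {}" using dbl dA fin a unfolding A1_def ps1_def by auto
    show "distinct ps1" using dbl fin a unfolding ps1_def by auto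
    show "ps1 \<noteq> []" unfolding ps1_def by simp
  qed
  obtain b0 where b0: "b0 \<in> B" "\<not> E ?d b0"
    using card(2) by (metis (mono_tags, lifting) Collect_empty_eq card.empty not_numeral_le_zero)
  have d1: "?d \<in> A1" unfolding A1_def by simp
  let ?G = "SG A1 B ?d b0 ps1"
  have sg: "simple_graph n ?G" by (rule SG_simple[OF arr d1 b0(1)])
  have len1: "length ps1 = 2 * k - 1" using len k ne unfolding ps1_def by (cases ps) auto
  have q1: "qf E x (set ps) (set ps) = 2 * psum x ps"
  proof -
    have "qf E x (set ps) (set ps) = qf (path_edge ps) x (set ps) (set ps)" by (rule qf_cong) (use ind in auto)
    thus ?thesis using qf_path_edge[OF _ dps order_refl, of x] by simp
  qed
  have qE: "?L * sqn x ?V = 2 * qf E x A B + 2 * x ?c * sum x ?A + 2 * x ?d * sum x ?B + 2 * psum x ps"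
    using qf_eigen[of ?V E x ?V ?L] x(3) qf_typeS[OF G S, of x] unfolding cov q1 by simp
  have pse: "psum x (?d # ps1 @ [b0]) = psum x ps + x ?c * x a + x a * x b0"
  proof -
    have "?d # ps1 @ [b0] = rev ps @ [a, b0]" unfolding ps1_def by (subst (3) e) simp
    also have "psum x (rev ps @ a # [b0]) = psum x (rev ps @ [a]) + psum x [a, b0]" by (rule psum_append)
    also have "rev ps @ [a] = rev (a # ps)" by simp
    also have "psum x (rev (a # ps)) = psum x (a # ps)" by (rule psum_rev)
    also have "psum x (a # ps) = x a * x ?c + psum x ps" using ne by (cases ps) auto
    finally show ?thesis by simp
  qed
  have sA1: "sum x A1 = sum x A - x a + x ?d"
    unfolding A1_def using fin dA a by (simp add: sum_diff1)
  have aA: "x a \<le> sum x ?A" using a fin x(1) by (intro member_le_sum) auto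
  \<comment> \<open>The weight of \<open>B\<close> outside \<open>b0\<close> and the neighbours of
    \<open>last ps\<close>. A second nonneighbour \<open>b1\<close> makes it positive, so that this
    switching gains strictly.\<close>
  define T where "T = sum x B - sum x ?B - x b0"
  have T0: "0 \<le> T"
  proof -
    have "sum x (insert b0 ?B) \<le> sum x B" using b0 fin x(1) by (intro sum_mono2) auto
    thus ?thesis unfolding T_def using b0 fin by simp
  qed
  have p1: "0 \<le> (sum x ?A - x a) * (sum x ?B - x ?c)" using aA lt by simp
  have p2: "0 \<le> (x ?d - x a) * T" using lt T0 by simp
  have diff: "?L * sqn x ?V + 2 * ((x ?d - x a) * T) \<le> qf ?G x ?V ?V"
    using qf_AB_le[OF G S, of x, OF x(1)] p1 unfolding qE qf_SG[OF arr d1 b0(1)] pse sA1 T_def by (simp add: algebra_simps)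
  hence ge: "?L * sqn x ?V \<le> qf ?G x ?V ?V" using p2 by linarith
  have "sqn x ?V > 0" using x(2) sqn_nonneg[of x ?V] by linarith
  hence "?L \<le> spec_rad n ?G" using spec_rad_lower[OF sg n0 ge] by blast
  hence iso: "graph_iso n ?G (S_graph n k)"
    using sr by (intro SG_extremal[OF arr d1 b0(1) len1 k nk]) simp
  define m where "m = n - (2 * k - 1)"
  have m: "185 \<le> m" "m < n" using nk k unfolding m_def by auto
  have abH: "0 \<in> {..<m div 2}" "m div 2 \<in> {m div 2..<m}" using m by auto
  have sH: "simple_graph n (S_graph n k)"
    using SG_simple[OF turan_arr abH] S_graph_eq[OF m_def] m by simp
  have "spec_rad n ?G \<le> spec_rad n (S_graph n k)" by (rule iso_spec_rad_le[OF sg sH n0 iso])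
  hence eqL: "spec_rad n ?G = ?L" using \<open>?L \<le> spec_rad n ?G\<close> sr by simp
  have ub: "qf ?G y ?V ?V \<le> ?L * sqn y ?V" for y using spec_rad_ge[OF sg n0, of y] eqL by simp
  have eig: "nsum ?G x ?V v = ?L * x v" if "v < n" for v
    using rayleigh_eq_imp_eigen[OF sg ub _ that] ub[of x] ge by (meson antisym)
  have c1: "2 \<le> card A1" unfolding A1_def using card fin dA a by (simp add: card_insert_if)
  have "card {b\<in>B. \<not> E ?d b} \<le> card B" using fin by (intro card_mono) auto
  hence c2: "2 \<le> card B" using card by simp
  have "\<not> {b\<in>B. \<not> E ?d b} \<subseteq> {b0}" using card(2) card_mono[of "{b0}" "{b\<in>B. \<not> E ?d b}"] by auto
  then obtain b1 where b1: "b1 \<in> B" "\<not> E ?d b1" "b1 \<noteq> b0" by blast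
  have "0 < x b1" using SG_pos[OF arr d1 b0(1) x(1) eig L x(2) c1 c2] b1 by blast
  moreover have "x b1 \<le> T"
  proof -
    have "sum x (insert b1 (insert b0 ?B)) \<le> sum x B" using b0 b1 fin x(1) by (intro sum_mono2) auto
    thus ?thesis unfolding T_def using b0 b1 fin by simp
  qed
  ultimately have "0 < (x ?d - x a) * T" using lt by simp
  thus False using diff ub[of x] by linarith
qed

text \<open>With the heaviest neighbours \<open>a\<close> and \<open>b\<close> of the path ends, one
  of the two switchings applies, up to reversal, unless each end outweighs all class neighbours of
  the other end. In that last case adding the eigenvalue equations along the path contradicts
  \<open>L\<close>.\<close>

theorem typeS_exact:
  assumes G: "simple_graph n E" and S: "typeS n E A B ps" and cov: "A \<union> B \<union> set ps = {..<n}"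
    and ind: "\<And>u v. u \<in> set ps \<Longrightarrow> v \<in> set ps \<Longrightarrow> E u v \<longleftrightarrow> path_edge ps u v"
    and len: "length ps = 2 * k - 1" and k: "1 \<le> k" and nk: "187 * k \<le> n"
    and card: "2 \<le> card {a\<in>A. \<not> E (hd ps) a}" "2 \<le> card {b\<in>B. \<not> E (last ps) b}"
    and sr: "spec_rad n (S_graph n k) \<le> spec_rad n E" and L: "4 < spec_rad n E"
  shows "graph_iso n E (S_graph n k)"
proof -
  let ?c = "hd ps" and ?d = "last ps" and ?L = "spec_rad n E"
  let ?A = "{a\<in>A. E ?c a}" and ?B = "{b\<in>B. E ?d b}" and ?V = "{..<n}"
  have n0: "0 < n" using k nk by simp
  note fin = typeS_finite[OF G S]
  have ne: "ps \<noteq> []" and dps: "distinct ps" using typeSD(4,5)[OF S] by auto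
  obtain x where x: "\<And>v. 0 \<le> x v" "sqn x ?V \<noteq> 0" "\<And>v. v < n \<Longrightarrow> nsum E x ?V v = ?L * x v"
    using spec_rad_perron[OF G n0] by blast
  have neA: "?A \<noteq> {}" "?B \<noteq> {}" using typeSD(11,12)[OF S] by auto
  obtain a where a: "a \<in> ?A" "\<forall>b\<in>?A. x b \<le> x a" using ex_max_elem[of ?A x] neA fin by auto
  obtain b where b: "b \<in> ?B" "\<forall>a\<in>?B. x a \<le> x b" using ex_max_elem[of ?B x] neA fin by auto
  have aA: "x a \<le> sum x ?A" using a fin x(1) by (intro member_le_sum) auto
  have bB: "x b \<le> sum x ?B" using b fin x(1) by (intro member_le_sum) auto
  have cc: "2 \<le> card A" "2 \<le> card B"
  proof -
    have "card {a\<in>A. \<not> E (hd ps) a} \<le> card A" "card {b\<in>B. \<not> E (last ps) b} \<le> card B"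
      using fin by (auto intro!: card_mono)
    thus "2 \<le> card A" "2 \<le> card B" using card by auto
  qed
  have hl: "hd (rev ps) = ?d" "last (rev ps) = ?c" using ne by (simp_all add: hd_rev last_rev)
  consider (std) "x ?c \<le> x b" "x ?d \<le> x a" | (sw1) "x a < x ?d" "x ?c \<le> sum x ?B"
    | (sw2) "x b < x ?c" "x ?d \<le> sum x ?A" | (none) "sum x ?A < x ?d" "sum x ?B < x ?c"
    using aA bB by linarith
  thus ?thesis
  proof cases
    case std
    thus ?thesis using typeS_standard[OF G S cov ind len k nk cc sr x] a b L by blast
  next
    case sw1
    thus ?thesis using typeS_swapped[OF G S cov ind len k nk cc(1) card(2) sr x] a L by blast
  next
    case sw2
    have ind': "E u v \<longleftrightarrow> path_edge (rev ps) u v" if "u \<in> set (rev ps)" "v \<in> set (rev ps)" for u v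
      using ind that by (simp add: path_edge_rev)
    have "B \<union> A \<union> set (rev ps) = {..<n}" using cov by auto
    from typeS_swapped[OF G typeS_swap[OF G S] this ind' _ k nk cc(2) _ sr x, unfolded hl] show ?thesis
      using sw2 b L card len by auto
  next
    case none
    let ?P = "set ps"
    have disj: "u \<notin> A" "u \<notin> B" "u < n" if "u \<in> ?P" for u using that fin cov by auto
    have split: "nsum E x ?V v = nsum E x A v + nsum E x B v + nsum E x ?P v" for v
      unfolding cov[symmetric] using fin by (simp add: nsum_Un)
    have "(\<Sum>p\<in>?P. 1 * nsum E x A p) = 1 * sum x ?A"
      using fin typeSD(8,9)[OF S] by (intro sum_attached) auto
    moreover have "(\<Sum>p\<in>?P. 1 * nsum E x B p) = 1 * sum x ?B"
      using fin typeSD(8,9)[OF S] by (intro sum_attached) auto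
    moreover have "(\<Sum>p\<in>?P. nsum E x ?P p) \<le> 2 * sum x ?P"
      using x(1) ind dps by (intro nsum_path_sum_le) auto
    moreover have "(\<Sum>p\<in>?P. nsum E x ?V p) = ?L * sum x ?P"
      unfolding sum_distrib_left using x(3) disj by (intro sum.cong) auto
    ultimately have "?L * sum x ?P \<le> sum x ?A + sum x ?B + 2 * sum x ?P"
      unfolding split by (simp add: sum.distrib)
    moreover have "x ?c + x ?d \<le> 2 * sum x ?P" using fin x(1) by (intro sum_ge_two) auto
    moreover have "4 * sum x ?P \<le> ?L * sum x ?P" using L x(1) by (intro mult_right_mono) (auto intro: sum_nonneg)
    ultimately show ?thesis using none by linarith
  qed
qed

section \<open>The complete bipartite graph with an attached odd cycle\<close>

definition CG :: "nat set \<Rightarrow> nat set \<Rightarrow> nat \<Rightarrow> nat list \<Rightarrow> nat \<Rightarrow> nat \<Rightarrow> bool" where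
  "CG A B a ps u v \<longleftrightarrow> bipK A B u v \<or> path_edge (a # ps @ [a]) u v"

lemma path_edge_closed:
  assumes "ps \<noteq> []"
  shows "path_edge (a # ps @ [b]) u v \<longleftrightarrow> path_edge ps u v \<or> (u = a \<and> v = hd ps) \<or> (v = a \<and> u = hd ps)
    \<or> (u = last ps \<and> v = b) \<or> (v = last ps \<and> u = b)"
proof -
  have "path_edge (a # ps @ [b]) u v \<longleftrightarrow> (u = a \<and> v = hd ps) \<or> (v = a \<and> u = hd ps) \<or> path_edge (ps @ [b]) u v"
    using assms by (cases ps) (auto simp: path_edge_Cons)
  moreover have "path_edge (ps @ [b]) u v \<longleftrightarrow> path_edge ps u v \<or> path_edge [last ps, b] u v"
  proof -
    have e: "ps = butlast ps @ [last ps]" using assms by simp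
    have "path_edge (butlast ps @ last ps # [b]) u v \<longleftrightarrow> path_edge (butlast ps @ [last ps]) u v \<or> path_edge [last ps, b] u v"
      by (rule path_edge_append)
    thus ?thesis using e by (metis append.assoc append_Cons append_Nil)
  qed
  ultimately show ?thesis by (auto simp: path_edge_Cons)
qed

lemma CG_iso:
  assumes arr: "arr n A B ps" "arr n A' B' ps'" and ab: "a \<in> A" "b \<in> B" "a' \<in> A'" "b' \<in> B'"
    and c: "card A = card A'" "card B = card B'" "length ps = length ps'"
  shows "graph_iso n (CG A B a ps) (CG A' B' a' ps')"
proof -
  obtain f where f: "bij_betw f {0..<n} {0..<n}" "f ` A = A'" "f ` B = B'" "f a = a'" "f b = b'" "map f ps = ps'"
    using graph_iso_arr[OF arr ab c] by blast
  have inj: "inj_on f {..<n}" using f(1) unfolding bij_betw_def by (simp add: lessThan_atLeast0)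
  have sub: "A \<subseteq> {..<n}" "B \<subseteq> {..<n}" "set ps \<subseteq> {..<n}" using arr(1) unfolding arr_def by auto
  have "CG A B a ps u v \<longleftrightarrow> CG A' B' a' ps' (f u) (f v)" if uv: "u < n" "v < n" for u v
  proof -
    have "w \<in> A \<longleftrightarrow> f w \<in> A'" "w \<in> B \<longleftrightarrow> f w \<in> B'" if "w < n" for w
      using that inj sub unfolding f(2,3)[symmetric] by (simp_all add: inj_on_image_mem_iff)
    moreover have "path_edge (a # ps @ [a]) u v \<longleftrightarrow> path_edge (a' # ps' @ [a']) (f u) (f v)"
    proof -
      have "a' # ps' @ [a'] = map f (a # ps @ [a])" using f by simp
      moreover have "inj_on f (insert u (insert v (set (a # ps @ [a]))))"
        by (rule inj_on_subset[OF inj]) (use uv ab sub in auto)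
      ultimately show ?thesis using path_edge_map by metis
    qed
    ultimately show ?thesis using uv unfolding CG_def bipK_def by auto
  qed
  thus ?thesis unfolding graph_iso_def using f(1) by blast
qed

lemma CG_simple:
  assumes "arr n A B ps" "a \<in> A" "2 \<le> length ps"
  shows "simple_graph n (CG A B a ps)"
proof -
  have ne: "ps \<noteq> []" and d: "distinct ps" and s: "A \<subseteq> {..<n}" "B \<subseteq> {..<n}" "set ps \<subseteq> {..<n}"
    and dis: "A \<inter> B = {}" "a \<notin> set ps"
    using assms unfolding arr_def by auto
  have h: "hd ps \<in> set ps" "last ps \<in> set ps" using ne by auto
  show ?thesis unfolding simple_graph_def
  proof (intro allI impI)
    fix u v assume e: "CG A B a ps u v"
    hence "CG A B a ps v u" unfolding CG_def using bipK_def path_edge_sym by metis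
    moreover have "u < n \<and> v < n \<and> u \<noteq> v"
    proof (cases "bipK A B u v")
      case True thus ?thesis using s dis unfolding bipK_def by blast
    next
      case False
      hence pe: "path_edge (a # ps @ [a]) u v" using e unfolding CG_def by blast
      have "u < n" "v < n" using path_edge_set[OF pe] s assms(2) by auto
      moreover have "u \<noteq> v" using pe path_edge_irrefl[OF d] h dis unfolding path_edge_closed[OF ne] by metis
      ultimately show ?thesis by blast
    qed
    ultimately show "u < n \<and> v < n \<and> u \<noteq> v \<and> CG A B a ps v u" by blast
  qed
qed

lemma qf_CG:
  assumes "arr n A B ps" "a \<in> A" "2 \<le> length ps"
  shows "qf (CG A B a ps) x {..<n} {..<n} =
    2 * (sum x A * sum x B) + 2 * psum x ps + 2 * (x a * (x (hd ps) + x (last ps)))"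
proof -
  let ?V = "{..<n}" and ?c = "hd ps" and ?d = "last ps"
  have ne: "ps \<noteq> []" and d: "distinct ps" and s: "A \<subseteq> ?V" "B \<subseteq> ?V" "set ps \<subseteq> ?V"
    and dis: "A \<inter> B = {}" "a \<notin> set ps" "set ps \<inter> (A \<union> B) = {}"
    using assms unfolding arr_def by auto
  have h: "?c \<in> set ps" "?d \<in> set ps" using ne by auto
  have cd: "?c \<noteq> ?d"
    using assms(3) d ne by (cases ps) (auto simp: last_in_set Suc_le_length_iff split: if_splits)
  have na: "\<not> path_edge ps a v" "\<not> path_edge ps v a" for v using path_edge_set dis(2) by blast+
  have "qf (CG A B a ps) x ?V ?V = qf (\<lambda>u v. bipK A B u v \<or> (path_edge ps u v \<or> (path_edge [a, ?c] u v \<or> path_edge [a, ?d] u v))) x ?V ?V"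
    by (rule qf_cong) (auto simp: CG_def path_edge_closed[OF ne] path_edge_Cons)
  also have "\<dots> = qf (bipK A B) x ?V ?V + qf (\<lambda>u v. path_edge ps u v \<or> (path_edge [a, ?c] u v \<or> path_edge [a, ?d] u v)) x ?V ?V"
    using path_edge_set[of ps] dis h by (intro qf_disj) (auto simp: bipK_def path_edge_Cons)
  also have "qf (\<lambda>u v. path_edge ps u v \<or> (path_edge [a, ?c] u v \<or> path_edge [a, ?d] u v)) x ?V ?V
      = qf (path_edge ps) x ?V ?V + qf (\<lambda>u v. path_edge [a, ?c] u v \<or> path_edge [a, ?d] u v) x ?V ?V"
    using na by (intro qf_disj) (auto simp: path_edge_Cons)
  also have "qf (\<lambda>u v. path_edge [a, ?c] u v \<or> path_edge [a, ?d] u v) x ?V ?V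
      = qf (path_edge [a,?c]) x ?V ?V + qf (path_edge [a,?d]) x ?V ?V"
    using cd by (intro qf_disj) (auto simp: path_edge_Cons)
  also have "qf (path_edge [a,?c]) x ?V ?V = 2 * psum x [a,?c]"
    using assms s h dis by (intro qf_path_edge) auto
  also have "qf (path_edge [a,?d]) x ?V ?V = 2 * psum x [a,?d]"
    using assms s h dis by (intro qf_path_edge) auto
  also have "qf (path_edge ps) x ?V ?V = 2 * psum x ps" using s d by (intro qf_path_edge) auto
  also have "qf (bipK A B) x ?V ?V = 2 * (sum x A * sum x B)" using s dis by (intro qf_bipK) auto
  finally show ?thesis by (simp add: algebra_simps)
qed

lemma C_graph_eq:
  assumes "m = n - 2 * l"
  shows "C_graph n l = CG {..<m div 2} {m div 2..<m} 0 [m..<n]"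
proof (intro ext)
  fix u v
  have "turan2 m u v \<longleftrightarrow> bipK {..<m div 2} {m div 2..<m} u v"
    unfolding turan2_def bipK_def by auto
  thus "C_graph n l u v = CG {..<m div 2} {m div 2..<m} 0 [m..<n] u v"
    unfolding C_graph_def CG_def Let_def assms(1)[symmetric] by simp
qed

lemma spec_rad_C_ge:
  assumes m: "m = n - 2 * l" "185 \<le> m" "m < n" and l: "1 \<le> l"
  shows "real m / 2 - 1 / 50 \<le> spec_rad n (C_graph n l)"
proof -
  let ?A = "{..<m div 2}" and ?B = "{m div 2..<m}" and ?V = "{..<n}"
  have a: "arr n ?A ?B [m..<n]" using turan_arr m(2,3) by simp
  have a0: "0 \<in> ?A" using m(2) by auto
  have len: "2 \<le> length [m..<n]" using m(1,2) l by simp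
  define y :: "nat \<Rightarrow> real" where "y v = (if v < m then 1 else 0)" for v
  have "sum y ?A = (\<Sum>v\<in>?A. 1)" "sum y ?B = (\<Sum>v\<in>?B. 1)"
    by (rule sum.cong[OF refl]; auto simp: y_def)+
  hence "sum y ?A = real (m div 2)" "sum y ?B = real (m - m div 2)" by simp_all
  moreover define z where "z = real (m div 2) * real (m - m div 2)"
  moreover define P where "P = 2 * psum y [m..<n] + 2 * (y 0 * (y (hd [m..<n]) + y (last [m..<n])))"
  ultimately have q1: "qf (C_graph n l) y ?V ?V = 2 * z + P"
    unfolding C_graph_eq[OF m(1)] qf_CG[OF a a0 len] by simp
  have "0 \<le> P" unfolding P_def using psum_nonneg[of y "[m..<n]"] by (auto simp: y_def)
  hence "qf (C_graph n l) y ?V ?V \<ge> 2 * (((real m)\<^sup>2 - 1) / 4)"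
    using q1 half_product_bound[of m, folded z_def] by simp
  also have "2 * (((real m)\<^sup>2 - 1) / 4) = real m * (real m / 2) - 1/2"
    by (simp add: power2_eq_square field_simps)
  finally have q: "real m * (real m / 2) - 1/2 \<le> qf (C_graph n l) y ?V ?V" .
  have "sqn y ?V = (\<Sum>v\<in>{..<m}. 1)"
    unfolding sqn_def y_def using m(3) by (intro sum.mono_neutral_cong_right) auto
  hence s: "sqn y ?V = real m" by simp
  have "(real m / 2 - 1/50) * sqn y ?V \<le> qf (C_graph n l) y ?V ?V"
    using q m(2) unfolding s by (simp add: algebra_simps)
  moreover have "simple_graph n (C_graph n l)"
    unfolding C_graph_eq[OF m(1)] by (rule CG_simple[OF a a0 len])
  ultimately show ?thesis using s m(2,3) by (intro spec_rad_lower[of n _ _ y]) auto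
qed

text \<open>With \<open>e = be - b\<close> the difference of the products is
  \<open>e * (b - h + e)\<close>. It vanishes for a nonzero \<open>e\<close> only if
  \<open>e = -1\<close> and \<open>b = h + 1\<close>; in this tie the term with \<open>w\<close>
  decides. That is why the cycle hangs on the smaller class.\<close>

lemma balanced_product_cases:
  fixes h b al be :: nat and s w D :: real
  assumes hb: "h \<le> b" "b \<le> h + 1" and sum: "al + be = h + b"
    and sw: "0 < w" "w < s" and D: "0 \<le> D"
    and le: "(real b * real h - real be * real al) * s + (real b - real be) * w + D \<le> 0"
  shows "be = b"
proof (rule ccontr)
  assume ne: "be \<noteq> b"
  define e where "e = real be - real b"
  have al: "real al = real h - e" using sum unfolding e_def by linarith
  have be: "real be = real b + e" unfolding e_def by simp
  have le': "e * (real b - real h + e) * s - e * w + D \<le> 0"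
    using le unfolding al be by (simp add: algebra_simps)
  have "b + 1 \<le> be \<or> be + 1 \<le> b" using ne by linarith
  hence "1 \<le> e \<or> e \<le> -1" unfolding e_def by auto
  then consider "1 \<le> e" | "e \<le> -1" by blast
  thus False
  proof cases
    case 1
    have "1 * s \<le> (real b - real h + e) * s" using 1 hb sw by (intro mult_right_mono) auto
    hence "0 < (real b - real h + e) * s - w" using sw by linarith
    hence "0 < e * ((real b - real h + e) * s - w)" using 1 by simp
    thus False using le' D by (simp add: algebra_simps)
  next
    case 2
    have "0 \<le> e * (real b - real h + e)" using 2 hb by (intro mult_nonpos_nonpos) auto
    hence "0 \<le> e * (real b - real h + e) * s" using sw by simp
    moreover have "0 < - (e * w)" using 2 sw by (simp add: mult_neg_pos)
    ultimately show False using le' D by linarith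
  qed
qed

lemma balanced_product_le:
  fixes h b al be :: nat
  assumes "h \<le> b" "b \<le> h + 1" "al + be = h + b"
  shows "real be * real al \<le> real b * real h"
proof -
  define e where "e = real be - real b"
  have al: "real al = real h - e" using assms(3) unfolding e_def by linarith
  have be: "real be = real b + e" unfolding e_def by simp
  have "be = b \<or> b + 1 \<le> be \<or> be + 1 \<le> b" by linarith
  hence "e = 0 \<or> 1 \<le> e \<or> e \<le> -1" unfolding e_def by auto
  hence "0 \<le> e * (real b - real h + e)"
  proof (elim disjE)
    assume "1 \<le> e" thus ?thesis using assms(1,2) by (intro mult_nonneg_nonneg) auto
  next
    assume "e \<le> -1" thus ?thesis using assms(1,2) by (intro mult_nonpos_nonpos) auto
  qed simp
  thus ?thesis unfolding al be by (simp add: algebra_simps)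
qed

text \<open>The value \<open>L\<^sup>2 * s\<close> is bounded twice: from above by the eigenvalue
  equations of \<open>E\<close> and the class sizes, from below by a test vector on
  \<open>C_graph n l\<close>. The two bounds leave no room, so the sizes are balanced, every
  neighbour sum is full and, by positivity, every edge between the classes is present.\<close>

theorem typeC_exact:
  assumes G: "simple_graph n E" and arr: "arr n A B ps" and a: "a \<in> A" and B1: "B \<noteq> {}"
    and indep: "\<And>u v. u \<in> A \<Longrightarrow> v \<in> A \<Longrightarrow> \<not> E u v" "\<And>u v. u \<in> B \<Longrightarrow> v \<in> B \<Longrightarrow> \<not> E u v"
    and ind: "\<And>u v. u \<in> set ps \<Longrightarrow> v \<in> set ps \<Longrightarrow> E u v \<longleftrightarrow> path_edge ps u v"
    and att: "\<And>p v. p \<in> set ps \<Longrightarrow> v \<in> A \<union> B \<Longrightarrow> E p v \<longleftrightarrow> v = a \<and> (p = hd ps \<or> p = last ps)"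
    and len: "length ps = 2 * l" and l: "1 \<le> l" and nl: "185 + 2 * l \<le> n"
    and sr: "spec_rad n (C_graph n l) \<le> spec_rad n E"
  shows "graph_iso n E (C_graph n l)"
proof -
  define m where "m = n - 2 * l"
  define h where "h = m div 2"
  have m: "185 \<le> m" "m < n" using nl l unfolding m_def by auto
  let ?V = "{..<n}" and ?c = "hd ps" and ?d = "last ps" and ?P = "set ps"
  define L where "L = spec_rad n E"
  have n0: "n > 0" using m by simp
  have fin: "finite A" "finite B" "finite ?P" using arr_finite[OF arr] by auto
  have V: "?V = (A \<union> B) \<union> ?P" and dis: "A \<inter> B = {}" "(A \<union> B) \<inter> ?P = {}" and dps: "distinct ps" and ne: "ps \<noteq> []"
    using arr unfolding arr_def by auto
  have hP: "?c \<in> ?P" "?d \<in> ?P" using ne by auto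
  have Pn: "v < n" if "v \<in> ?P" for v using that V by auto
  have cd: "?c \<noteq> ?d"
    using len l dps ne by (cases ps) (auto simp: last_in_set split: if_splits)
  have cm: "card A + card B = m" using arr_card[OF arr] len unfolding m_def by simp
  obtain x where x: "\<And>v. 0 \<le> x v" "sqn x ?V \<noteq> 0" "\<And>v. v < n \<Longrightarrow> nsum E x ?V v = L * x v"
    using spec_rad_perron[OF G n0] unfolding L_def by blast
  have L90: "90 < L" using spec_rad_C_ge[OF m_def m l] sr m unfolding L_def by simp
  hence L0: "0 < L" by simp
  define s where "s = sum x B"
  define sA where "sA = sum x A"
  define w where "w = x ?c + x ?d"
  define tau where "tau = nsum E x B a"
  define X where "X = L * x a"
  have split: "nsum E x ?V v = nsum E x A v + nsum E x B v + nsum E x ?P v" for v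
    unfolding V using fin dis by (simp add: nsum_Un)
  have sE: "E u v \<longleftrightarrow> E v u" for u v by (rule simple_graph_commute[OF G])
  have an: "a < n" using a V by auto
  have rowA: "L * x v = nsum E x B v" if v: "v \<in> A" "v \<noteq> a" for v
  proof -
    have "nsum E x A v = 0" using v indep by (intro nsum_eq_0) auto
    moreover have "nsum E x ?P v = 0" using v att sE by (intro nsum_eq_0) blast
    moreover have "v < n" using v V by auto
    ultimately show ?thesis using x(3)[of v] split[of v] by simp
  qed
  have rowB: "L * x v = nsum E x A v" if v: "v \<in> B" for v
  proof -
    have "nsum E x B v = 0" using v indep by (intro nsum_eq_0) auto
    moreover have "nsum E x ?P v = 0" using v att sE dis a by (intro nsum_eq_0) blast
    moreover have "v < n" using v V by auto
    ultimately show ?thesis using x(3)[of v] split[of v] by simp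
  qed
  have rowa: "X = tau + w"
  proof -
    have "nsum E x A a = 0" using a indep by (intro nsum_eq_0) auto
    moreover have "nsum E x ?P a = w"
    proof -
      have "{p\<in>?P. E a p} = {?c, ?d}" using att[of _ a] sE hP a by blast
      thus ?thesis unfolding w_def using cd by (simp add: nsum_eq_sum_filter)
    qed
    ultimately show ?thesis using x(3)[OF an] split[of a] unfolding X_def tau_def by simp
  qed
  have tau_s: "tau \<le> s" unfolding tau_def s_def using fin x(1) by (intro nsum_le_sum) auto
  have s0: "0 \<le> s" "0 \<le> w" unfolding s_def w_def using x(1) by (auto intro: sum_nonneg)
  have Xs: "X \<le> s + w" using rowa tau_s by simp
  have wsum: "w \<le> sum x ?P"
  proof -
    have "sum x {?c, ?d} \<le> sum x ?P" using hP fin x(1) by (intro sum_mono2) auto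
    thus ?thesis unfolding w_def using cd by simp
  qed
  have Psum: "L * sum x ?P \<le> 2 * x a + 2 * sum x ?P"
  proof -
    have "L * sum x ?P = (\<Sum>p\<in>?P. nsum E x ?V p)"
      unfolding sum_distrib_left using x(3) Pn by (intro sum.cong) auto
    also have "\<dots> = (\<Sum>p\<in>?P. nsum E x A p) + (\<Sum>p\<in>?P. nsum E x B p) + (\<Sum>p\<in>?P. nsum E x ?P p)"
      unfolding split by (simp add: sum.distrib)
    also have "(\<Sum>p\<in>?P. nsum E x B p) = 0" using att dis a by (intro sum.neutral ballI nsum_eq_0) blast
    also have "(\<Sum>p\<in>?P. nsum E x A p) = (\<Sum>p\<in>?P. if p \<in> {?c,?d} then x a else 0)"
    proof (intro sum.cong refl)
      fix p assume p: "p \<in> ?P"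
      have "{v\<in>A. E p v} = (if p \<in> {?c,?d} then {a} else {})" using att[OF p] a by auto
      thus "nsum E x A p = (if p \<in> {?c,?d} then x a else 0)" using fin by (simp add: nsum_eq_sum_filter)
    qed
    also have "\<dots> = (\<Sum>p\<in>?P \<inter> {?c,?d}. x a)" using fin(3) by (rule sum.inter_restrict[symmetric])
    also have "?P \<inter> {?c,?d} = {?c,?d}" using hP by auto
    also have "(\<Sum>p\<in>{?c,?d}. x a) = 2 * x a" using cd by simp
    also have "(\<Sum>p\<in>?P. nsum E x ?P p) \<le> 2 * sum x ?P"
      using fin x(1) ind dps by (intro nsum_path_sum_le) auto
    finally show ?thesis by simp
  qed
  have P0: "0 \<le> sum x ?P" using x(1) by (simp add: sum_nonneg)
  have L88: "90 * sum x ?P \<le> L * sum x ?P" using L90 P0 by (intro mult_right_mono) auto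
  have Lxa: "90 * x a \<le> X" unfolding X_def using L90 x(1) by (intro mult_right_mono) auto
  have spos: "0 < s"
  proof (rule ccontr)
    assume "\<not> ?thesis"
    hence s00: "s = 0" using s0 by simp
    have xa: "x a = 0" using s00 Xs wsum Psum L88 Lxa x(1)[of a] by linarith
    have sP: "sum x ?P = 0" using Psum L88 xa P0 by linarith
    have "x v = 0" if v: "v \<in> ?V" for v
    proof -
      consider "v \<in> A" "v \<noteq> a" | "v = a" | "v \<in> B" | "v \<in> ?P" using v V by auto
      thus ?thesis
      proof cases
        case 1
        have "L * x v \<le> s" unfolding rowA[OF 1] s_def using fin x(1) by (intro nsum_le_sum) auto
        thus ?thesis using s00 L0 x(1)[of v] by (simp add: mult_le_0_iff)
      next
        case 3 thus ?thesis using s00 fin x(1) unfolding s_def by (simp add: sum_nonneg_eq_0_iff)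
      next
        case 4 thus ?thesis using sP fin x(1) by (simp add: sum_nonneg_eq_0_iff)
      qed (use xa in simp)
    qed
    thus False using x(2) unfolding sqn_def by simp
  qed
  have ws: "w < s" using Xs wsum Psum L88 Lxa spos by linarith
  define b where "b = m - h"
  have hb: "h \<le> b" "b \<le> h + 1" "2 \<le> h" "h < m" unfolding b_def h_def using m by auto
  have hbm: "card A + card B = h + b" using cm hb unfolding b_def by simp
  let ?A = "{..<m div 2}" and ?B = "{m div 2..<m}" and ?H = "C_graph n l"
  have aH: "arr n ?A ?B [m..<n]" using turan_arr m by simp
  have a0: "0 \<in> ?A" using m by auto
  have len2: "2 \<le> length [m..<n]" "2 \<le> length ps" using m l len unfolding m_def by auto
  have ylen: "length [m..<n] = length ps" using len m unfolding m_def by simp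
  have sH: "simple_graph n ?H" unfolding C_graph_eq[OF m_def] by (rule CG_simple[OF aH a0 len2(1)])
  \<comment> \<open>The test vector copies the entries along the cycle. On the first class it solves
    the eigenvalue equation with \<open>s\<close> as the sum over the other class, and then
    \<open>q\<close> solves the equation on the second class.\<close>
  define p where "p = s / L"
  define Y where "Y = (s + w) / L"
  define Z where "Z = real h * s + w"
  define q where "q = Z / L / L"
  define y where "y j = (if j = 0 then Y else if j < h then p else if j < m then q else x (ps ! (j - m)))" for j
  have ymap: "map y [m..<n] = map x ps"
  proof (rule nth_equalityI)
    show "length (map y [m..<n]) = length (map x ps)" using ylen by simp
    fix i assume "i < length (map y [m..<n])"
    hence i: "i < length [m..<n]" by simp
    hence "y ([m..<n] ! i) = x (ps ! i)" using hb by (simp add: y_def)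
    thus "map y [m..<n] ! i = map x ps ! i" using i ylen by simp
  qed
  have psy: "psum y [m..<n] = psum x ps" using ymap by (rule psum_map_cong)
  have nem: "[m..<n] \<noteq> []" using m by simp
  have yends: "y (hd [m..<n]) = x ?c" "y (last [m..<n]) = x ?d"
    using ymap nem ne by (metis hd_map, metis last_map)
  have y0: "y 0 = Y" unfolding y_def by simp
  have ysum: "(\<Sum>v\<in>{..<m div 2}. f (y v)) = f Y + (real h - 1) * f p"
    "(\<Sum>v\<in>{m div 2..<m}. f (y v)) = real b * f q" for f :: "real \<Rightarrow> real"
  proof -
    have "{..<m div 2} = insert 0 {1..<h}" using hb unfolding h_def by auto
    moreover have "(\<Sum>v\<in>{1..<h}. f (y v)) = (\<Sum>v\<in>{1..<h}. f p)"
      by (rule sum.cong[OF refl]) (auto simp: y_def)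
    ultimately show "(\<Sum>v\<in>{..<m div 2}. f (y v)) = f Y + (real h - 1) * f p"
      using hb y0 by (simp add: of_nat_diff)
    have "(\<Sum>v\<in>{h..<m}. f (y v)) = (\<Sum>v\<in>{h..<m}. f q)"
      by (rule sum.cong[OF refl]) (use hb in \<open>auto simp: y_def\<close>)
    thus "(\<Sum>v\<in>{m div 2..<m}. f (y v)) = real b * f q"
      unfolding h_def[symmetric] b_def by simp
  qed
  have Lp: "L * p = s" and LY: "L * Y = s + w" and Lq: "L * L * q = Z" unfolding p_def Y_def q_def using L0 by simp_all
  have ysA: "sum y ?A = L * q"
  proof -
    have "sum y ?A = Y + (real h - 1) * p" using ysum(1)[of "\<lambda>z. z"] by simp
    hence "L * sum y ?A = L * (Y + (real h - 1) * p)" by simp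
    also have "\<dots> = L * Y + (real h - 1) * (L * p)" by (simp add: algebra_simps)
    also have "\<dots> = L * (L * q)" unfolding Lp LY using Lq unfolding Z_def by (simp add: algebra_simps)
    finally show ?thesis using L0 by simp
  qed
  have ysB: "sum y ?B = real b * q" using ysum(2)[of "\<lambda>z. z"] by simp
  have yqA: "sqn y ?A = Y\<^sup>2 + (real h - 1) * p\<^sup>2" using ysum(1)[of "\<lambda>z. z\<^sup>2"] unfolding sqn_def by simp
  have yqB: "sqn y ?B = real b * q\<^sup>2" using ysum(2)[of "\<lambda>z. z\<^sup>2"] unfolding sqn_def by simp
  have yqP: "sqn y {m..<n} = sqn x ?P"
  proof -
    have "sqn x ?P = (\<Sum>v\<leftarrow>ps. (x v)\<^sup>2)"
      unfolding sqn_def using dps by (simp add: sum_list_distinct_conv_sum_set)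
    also have "\<dots> = (\<Sum>i<length ps. (x (ps ! i))\<^sup>2)" by (simp add: sum_list_sum_nth lessThan_atLeast0)
    also have "\<dots> = (\<Sum>i<length ps. (y (m + i))\<^sup>2)" using hb by (intro sum.cong refl) (simp add: y_def)
    also have "\<dots> = (\<Sum>j\<in>{m..<n}. (y j)\<^sup>2)"
      using ylen by (intro sum.reindex_bij_witness[of _ "\<lambda>j. j - m" "\<lambda>i. m + i"]) auto
    finally show ?thesis unfolding sqn_def by simp
  qed
  have yV: "sqn y ?V = sqn y ?A + sqn y ?B + sqn y {m..<n}"
  proof -
    have "?V = (?A \<union> ?B) \<union> {m..<n}" using m by auto
    moreover have "?A \<inter> ?B = {}" "(?A \<union> ?B) \<inter> {m..<n} = {}" by auto
    ultimately show ?thesis by (simp only: sqn_Un finite_Un finite_lessThan finite_atLeastLessThan)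
  qed
  have qH: "qf ?H y ?V ?V = 2 * (L * q * (real b * q)) + 2 * psum x ps + 2 * (Y * w)"
    unfolding C_graph_eq[OF m_def] qf_CG[OF aH a0 len2(1)] ysA ysB psy yends y0 w_def by simp
  have qG: "L * sqn x ?P = 2 * psum x ps + x a * w"
  proof -
    have "L * sqn x ?P = qf E x ?P ?V" using x(3) Pn by (intro qf_eigen[symmetric]) auto
    also have "\<dots> = qf E x ?P (A \<union> B) + qf E x ?P ?P" unfolding V using fin dis by (intro qf_Un_right) auto
    also have "qf E x ?P ?P = qf (path_edge ps) x ?P ?P" using ind by (intro qf_cong) auto
    also have "\<dots> = 2 * psum x ps" using dps by (intro qf_path_edge) auto
    also have "qf E x ?P (A \<union> B) = qf E x (A \<union> B) ?P" by (rule qf_commute[OF G])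
    also have "\<dots> = (\<Sum>v\<in>A \<union> B. if v = a then x a * w else 0)"
      unfolding qf_def
    proof (intro sum.cong refl)
      fix v assume v: "v \<in> A \<union> B"
      show "x v * nsum E x ?P v = (if v = a then x a * w else 0)"
      proof (cases "v = a")
        case True
        have "{p\<in>?P. E a p} = {?c, ?d}" using att[of _ a] sE hP a by blast
        thus ?thesis unfolding w_def using cd True by (simp add: nsum_eq_sum_filter)
      next
        case False
        hence "nsum E x ?P v = 0" using v att sE by (intro nsum_eq_0) blast
        thus ?thesis using False by simp
      qed
    qed
    also have "\<dots> = x a * w" using fin a by simp
    finally show ?thesis by simp
  qed
  have "qf ?H y ?V ?V \<le> spec_rad n ?H * sqn y ?V" using sH n0 by (rule spec_rad_ge)
  also have "\<dots> \<le> L * sqn y ?V" using sr unfolding L_def by (intro mult_right_mono) auto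
  finally have "2 * (L * q * (real b * q)) + 2 * psum x ps + 2 * (Y * w)
      \<le> L * (Y\<^sup>2 + (real h - 1) * p\<^sup>2 + real b * q\<^sup>2) + (2 * psum x ps + x a * w)"
    unfolding qH yV yqA yqB yqP using qG by (simp add: algebra_simps)
  hence "L * (2 * (L * q * (real b * q)) + 2 * (Y * w)) \<le> L * (L * (Y\<^sup>2 + (real h - 1) * p\<^sup>2 + real b * q\<^sup>2) + x a * w)"
    using L0 by (intro mult_left_mono) auto
  hence "2 * real b * (L * q)\<^sup>2 + 2 * ((L * Y) * w) \<le> (L * Y)\<^sup>2 + (real h - 1) * (L * p)\<^sup>2 + real b * (L * q)\<^sup>2 + X * w"
    unfolding X_def by (simp add: algebra_simps power2_eq_square)
  hence "real b * (L * q)\<^sup>2 - s * Z + w * (s + w - X) \<le> 0"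
    unfolding Lp LY Z_def by (simp add: algebra_simps power2_eq_square)
  hence "L\<^sup>2 * (real b * (L * q)\<^sup>2 - s * Z + w * (s + w - X)) \<le> 0"
    using L0 by (simp add: mult_le_0_iff)
  moreover have "L\<^sup>2 * (real b * (L * q)\<^sup>2) = real b * Z\<^sup>2" unfolding Lq[symmetric] by (simp add: power2_eq_square)
  moreover have "L\<^sup>2 * (real b * (L * q)\<^sup>2 - s * Z + w * (s + w - X))
    = L\<^sup>2 * (real b * (L * q)\<^sup>2) - L\<^sup>2 * s * Z + L\<^sup>2 * (w * (s + w - X))" by (simp add: algebra_simps)
  moreover have "Z * (real b * Z - L\<^sup>2 * s) = real b * Z\<^sup>2 - L\<^sup>2 * s * Z" by (simp add: algebra_simps power2_eq_square)
  ultimately have "Z * (real b * Z - L\<^sup>2 * s) + L\<^sup>2 * (w * (s + w - X)) \<le> 0" by linarith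
  moreover have "0 \<le> L\<^sup>2 * (w * (s + w - X))" using s0 Xs by simp
  ultimately have "Z * (real b * Z - L\<^sup>2 * s) \<le> 0" by linarith
  moreover have "0 < Z" unfolding Z_def using spos s0 hb by (intro add_pos_nonneg mult_pos_pos) auto
  \<comment> \<open>In a balanced complete bipartite graph with the cycle attached, two steps of the
    eigenvalue equation would produce the left side from \<open>s\<close>.\<close>
  ultimately have low: "real b * Z \<le> L\<^sup>2 * s" by (simp add: mult_le_0_iff)
  define al where "al = card A"
  define be where "be = card B"
  have be1: "1 \<le> be" unfolding be_def using B1 fin by (simp add: Suc_le_eq card_gt_0_iff)
  have LsB: "L * s = (\<Sum>v\<in>B. nsum E x A v)"
    unfolding s_def sum_distrib_left by (intro sum.cong refl rowB)
  have nA: "nsum E x A v \<le> sA" for v unfolding sA_def using fin x(1) by (intro nsum_le_sum) auto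
  have nB: "nsum E x B v \<le> s" for v unfolding s_def using fin x(1) by (intro nsum_le_sum) auto
  have up1: "L * s \<le> real be * sA" unfolding LsB be_def using nA by (intro sum_bounded_above) auto
  have LsA: "L * sA = X + (\<Sum>v\<in>A - {a}. nsum E x B v)"
  proof -
    have "L * sA = L * x a + (\<Sum>v\<in>A - {a}. L * x v)"
      unfolding sA_def sum_distrib_left by (rule sum.remove[OF fin(1) a])
    also have "(\<Sum>v\<in>A - {a}. L * x v) = (\<Sum>v\<in>A - {a}. nsum E x B v)" by (intro sum.cong refl) (simp add: rowA)
    finally show ?thesis unfolding X_def .
  qed
  have al1: "1 \<le> al" unfolding al_def using a fin by (auto simp: Suc_le_eq card_gt_0_iff)
  have cAa: "real (card (A - {a})) = real al - 1"
    unfolding al_def using a fin al1[unfolded al_def] by (simp add: of_nat_diff)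
  have up2: "L * sA \<le> X + (real al - 1) * s"
    using sum_bounded_above[of "A - {a}" "nsum E x B" s] nB unfolding LsA cAa by simp
  have up: "L\<^sup>2 * s \<le> real be * (L * sA)" using mult_left_mono[OF up1, of L] L0 by (simp add: power2_eq_square algebra_simps)
  have up': "real be * (L * sA) \<le> real be * (X + (real al - 1) * s)" using up2 by (intro mult_left_mono) auto
  \<comment> \<open>The term \<open>s + w - X\<close> equals \<open>s - tau\<close>, the weight of
    the vertices of \<open>B\<close> that \<open>a\<close> is not adjacent to.\<close>
  have key: "(real b * real h - real be * real al) * s + (real b - real be) * w + real be * (s + w - X) \<le> 0"
    using low up up' unfolding Z_def by (simp add: algebra_simps)
  have D: "0 \<le> real be * (s + w - X)" using Xs by simp
  \<comment> \<open>Strictness for the tie. If \<open>w\<close> were 0, the entry at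
    \<open>hd ps\<close>, hence the one at \<open>a\<close>, hence \<open>X\<close> would be 0, and
    \<open>key\<close> would fail.\<close>
  have wpos: "0 < w"
  proof (rule ccontr)
    assume "\<not> ?thesis"
    hence w0: "w = 0" using s0 by simp
    hence "x ?c = 0" unfolding w_def using x(1)[of ?c] x(1)[of ?d] by linarith
    moreover have "x a \<le> nsum E x A ?c"
    proof -
      have "{v\<in>A. E ?c v} = {a}" using att[OF hP(1)] a by blast
      thus ?thesis using fin by (simp add: nsum_eq_sum_filter)
    qed
    moreover have "nsum E x A ?c \<le> L * x ?c"
      using x(3)[OF Pn[OF hP(1)]] split[of ?c] nsum_nonneg[of x E B ?c] nsum_nonneg[of x E ?P ?c] x(1) by simp
    ultimately have "x a = 0" using x(1)[of a] by simp
    hence "X = 0" unfolding X_def by simp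
    hence "(real b * real h - real be * real al) * s + real be * s \<le> 0" using key w0 by simp
    moreover have "0 \<le> (real b * real h - real be * real al) * s"
      using balanced_product_le[OF hb(1,2) hbm[folded al_def be_def]] spos by simp
    moreover have "0 < real be * s" using be1 spos by simp
    ultimately show False by linarith
  qed
  have beb: "be = b"
    by (rule balanced_product_cases[OF hb(1,2) hbm[folded al_def be_def] wpos ws D key])
  have alh: "al = h" using hbm beb unfolding al_def be_def by simp
  have "real be * (s + w - X) \<le> 0" using key unfolding beb alh by simp
  hence Xeq: "X = s + w" using be1 Xs by (simp add: mult_le_0_iff)
  have ZX: "X + (real al - 1) * s = Z" unfolding Z_def Xeq alh by (simp add: algebra_simps)
  have "real be * (L * sA) = real be * Z" using low up up' unfolding ZX beb by linarith
  hence e2': "L * sA = Z" using be1 by simp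
  have "L\<^sup>2 * s = real be * (L * sA)" using low up up' unfolding ZX beb e2' by linarith
  hence "L * (L * s) = L * (real be * sA)" by (simp add: power2_eq_square algebra_simps)
  hence e1: "L * s = real be * sA" using L0 by simp
  have fullB: "nsum E x A v = sA" if "v \<in> B" for v
  proof (rule ccontr)
    assume "nsum E x A v \<noteq> sA"
    hence "nsum E x A v < sA" using nA[of v] by simp
    hence "(\<Sum>v\<in>B. nsum E x A v) < (\<Sum>v\<in>B. sA)" using nA that fin by (intro sum_strict_mono_ex1) auto
    thus False using e1 LsB unfolding be_def by simp
  qed
  have fullA: "nsum E x B v = s" if "v \<in> A - {a}" for v
  proof (rule ccontr)
    assume "nsum E x B v \<noteq> s"
    hence "nsum E x B v < s" using nB[of v] by simp
    hence "(\<Sum>v\<in>A - {a}. nsum E x B v) < (\<Sum>v\<in>A - {a}. s)" using nB that fin by (intro sum_strict_mono_ex1) auto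
    thus False using e2' LsA ZX cAa by simp
  qed
  have posA: "0 < x v" if v: "v \<in> A" for v
  proof (cases "v = a")
    case True
    have "0 < L * x a" using Xeq spos wpos unfolding X_def by simp
    thus ?thesis using L0 True by (simp add: zero_less_mult_iff)
  next
    case False
    have "L * x v = s" using rowA[OF v False] fullA v False by simp
    thus ?thesis using spos L0 by (metis zero_less_mult_pos)
  qed
  have full: "E v u" if v: "v \<in> B" and u: "u \<in> A" for u v
  proof (rule ccontr)
    assume neg: "\<not> E v u"
    have "nsum E x A v < sum x A" unfolding nsum_def
      using neg u posA[OF u] fin x(1) by (intro sum_strict_mono_ex1) (auto intro!: bexI[of _ u])
    thus False using fullB[OF v] unfolding sA_def by simp
  qed
  have "E u v \<longleftrightarrow> CG A B a ps u v" if uv: "u < n" "v < n" for u v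
  proof -
    have na: "\<not> path_edge ps z z'" if "z \<in> A \<union> B \<or> z' \<in> A \<union> B" for z z' using path_edge_set that dis by blast
    have nP: "p \<notin> A" "p \<notin> B" if "p \<in> ?P" for p using that dis by auto
    consider "u \<in> A \<union> B" "v \<in> A \<union> B" | "u \<in> ?P" "v \<in> ?P" | "u \<in> ?P" "v \<in> A \<union> B" | "u \<in> A \<union> B" "v \<in> ?P"
      using uv V by blast
    thus ?thesis
    proof cases
      case 1
      have "E u v \<longleftrightarrow> bipK A B u v" using 1 full indep dis sE unfolding bipK_def by blast
      moreover have "\<not> path_edge (a # ps @ [a]) u v"
        using 1 na nP hP unfolding path_edge_closed[OF ne] by blast
      ultimately show ?thesis unfolding CG_def by blast
    next
      case 2
      have "\<not> bipK A B u v" using 2 nP unfolding bipK_def by blast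
      moreover have "u \<noteq> a" "v \<noteq> a" using 2 nP a by auto
      ultimately show ?thesis using ind 2 unfolding CG_def path_edge_closed[OF ne] by blast
    next
      case 3
      have "\<not> bipK A B u v" "u \<noteq> a" "\<not> path_edge ps u v" using 3 nP a na unfolding bipK_def by blast+
      thus ?thesis using att[OF 3] unfolding CG_def path_edge_closed[OF ne] by blast
    next
      case 4
      have "\<not> bipK A B u v" "v \<noteq> a" "\<not> path_edge ps u v" using 4 nP a na unfolding bipK_def by blast+
      thus ?thesis using att[OF 4(2,1)] sE[of u v] unfolding CG_def path_edge_closed[OF ne] by blast
    qed
  qed
  moreover have "graph_iso n (CG A B a ps) (CG ?A ?B 0 [m..<n])"
  proof -
    obtain b' where b': "b' \<in> B" using B1 by blast
    show ?thesis using b' a a0 m alh beb ylen unfolding al_def be_def h_def b_def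
      by (intro CG_iso[OF arr aH, of a b' 0 "m div 2"]) auto
  qed
  ultimately show ?thesis unfolding C_graph_eq[OF m_def] graph_iso_def by simp
qed

section \<open>The Perron vector of a graph without a given odd cycle\<close>

lemma perron_normalized:
  assumes G: "simple_graph n E" and n0: "n > 0"
  shows "\<exists>x u. (\<forall>v. 0 \<le> x v \<and> x v \<le> 1) \<and> u < n \<and> x u = 1 \<and> (\<forall>v<n. nsum E x {..<n} v = spec_rad n E * x v)"
proof -
  obtain x where x: "\<And>v. 0 \<le> x v" "sqn x {..<n} \<noteq> 0" "\<And>v. v < n \<Longrightarrow> nsum E x {..<n} v = spec_rad n E * x v"
    using spec_rad_perron[OF G n0] by blast
  have ne: "{..<n} \<noteq> {}" using n0 by auto
  obtain u where u: "u \<in> {..<n}" "\<forall>b\<in>{..<n}. x b \<le> x u" using ex_max_elem[of "{..<n}" x] ne by auto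
  have xu: "0 < x u"
  proof (rule ccontr)
    assume "\<not> ?thesis"
    hence "\<forall>b\<in>{..<n}. x b = 0" using u x(1) by (metis antisym linorder_not_less order_trans)
    thus False using x(2) unfolding sqn_def by simp
  qed
  define y where "y v = (if v < n then x v / x u else 0)" for v
  have "nsum E y {..<n} v = spec_rad n E * y v" if "v < n" for v
  proof -
    have "nsum E y {..<n} v = (1 / x u) * nsum E x {..<n} v"
      unfolding nsum_def sum_distrib_left y_def by (intro sum.cong) auto
    thus ?thesis using x(3)[OF that] that unfolding y_def by simp
  qed
  moreover have "0 \<le> y v \<and> y v \<le> 1" for v
    using u xu x(1) unfolding y_def by (simp add: divide_le_eq_1)
  moreover have "y u = 1" using u xu unfolding y_def by simp
  ultimately show ?thesis using u by (intro exI[of _ y] exI[of _ u]) auto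
qed

lemma sum_square_le: "finite X \<Longrightarrow> (sum x X)\<^sup>2 \<le> real (card X) * sqn x X"
  using sum_squared_le_sum_of_squares[of x X] unfolding sqn_def by (simp add: mult.commute)

lemma qf_square_le:
  assumes "finite X" "\<And>v. 0 \<le> x v"
  shows "qf E x X X \<le> real (card X) * sqn x X"
  using qf_le_sum_mult[of X x E X] sum_square_le[of X x] assms by (simp add: power2_eq_square)

text \<open>Cauchy-Schwarz in each class and twice the inequality between arithmetic and geometric
  mean: the spectral radius of a complete bipartite graph is at most half its number of
  vertices.\<close>

lemma two_sums_le:
  assumes "finite A" "finite B" "\<And>v. 0 \<le> (x v :: real)"
  shows "2 * (sum x A * sum x B) \<le> (real (card A) + real (card B)) / 2 * (sqn x A + sqn x B)"
proof (rule power2_le_imp_le)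
  let ?a = "real (card A)" and ?b = "real (card B)" and ?X = "sqn x A" and ?Y = "sqn x B"
  have amgm: "4 * (p * q) \<le> (p + q)\<^sup>2" for p q :: real
    using zero_le_power2[of "p - q"] by (simp add: power2_eq_square algebra_simps)
  have "(2 * (sum x A * sum x B))\<^sup>2 = 4 * ((sum x A)\<^sup>2 * (sum x B)\<^sup>2)" by (simp add: power_mult_distrib)
  also have "\<dots> \<le> 4 * ((?a * ?X) * (?b * ?Y))"
    using sum_square_le[OF assms(1), of x] sum_square_le[OF assms(2), of x]
    by (intro mult_left_mono mult_mono) auto
  also have "\<dots> = (4 * (?a * ?b)) * (4 * (?X * ?Y)) / 4" by simp
  also have "\<dots> \<le> ((?a + ?b)\<^sup>2 * (?X + ?Y)\<^sup>2) / 4"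
    using amgm[of ?a ?b] amgm[of ?X ?Y] by (intro divide_right_mono mult_mono) auto
  also have "\<dots> = ((?a + ?b) / 2 * (?X + ?Y))\<^sup>2" by (simp add: power_mult_distrib power_divide)
  finally show "(2 * (sum x A * sum x B))\<^sup>2 \<le> ((?a + ?b) / 2 * (?X + ?Y))\<^sup>2" .
  show "0 \<le> (?a + ?b) / 2 * (?X + ?Y)" by simp
qed

text \<open>The lower bound on \<open>L\<close> follows from the hypotheses of (a) and of (b) alike,
  so the structural analysis serves both.\<close>

locale perron_graph =
  fixes n k :: nat and E :: "nat \<Rightarrow> nat \<Rightarrow> bool" and L :: real and x :: "nat \<Rightarrow> real" and u :: nat
  assumes G: "simple_graph n E" and k1: "1 \<le> k" and nk: "187 * k \<le> n"
    and nocyc: "\<not> has_cycle n E (2 * k + 1)"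
    and L_ge: "real n / 2 - real k \<le> L"
    and x0: "\<And>v. 0 \<le> x v" and x1: "\<And>v. x v \<le> 1" and u: "u < n" "x u = 1"
    and eig: "\<And>v. v < n \<Longrightarrow> nsum E x {..<n} v = L * x v"
begin

lemma sE: "E v w \<longleftrightarrow> E w v"
  by (rule simple_graph_commute[OF G])

lemma irr: "\<not> E v v"
  by (rule simple_graph_irrefl[OF G])

lemma nR: "187 * real k \<le> real n" "1 \<le> real k" "187 \<le> real n"
proof -
  have "real (187 * k) \<le> real n" using nk by (rule of_nat_mono)
  thus "187 * real k \<le> real n" by simp
  show "1 \<le> real k" using k1 by simp
  thus "187 \<le> real n" using \<open>187 * real k \<le> real n\<close> by linarith
qed

lemma L_pos: "92 < L" "49465 / 100000 * real n \<le> L"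
  using L_ge nR by linarith+

definition S :: "nat set" where "S = {v. E u v}"
definition T :: "nat set" where "T = {..<n} - S"
definition D :: real where "D = real (card S)"
text \<open>An upper bound for the number of nonadjacent pairs between \<open>S\<close> and
  \<open>T\<close>. The last summand is the Erdos-Gallai bound for the degree sum inside
  \<open>S\<close>.\<close>

definition Mh :: real where "Mh = D * (real n - D) - L\<^sup>2 + 2 * (real k - 1) * D"
text \<open>The deviation of \<open>D\<close> from the value that maximises the estimate of
  \<open>Mh\<close>. The negative square of \<open>z\<close> is kept in all bounds, since it absorbs
  the terms linear in \<open>z\<close>.\<close>

definition z :: real where "z = D - real n / 2 - real k"

lemma S_sub: "S \<subseteq> {..<n}"
  unfolding S_def using simple_graphD[OF G] by auto

lemma fin: "finite S" "finite T"
  unfolding T_def using finite_subset[OF S_sub] by auto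

lemma V_ST: "{..<n} = S \<union> T" "S \<inter> T = {}"
  unfolding T_def using S_sub by auto

lemma card_T: "real (card T) = real n - D"
proof -
  have "card S + card T = n" using card_Un_disjoint[OF fin V_ST(2)] unfolding V_ST(1)[symmetric] by simp
  thus ?thesis unfolding D_def by linarith
qed

lemma L_eq_sum: "L = sum x S"
proof -
  have "{w \<in> {..<n}. E u w} = S" unfolding S_def using simple_graphD[OF G] by auto
  thus ?thesis using eig[OF u(1)] u(2) by (simp add: nsum_eq_sum_filter)
qed

lemma L_le_D: "L \<le> D"
  unfolding L_eq_sum D_def using sum_bounded_above[of S x 1] x1 by simp

text \<open>A path on \<open>2 * k\<close> vertices inside the neighbourhood of \<open>u\<close>
  closes through \<open>u\<close> to a \<open>C_{2k+1}\<close>.\<close>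

lemma deg_S_sum: "(\<Sum>v\<in>S. deg E S v) \<le> 2 * (k - 1) * card S"
proof (rule erdos_gallai_path[OF G fin(1) k1])
  fix zs assume zs: "distinct zs" "successively E zs" "set zs \<subseteq> S"
  show "length zs < 2 * k"
  proof (rule ccontr)
    assume "\<not> ?thesis"
    hence len: "2 * k \<le> length zs" by simp
    let ?us = "take (2 * k) zs"
    have l: "length ?us = 2 * k" using len by simp
    hence ne: "?us \<noteq> []" using k1 by auto
    have us: "distinct ?us" "successively E ?us" "set ?us \<subseteq> S"
      using zs by (auto dest: in_set_takeD) (metis append_take_drop_id successively_append_iff)
    have "hd ?us \<in> S" "last ?us \<in> S" using us(3) ne by (meson hd_in_set last_in_set subsetD)+
    hence "E u (hd ?us)" "E (last ?us) u" unfolding S_def using sE by auto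
    moreover have "u \<notin> set ?us" using us(3) irr unfolding S_def by auto
    ultimately have "has_cycle n E (length (u # ?us))"
      using us ne S_sub u(1) by (intro has_cycle_of_list) (auto simp: successively_Cons)
    thus False using nocyc l by simp
  qed
qed

text \<open>The eigenvalue equation is applied at \<open>u\<close> and then at its neighbours, and
  walks of length two are sorted by their last vertex. Last vertices inside \<open>S\<close> are
  bounded by Erdos-Gallai.\<close>

lemma L_square: "L\<^sup>2 \<le> (\<Sum>w\<in>T. real (deg E S w) * x w) + 2 * (real k - 1) * D"
proof -
  have "L\<^sup>2 = (\<Sum>v\<in>S. L * x v)"
    unfolding sum_distrib_left[symmetric] L_eq_sum[symmetric] by (simp add: power2_eq_square)
  also have "\<dots> = (\<Sum>v\<in>S. nsum E x {..<n} v)" using S_sub eig by (intro sum.cong) auto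
  also have "\<dots> = (\<Sum>w<n. \<Sum>v\<in>S. if E v w then x w else 0)" unfolding nsum_def by (rule sum.swap)
  also have "\<dots> = (\<Sum>w<n. real (deg E S w) * x w)"
  proof (intro sum.cong refl)
    fix w
    have "{v\<in>S. E v w} = {v\<in>S. E w v}" using sE by blast
    thus "(\<Sum>v\<in>S. if E v w then x w else 0) = real (deg E S w) * x w"
      using fin unfolding deg_def by (simp add: sum.If_cases Int_def)
  qed
  also have "\<dots> = (\<Sum>w\<in>S. real (deg E S w) * x w) + (\<Sum>w\<in>T. real (deg E S w) * x w)"
    unfolding V_ST(1) using fin V_ST(2) by (intro sum.union_disjoint)
  also have "(\<Sum>w\<in>S. real (deg E S w) * x w) \<le> (\<Sum>w\<in>S. real (deg E S w))"
    using x1 by (intro sum_mono) (simp add: mult_left_le)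
  also have "\<dots> = real (\<Sum>w\<in>S. deg E S w)" by simp
  also have "\<dots> \<le> real (2 * (k - 1) * card S)" using deg_S_sum by (rule of_nat_mono)
  also have "\<dots> = 2 * (real k - 1) * D" unfolding D_def using k1 by (simp add: of_nat_diff)
  finally show ?thesis by simp
qed

lemma defect: "(\<Sum>w\<in>T. D - real (deg E S w) * x w) \<le> Mh"
proof -
  have "(\<Sum>w\<in>T. D - real (deg E S w) * x w) = D * (real n - D) - (\<Sum>w\<in>T. real (deg E S w) * x w)"
    by (simp add: sum_subtractf card_T)
  thus ?thesis using L_square unfolding Mh_def by linarith
qed

lemma Mh_le: "Mh \<le> 2 * real k * real n - z\<^sup>2"
proof -
  have "(real n / 2 - real k)\<^sup>2 \<le> L\<^sup>2" using L_ge nR by (intro power_mono) auto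
  hence "Mh \<le> D * (real n - D) - (real n / 2 - real k)\<^sup>2 + 2 * real k * D"
    unfolding Mh_def using D_def by (simp add: algebra_simps)
  also have "\<dots> = 2 * real k * real n - z\<^sup>2" unfolding z_def by (simp add: power2_eq_square field_simps)
  finally show ?thesis .
qed

text \<open>For \<open>k = 1\<close> the Erdos-Gallai summand vanishes. The general bound
  \<open>2 * n\<close> would be too weak for the case of \<open>rest_x\<close> that only occurs for
  \<open>k = 1\<close>.\<close>

lemma Mh_le_1: "k = 1 \<Longrightarrow> Mh \<le> real n"
proof -
  assume k: "k = 1"
  have "(real n / 2 - real k)\<^sup>2 \<le> L\<^sup>2" using L_ge nR by (intro power_mono) auto
  moreover have "real k = 1" using k by simp
  ultimately have "Mh \<le> D * (real n - D) - (real n / 2 - 1)\<^sup>2" unfolding Mh_def by simp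
  moreover have "D * (real n - D) - (real n / 2 - 1)\<^sup>2 = real n - 1 - (D - real n / 2)\<^sup>2"
    by (simp add: power2_eq_square field_simps)
  ultimately show ?thesis using zero_le_power2[of "D - real n / 2"] by linarith
qed

text \<open>With the threshold \<open>n / 6\<close> two vertices together miss at most a third of
  \<open>n\<close> on the other side, while each side keeps nearly half of all vertices.\<close>

definition A0 :: "nat set" where "A0 = {v\<in>S. 6 * card {w\<in>T. \<not> E v w} \<le> n}"
definition B0 :: "nat set" where "B0 = {w\<in>T. 6 * card {v\<in>S. \<not> E w v} \<le> n}"

lemma miss_eq: "real (card {v\<in>S. \<not> E w v}) = D - real (deg E S w)"
  using card_split_pred[OF fin(1), of "E w"] unfolding deg_def D_def by linarith

lemma miss_T: "(\<Sum>w\<in>T. real (card {v\<in>S. \<not> E w v})) \<le> Mh"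
proof -
  have "(\<Sum>w\<in>T. real (card {v\<in>S. \<not> E w v})) \<le> (\<Sum>w\<in>T. D - real (deg E S w) * x w)"
    unfolding miss_eq using x1 by (intro sum_mono) (simp add: mult_left_le)
  thus ?thesis using defect by simp
qed

lemma miss_S: "(\<Sum>v\<in>S. real (card {w\<in>T. \<not> E v w})) \<le> Mh"
proof -
  have "(\<Sum>v\<in>S. real (card {w\<in>T. \<not> E v w})) = (\<Sum>v\<in>S. \<Sum>w\<in>T. if E v w then 0 else 1)"
    using fin by (simp add: sum.If_cases Int_def)
  also have "\<dots> = (\<Sum>w\<in>T. \<Sum>v\<in>S. if E v w then 0 else 1)" by (rule sum.swap)
  also have "\<dots> = (\<Sum>w\<in>T. real (card {v\<in>S. \<not> E w v}))"
  proof (intro sum.cong refl)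
    fix w
    have "{v\<in>S. \<not> E v w} = {v\<in>S. \<not> E w v}" using sE by blast
    thus "(\<Sum>v\<in>S. if E v w then 0 else 1) = real (card {v\<in>S. \<not> E w v})"
      using fin by (simp add: sum.If_cases Int_def)
  qed
  finally show ?thesis using miss_T by simp
qed

lemma markov_card:
  assumes "finite X" "(\<Sum>v\<in>X. real (f v)) \<le> M"
  shows "real n * real (card {v\<in>X. \<not> 6 * f v \<le> n}) \<le> 6 * M"
proof -
  let ?Y = "{v\<in>X. \<not> 6 * f v \<le> n}"
  have "real n / 6 * real (card ?Y) = (\<Sum>v\<in>?Y. real n / 6)" by simp
  also have "\<dots> \<le> (\<Sum>v\<in>?Y. real (f v))" by (intro sum_mono) auto
  also have "\<dots> \<le> (\<Sum>v\<in>X. real (f v))" using assms(1) by (intro sum_mono2) auto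
  also have "\<dots> \<le> M" by fact
  finally show ?thesis by simp
qed

lemma bad_S: "real n * real (card (S - A0)) \<le> 6 * Mh"
proof -
  have "S - A0 = {v\<in>S. \<not> 6 * card {w\<in>T. \<not> E v w} \<le> n}" unfolding A0_def by auto
  thus ?thesis using markov_card[OF fin(1) miss_S] by simp
qed

lemma bad_T: "real n * real (card (T - B0)) \<le> 6 * Mh"
proof -
  have "T - B0 = {w\<in>T. \<not> 6 * card {v\<in>S. \<not> E w v} \<le> n}" unfolding B0_def by auto
  thus ?thesis using markov_card[OF fin(2) miss_T] by simp
qed

lemma sub0: "A0 \<subseteq> S" "B0 \<subseteq> T" "finite A0" "finite B0" "A0 \<inter> B0 = {}"
  using fin V_ST(2) unfolding A0_def B0_def by auto

lemma card_A0_eq: "real (card A0) = D - real (card (S - A0))"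
  using card_Diff_subset[OF sub0(3,1)] card_mono[OF fin(1) sub0(1)] unfolding D_def by (simp add: of_nat_diff)

lemma card_B0_eq: "real (card B0) = real n - D - real (card (T - B0))"
  using card_Diff_subset[OF sub0(4,2)] card_mono[OF fin(2) sub0(2)] card_T by (simp add: of_nat_diff)

lemma card_A0_ge: "real n / 3 + 2 * real k + 4 \<le> real (card A0)"
proof -
  let ?n = "real n" and ?k = "real k"
  have "?n * real (card A0) = ?n * D - ?n * real (card (S - A0))" unfolding card_A0_eq by (simp add: algebra_simps)
  hence "?n * D - 12 * ?k * ?n + 6 * z\<^sup>2 \<le> ?n * real (card A0)" using bad_S Mh_le by linarith
  moreover have "?n * D = ?n * ?n / 2 + ?n * ?k + ?n * z" unfolding z_def by (simp add: algebra_simps)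
  \<comment> \<open>Trades the term linear in \<open>z\<close> for the positive square of
    \<open>z\<close> supplied by \<open>Mh_le\<close>.\<close>
  moreover have "0 \<le> ?n * ?n + 24 * (?n * z) + 144 * z\<^sup>2"
    using zero_le_power2[of "?n + 12 * z"] by (simp add: power2_eq_square algebra_simps)
  moreover have "?n * (13 * ?k + 4) \<le> ?n * (?n / 8)" using nR by (intro mult_left_mono) auto
  ultimately have "?n * (?n / 3 + 2 * ?k + 4) \<le> ?n * real (card A0)"
    by (simp add: algebra_simps)
  thus ?thesis using nR by simp
qed

lemma card_B0_ge: "real n / 3 + 2 * real k + 4 \<le> real (card B0)"
proof -
  let ?n = "real n" and ?k = "real k"
  have "?n * real (card B0) = ?n * (?n - D) - ?n * real (card (T - B0))" unfolding card_B0_eq by (simp add: algebra_simps)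
  hence "?n * (?n - D) - 12 * ?k * ?n + 6 * z\<^sup>2 \<le> ?n * real (card B0)" using bad_T Mh_le by linarith
  moreover have "?n * (?n - D) = ?n * ?n / 2 - ?n * ?k - ?n * z" unfolding z_def by (simp add: algebra_simps)
  moreover have "0 \<le> ?n * ?n - 24 * (?n * z) + 144 * z\<^sup>2"
    using zero_le_power2[of "?n - 12 * z"] by (simp add: power2_eq_square algebra_simps)
  moreover have "?n * (15 * ?k + 4) \<le> ?n * (?n / 8)" using nR by (intro mult_left_mono) auto
  ultimately have "?n * (?n / 3 + 2 * ?k + 4) \<le> ?n * real (card B0)"
    by (simp add: algebra_simps)
  thus ?thesis using nR by simp
qed

text \<open>The surplus \<open>2 * k + 4\<close> is what links of length up to \<open>2 * k\<close>
  between majority vertices require.\<close>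

lemma core0: "core E A0 B0 (n div 6) (2 * k + 4)"
  unfolding core_def
proof (intro conjI ballI)
  have "real (2 * (n div 6) + (2 * k + 4)) \<le> real n / 3 + 2 * real k + 4" by linarith
  thus "2 * (n div 6) + (2 * k + 4) \<le> card A0" "2 * (n div 6) + (2 * k + 4) \<le> card B0"
    using card_A0_ge card_B0_ge by linarith+
  fix v assume v: "v \<in> A0"
  have "card {w\<in>B0. \<not> E v w} \<le> card {w\<in>T. \<not> E v w}" using fin sub0 by (intro card_mono) auto
  thus "card {w\<in>B0. \<not> E v w} \<le> n div 6" using v unfolding A0_def by auto
next
  fix w assume w: "w \<in> B0"
  have "card {v\<in>A0. \<not> E w v} \<le> card {v\<in>S. \<not> E w v}" using fin sub0 by (intro card_mono) auto
  thus "card {v\<in>A0. \<not> E w v} \<le> n div 6" using w unfolding B0_def by auto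
qed (use sub0 in auto)

text \<open>Membership is decided by a majority instead of the threshold of \<open>A0\<close>, so
  that each vertex left over lacks at least half of \<open>A0\<close> and at least half of
  \<open>B0\<close>.\<close>

definition A :: "nat set" where "A = {v. v < n \<and> maj E B0 v}"
definition B :: "nat set" where "B = {v. v < n \<and> maj E A0 v}"

lemma core_in: "A0 \<subseteq> A" "B0 \<subseteq> B"
  using core_maj[OF core0] core_maj[OF core_sym[OF core0]] sub0 V_ST unfolding A_def B_def by auto

lemma core_lt: "v \<in> A0 \<union> B0 \<Longrightarrow> v < n"
  using sub0 V_ST by blast

lemma cycle_of_path:
  assumes "distinct us" "successively E us" "set us \<subseteq> {..<n}" "E (last us) (hd us)" "length us = 2 * k + 1"
  shows False
  using has_cycle_of_list[of us n E] assms nocyc by (cases us) auto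

lemma link_path_same:
  assumes "(v \<in> A \<and> w \<in> A) \<or> (v \<in> B \<and> w \<in> B)" "v \<noteq> w" "even g" "2 \<le> g" "g \<le> 2 * k"
  shows "\<exists>zs. distinct (v # zs @ [w]) \<and> successively E (v # zs @ [w]) \<and> set zs \<subseteq> A0 \<union> B0 \<and> length zs = g - 1"
  using assms(1)
proof
  assume "v \<in> A \<and> w \<in> A"
  thus ?thesis using link_same[OF core0 G, of v w g] assms unfolding A_def by auto
next
  assume "v \<in> B \<and> w \<in> B"
  thus ?thesis using link_same[OF core_sym[OF core0] G, of v w g] assms unfolding B_def by (auto simp: Un_commute)
qed

lemma link_path_opposite:
  assumes "(v \<in> A \<and> w \<in> B) \<or> (v \<in> B \<and> w \<in> A)" "v \<noteq> w" "odd g" "3 \<le> g" "g \<le> 2 * k"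
  shows "\<exists>zs. distinct (v # zs @ [w]) \<and> successively E (v # zs @ [w]) \<and> set zs \<subseteq> A0 \<union> B0 \<and> length zs = g - 1"
  using assms(1)
proof
  assume "v \<in> A \<and> w \<in> B"
  thus ?thesis using link_opposite[OF core0 G, of v w g] assms unfolding A_def B_def by auto
next
  assume "v \<in> B \<and> w \<in> A"
  thus ?thesis using link_opposite[OF core_sym[OF core0] G, of v w g] assms unfolding A_def B_def by (auto simp: Un_commute)
qed

text \<open>An edge inside a class together with a link of length \<open>2 * k\<close> between its
  ends is a \<open>C_{2k+1}\<close>.\<close>

lemma indep_AB: "(v \<in> A \<and> w \<in> A) \<or> (v \<in> B \<and> w \<in> B) \<Longrightarrow> \<not> E v w"
proof
  assume a: "(v \<in> A \<and> w \<in> A) \<or> (v \<in> B \<and> w \<in> B)" and e: "E v w"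
  have "v \<noteq> w" using e irr by auto
  then obtain zs where zs: "distinct (v # zs @ [w])" "successively E (v # zs @ [w])" "set zs \<subseteq> A0 \<union> B0" "length zs = 2 * k - 1"
    using link_path_same[OF a, of "2 * k"] k1 by auto
  have "set (v # zs @ [w]) \<subseteq> {..<n}" using zs(3) core_lt a unfolding A_def B_def by auto
  thus False using cycle_of_path[OF zs(1,2)] e sE zs(4) k1 by simp
qed

text \<open>A vertex in both classes has core neighbours \<open>w\<close> and \<open>t\<close> on
  both sides, and a core path of length \<open>2 * k - 1\<close> between them closes a
  \<open>C_{2k+1}\<close>. They are chosen adjacent so that the edge itself serves for
  \<open>k = 1\<close>.\<close>

lemma AB_disjoint: "A \<inter> B = {}"
proof (rule ccontr)
  assume "A \<inter> B \<noteq> {}"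
  then obtain v where v: "v < n" "maj E B0 v" "maj E A0 v" unfolding A_def B_def by auto
  have c: "2 * (n div 6) + (2 * k + 4) \<le> card A0" "2 * (n div 6) + (2 * k + 4) \<le> card B0"
    using core0 unfolding core_def by auto
  obtain w where w: "w \<in> B0" "E v w" using maj_ex[OF sub0(4) v(2), of "{}"] c by auto
  have "\<exists>t\<in>A0. E v t \<and> E w t \<and> t \<notin> {}"
  proof (rule ex_good_element[OF sub0(3)])
    have "card {t\<in>A0. \<not> E w t} \<le> n div 6" using core0 w unfolding core_def by auto
    thus "card {t \<in> A0. \<not> E v t} + card {t \<in> A0. \<not> E w t} + card {} < card A0"
      using v(3) card_split_pred[OF sub0(3), of "E v"] c unfolding maj_def by simp
  qed simp
  then obtain t where t: "t \<in> A0" "E v t" "E w t" by blast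
  have ne: "w \<noteq> v" "t \<noteq> v" "w \<noteq> t" using w t irr sub0 by auto
  have "\<exists>zs. distinct (w # zs @ [t]) \<and> successively E (w # zs @ [t]) \<and> set zs \<subseteq> (B0 \<union> A0) - {v} \<and> length (w # zs @ [t]) = 2 * k"
  proof (cases "k = 1")
    case True
    thus ?thesis using t ne by (intro exI[of _ "[]"]) auto
  next
    case False
    hence k2: "2 \<le> k" using k1 by simp
    have "\<exists>zs. distinct (w # zs @ [t]) \<and> successively E (w # zs @ [t]) \<and> set zs \<subseteq> (B0 \<union> A0) - {v} \<and> length zs = (2 * k - 1) - 1"
      by (rule core_path[OF core_sym[OF core0] G]) (use k2 w t ne in auto)
    thus ?thesis using k2 by auto
  qed
  then obtain zs where zs: "distinct (w # zs @ [t])" "successively E (w # zs @ [t])" "set zs \<subseteq> (B0 \<union> A0) - {v}"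
    "length (w # zs @ [t]) = 2 * k" by blast
  have "distinct (v # w # zs @ [t])" using zs ne by auto
  moreover have "successively E (v # w # zs @ [t])" using zs w by (simp add: successively_Cons)
  moreover have "set (v # w # zs @ [t]) \<subseteq> {..<n}" using zs w t v core_lt by auto
  ultimately show False using cycle_of_path[of "v # w # zs @ [t]"] t sE zs(4) by simp
qed

sublocale bip_part n E A B
  by unfold_locales (use G AB_disjoint indep_AB in \<open>auto simp: A_def B_def\<close>)

lemma finAB: "finite A" "finite B" "finite rest"
proof -
  show "finite A" "finite B" unfolding A_def B_def by auto
  show "finite rest" unfolding rest_def by simp
qed

text \<open>A shorter ear would be closed to a \<open>C_{2k+1}\<close> by a link of length
  \<open>2 * k - length ws\<close>. That the ear is bad is exactly the parity condition for this
  link.\<close>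

lemma ear_length:
  assumes ear: "bad_ear v ws w" and d: "distinct ws" and ne: "v \<noteq> w"
  shows "2 * k - 1 \<le> length ws"
proof (rule ccontr)
  assume "\<not> ?thesis"
  hence len: "length ws \<le> 2 * k - 2" by simp
  have ws: "ws \<noteq> []" "set ws \<subseteq> rest" "successively E ws" and vw: "v \<in> A \<union> B" "w \<in> A \<union> B"
    and e: "E v (hd ws)" "E (last ws) w" and par: "(v \<in> A \<longleftrightarrow> w \<in> A) \<longleftrightarrow> even (length ws)"
    using ear unfolding bad_ear_def rwalk_def by auto
  define g where "g = 2 * k - length ws"
  have g: "2 \<le> g" "g \<le> 2 * k" "even g \<longleftrightarrow> even (length ws)" "length ws + g = 2 * k"
    using len k1 ws(1) unfolding g_def by (auto simp: even_diff_nat)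
  have "\<exists>zs. distinct (w # zs @ [v]) \<and> successively E (w # zs @ [v]) \<and> set zs \<subseteq> A0 \<union> B0 \<and> length zs = g - 1"
  proof (cases "v \<in> A \<longleftrightarrow> w \<in> A")
    case True
    thus ?thesis using g par vw ne AB_disjoint by (intro link_path_same) auto
  next
    case False
    hence "odd g" using par g by simp
    hence "3 \<le> g" using g(1) by presburger
    thus ?thesis using g False \<open>odd g\<close> vw ne by (intro link_path_opposite) auto
  qed
  then obtain zs where zs: "distinct (w # zs @ [v])" "successively E (w # zs @ [v])" "set zs \<subseteq> A0 \<union> B0" "length zs = g - 1"
    by blast
  let ?c = "ws @ (w # zs @ [v])"
  have zAB: "set zs \<subseteq> A \<union> B" using zs(3) core_in by auto
  have "distinct ?c" using d zs(1) ws(2) vw zAB unfolding rest_def by auto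
  moreover have "successively E ?c" using ws zs(2) e(2) by (simp add: successively_append_iff)
  moreover have "set ?c \<subseteq> {..<n}" using ws(2) zAB vw AB(1,2) unfolding rest_def by auto
  moreover have "E (last ?c) (hd ?c)" using e(1) ws(1) by simp
  moreover have "length ?c = 2 * k + 1" using zs(4) g by simp
  ultimately show False using cycle_of_path by blast
qed

lemma rest_bad: "rest \<subseteq> (S - A0) \<union> (T - B0)"
  using core_in V_ST unfolding rest_def by blast

lemma bad_card: "real n * (real (card (S - A0)) + real (card (T - B0))) \<le> 12 * Mh"
  using bad_S bad_T by (simp add: algebra_simps)

lemma rest_card: "real n * real (card rest) \<le> 24 * real k * real n - 12 * z\<^sup>2"
proof -
  have "card rest \<le> card ((S - A0) \<union> (T - B0))" using rest_bad fin by (intro card_mono) auto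
  also have "\<dots> \<le> card (S - A0) + card (T - B0)" by (rule card_Un_le)
  finally have "real (card rest) \<le> real (card (S - A0)) + real (card (T - B0))" by linarith
  hence "real n * real (card rest) \<le> real n * (real (card (S - A0)) + real (card (T - B0)))" by (intro mult_left_mono) auto
  thus ?thesis using bad_card Mh_le by linarith
qed

text \<open>The remainder has at most \<open>24 * k\<close> vertices, so the form inside any part of
  it is at most \<open>L\<close> times the squared norm.\<close>

lemma rest_card_L: "real (card rest) \<le> L"
proof -
  have "0 \<le> z\<^sup>2" by simp
  hence "real n * real (card rest) \<le> 24 * real k * real n" using rest_card by linarith
  hence "real n * real (card rest) \<le> real n * (24 * real k)" by (simp add: algebra_simps)
  hence "real (card rest) \<le> 24 * real k" using nR by simp
  thus ?thesis using L_pos nR by linarith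
qed

text \<open>A vertex of the remainder sees at most half of \<open>A0\<close> and half of
  \<open>B0\<close>. If it sees both sets it is a bad ear by itself, so \<open>k = 1\<close>, and
  the absence of triangles reduces each neighbourhood to \<open>n / 6\<close>; then 1/3 + 12/187
  gives the constant. Otherwise only one of the halves counts.\<close>

lemma rest_x:
  assumes v: "v \<in> rest" shows "L * x v \<le> 398 / 1000 * real n"
proof -
  let ?n = "real n" and ?k = "real k"
  let ?N = "{w\<in>{..<n}. E v w}" and ?NA = "{w\<in>A0. E v w}" and ?NB = "{w\<in>B0. E v w}"
  have vn: "v < n" "v \<notin> A" "v \<notin> B" using v unfolding rest_def by auto
  have "L * x v = sum x ?N" using eig[OF vn(1)] by (simp add: nsum_eq_sum_filter)
  also have "\<dots> \<le> real (card ?N)" using sum_bounded_above[of ?N x 1] x1 by simp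
  finally have 1: "L * x v \<le> real (card ?N)" .
  have "?N \<subseteq> ((?NA \<union> ?NB) \<union> (S - A0)) \<union> (T - B0)" using V_ST by blast
  hence "card ?N \<le> card (((?NA \<union> ?NB) \<union> (S - A0)) \<union> (T - B0))" using fin sub0 by (intro card_mono) auto
  also have "\<dots> \<le> card ?NA + card ?NB + card (S - A0) + card (T - B0)"
    by (meson add_mono card_Un_le le_refl order_trans)
  finally have 2: "L * x v \<le> real (card ?NA) + real (card ?NB) + (real (card (S - A0)) + real (card (T - B0)))"
    using 1 by linarith
  have "\<not> maj E A0 v" "\<not> maj E B0 v" using vn unfolding A_def B_def by auto
  hence hA: "2 * real (card ?NA) \<le> real (card A0)" and hB: "2 * real (card ?NB) \<le> real (card B0)"
    unfolding maj_def by linarith+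
  have A0D: "real (card A0) \<le> D" and B0D: "real (card B0) \<le> ?n - D" using card_A0_eq card_B0_eq by auto
  show ?thesis
  proof (cases "?NA = {} \<or> ?NB = {}")
    case True
    \<comment> \<open>These squares bound \<open>n * z\<close> in either direction; the excess is
      covered by the term \<open>- 12 * z\<^sup>2\<close> from the count of bad vertices.\<close>
    have sq: "0 \<le> ?n * ?n - 96 * (?n * z) + 2304 * z\<^sup>2" "0 \<le> ?n * ?n + 96 * (?n * z) + 2304 * z\<^sup>2"
      using zero_le_power2[of "?n - 48 * z"] zero_le_power2[of "?n + 48 * z"] by (simp_all add: power2_eq_square algebra_simps)
    have kn: "?n * (187 * ?k) \<le> ?n * ?n" using nR by (intro mult_left_mono) auto
    have nn: "0 \<le> ?n * ?n" by simp
    have "L * x v \<le> D / 2 + (real (card (S - A0)) + real (card (T - B0)))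
      \<or> L * x v \<le> (?n - D) / 2 + (real (card (S - A0)) + real (card (T - B0)))"
    proof (cases "?NB = {}")
      case True
      hence "card ?NB = 0" by (simp only: card.empty)
      hence "real (card ?NB) = 0" by (simp only: of_nat_0)
      hence "L * x v \<le> D / 2 + (real (card (S - A0)) + real (card (T - B0)))" using 2 hA A0D by linarith
      thus ?thesis ..
    next
      case False
      hence "?NA = {}" using \<open>?NA = {} \<or> ?NB = {}\<close> by blast
      hence "card ?NA = 0" by (simp only: card.empty)
      hence "real (card ?NA) = 0" by (simp only: of_nat_0)
      moreover have "l \<le> q / 2 + s" if "a = 0" "l \<le> a + b + s" "2 * b \<le> c" "c \<le> q" for l q s a b c :: real
        using that by linarith
      ultimately have "L * x v \<le> (?n - D) / 2 + (real (card (S - A0)) + real (card (T - B0)))" using 2 hB B0D by blast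
      thus ?thesis ..
    qed
    moreover have num: "398 / 1000 * nn \<ge> q"
      if "q \<le> (nn / 2 + kn + t) / 2 + (24 * kn - 12 * zz)" "96 * t \<le> nn + 2304 * zz" "187 * kn \<le> nn" "0 \<le> nn" for q nn kn t zz :: real
    proof -
      have "q \<le> nn / 4 + kn / 2 + t / 2 + 24 * kn - 12 * zz" using that(1) by (simp add: add_divide_distrib)
      thus ?thesis using that(2-4) by linarith
    qed
    moreover have zn: "0 \<le> ?k * ?n" by simp
    ultimately have "?n * (L * x v) \<le> ?n * (398 / 1000 * ?n)"
    proof (elim disjE)
      assume "L * x v \<le> D / 2 + (real (card (S - A0)) + real (card (T - B0)))"
      hence "?n * (L * x v) \<le> ?n * (D / 2 + (real (card (S - A0)) + real (card (T - B0))))" by (intro mult_left_mono) auto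
      also have "\<dots> \<le> ?n * D / 2 + (24 * ?k * ?n - 12 * z\<^sup>2)"
        using bad_card Mh_le by (simp add: algebra_simps)
      also have "?n * D = ?n * ?n / 2 + ?k * ?n + ?n * z" unfolding z_def by (simp add: algebra_simps)
      finally have "?n * (L * x v) \<le> 398 / 1000 * (?n * ?n)"
        using sq kn nn by (intro num[of _ _ "?k * ?n" "?n * z" "z\<^sup>2"]) (simp_all add: algebra_simps)
      thus ?thesis by simp
    next
      assume "L * x v \<le> (?n - D) / 2 + (real (card (S - A0)) + real (card (T - B0)))"
      hence "?n * (L * x v) \<le> ?n * ((?n - D) / 2 + (real (card (S - A0)) + real (card (T - B0))))" by (intro mult_left_mono) auto
      also have "\<dots> \<le> ?n * (?n - D) / 2 + (24 * ?k * ?n - 12 * z\<^sup>2)"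
        using bad_card Mh_le by (simp add: algebra_simps)
      also have "?n * (?n - D) = ?n * ?n / 2 - ?k * ?n - ?n * z" unfolding z_def by (simp add: algebra_simps)
      also have "(?n * ?n / 2 - ?k * ?n - ?n * z) / 2 + (24 * ?k * ?n - 12 * z\<^sup>2)
        \<le> (?n * ?n / 2 + ?k * ?n - ?n * z) / 2 + (24 * ?k * ?n - 12 * z\<^sup>2)" using zn by simp
      finally have "?n * (L * x v) \<le> 398 / 1000 * (?n * ?n)"
        using sq kn nn by (intro num[of _ _ "?k * ?n" "- (?n * z)" "z\<^sup>2"]) (simp_all add: algebra_simps)
      thus ?thesis by simp
    qed
    thus ?thesis using nR by simp
  next
    case False
    then obtain a b where ab: "a \<in> A0" "E v a" "b \<in> B0" "E v b" by blast
    have "bad_ear a [v] b" unfolding bad_ear_def rwalk_def using ab core_in v sE AB_disjoint by auto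
    moreover have "a \<noteq> b" using ab sub0 by auto
    ultimately have "2 * k - 1 \<le> 1" using ear_length[of a "[v]" b] by simp
    hence k: "k = 1" using k1 by simp
    have tri: "\<not> E a' b'" if "a' \<in> A0" "E v a'" "b' \<in> B0" "E v b'" for a' b'
    proof
      assume e: "E a' b'"
      have "a' \<noteq> b'" "v \<noteq> a'" "v \<noteq> b'" using that e irr by auto
      thus False using cycle_of_path[of "[v, a', b']"] that e sE vn(1) core_lt k by auto
    qed
    have "?NA \<subseteq> {t\<in>S. \<not> E b t}"
    proof
      fix t assume "t \<in> ?NA"
      hence "t \<in> S" "\<not> E t b" using tri[of t b] ab sub0(1) by auto
      thus "t \<in> {t\<in>S. \<not> E b t}" using sE[of t b] by simp
    qed
    hence "card ?NA \<le> card {t\<in>S. \<not> E b t}" using fin by (intro card_mono) auto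
    hence nA: "6 * real (card ?NA) \<le> ?n" using ab unfolding B0_def by auto
    have "?NB \<subseteq> {t\<in>T. \<not> E a t}" using tri[OF ab(1,2)] sub0(2) by auto
    hence "card ?NB \<le> card {t\<in>T. \<not> E a t}" using fin by (intro card_mono) auto
    hence nB: "6 * real (card ?NB) \<le> ?n" using ab unfolding A0_def by auto
    have "?n * (real (card (S - A0)) + real (card (T - B0))) \<le> ?n * 12" using bad_card Mh_le_1[OF k] by linarith
    hence "real (card (S - A0)) + real (card (T - B0)) \<le> 12" using nR by simp
    thus ?thesis using 2 nA nB nR by linarith
  qed
qed

lemma rest_x_square:
  assumes v: "v \<in> rest"
  shows "(x v)\<^sup>2 \<le> 6475 / 10000" "L * (x v)\<^sup>2 \<le> 3203 / 10000 * real n"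
proof -
  have "49465 / 100000 * real n * x v \<le> L * x v" using L_pos x0 by (intro mult_right_mono) auto
  hence "real n * (49465 / 100000 * x v) \<le> real n * (398 / 1000)" using rest_x[OF v] by (simp add: algebra_simps)
  hence "49465 / 100000 * x v \<le> 398 / 1000" using nR by simp
  \<comment> \<open>The quotient of 0.398 and the lower bound 0.49465 for \<open>L / n\<close>,
    rounded up.\<close>
  hence xv: "x v \<le> 80461 / 100000" by simp
  have "(x v)\<^sup>2 \<le> (80461 / 100000)\<^sup>2" using xv x0 by (intro power_mono) auto
  also have "\<dots> \<le> 6475 / 10000" by (simp add: power2_eq_square)
  finally show "(x v)\<^sup>2 \<le> 6475 / 10000" .
  have "L * (x v)\<^sup>2 = (L * x v) * x v" by (simp add: power2_eq_square)
  also have "\<dots> \<le> (398 / 1000 * real n) * (80461 / 100000)"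
    by (rule mult_mono[OF rest_x[OF v] xv]) (use x0 in auto)
  also have "\<dots> \<le> 3203 / 10000 * real n" by simp
  finally show "L * (x v)\<^sup>2 \<le> 3203 / 10000 * real n" .
qed

text \<open>Since the square of \<open>x v\<close> is at least \<open>2 * x v - 1\<close>, the total
  squared norm is at least twice the sum of the entries minus \<open>n\<close>. The entries on
  \<open>S\<close> sum to \<open>L\<close>, those on \<open>T\<close> are controlled by
  \<open>defect\<close>, and the contribution of the remainder is subtracted at the end.\<close>

lemma sqn_AB: "767 / 1000 * real n \<le> sqn x (A \<union> B)"
proof -
  let ?n = "real n" and ?k = "real k"
  define t where "t = (\<Sum>w\<in>T. 1 - x w)"
  have t0: "0 \<le> t" unfolding t_def using x1 by (intro sum_nonneg) auto
  have "D * t = (\<Sum>w\<in>T. D - D * x w)" unfolding t_def sum_distrib_left by (simp add: algebra_simps)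
  also have "\<dots> \<le> (\<Sum>w\<in>T. D - real (deg E S w) * x w)"
    using deg_le_card[OF fin(1)] x0 unfolding D_def by (intro sum_mono) (simp add: mult_right_mono)
  finally have Dt: "D * t \<le> 2 * ?k * ?n - z\<^sup>2" using defect Mh_le by linarith
  have "494 / 1000 * ?n * t \<le> D * t" using L_pos L_le_D t0 by (intro mult_right_mono) auto
  hence a: "494 / 1000 * (?n * t) \<le> 2 * ?k * ?n - z\<^sup>2" using Dt by (simp add: mult.assoc)
  have b: "0 \<le> ?n * t" using t0 by simp
  have "q \<le> 2025 / 1000 * W" if "494 / 1000 * q \<le> W" "0 \<le> q" for q W :: real using that by linarith
  from this[OF a b] have nt: "?n * t \<le> 2025 / 1000 * (2 * ?k * ?n - z\<^sup>2)" .
  have "sqn x {..<n} \<ge> (\<Sum>v<n. 2 * x v - 1)"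
    unfolding sqn_def
  proof (rule sum_mono)
    fix v show "2 * x v - 1 \<le> (x v)\<^sup>2" using zero_le_power2[of "x v - 1"] by (simp add: power2_eq_square algebra_simps)
  qed
  moreover have "(\<Sum>v<n. 2 * x v - 1) = 2 * sum x {..<n} - ?n" by (simp add: sum_subtractf sum_distrib_left)
  moreover have "sum x {..<n} = L + sum x T"
    unfolding L_eq_sum V_ST(1) using fin V_ST(2) by (intro sum.union_disjoint)
  moreover have "t = ?n - D - sum x T" unfolding t_def by (simp add: sum_subtractf card_T)
  moreover have "D = ?n / 2 + ?k + z" unfolding z_def by simp
  ultimately have "sqn x {..<n} \<ge> ?n - 2 * z - 4 * ?k - 2 * t" using L_ge by linarith
  hence "?n * (?n - 2 * z - 4 * ?k - 2 * t) \<le> ?n * sqn x {..<n}" by (intro mult_left_mono) auto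
  hence V: "?n * ?n - 2 * (?n * z) - 4 * ?k * ?n - 4050 / 1000 * (2 * ?k * ?n - z\<^sup>2) \<le> ?n * sqn x {..<n}"
    using nt by (simp add: algebra_simps)
  have "sqn x rest \<le> real (card rest) * (6475 / 10000)"
    unfolding sqn_def using rest_x_square(1) by (intro sum_bounded_above) auto
  hence "?n * sqn x rest \<le> ?n * (real (card rest) * (6475 / 10000))" by (intro mult_left_mono) auto
  hence R: "?n * sqn x rest \<le> 6475 / 10000 * (24 * ?k * ?n - 12 * z\<^sup>2)" using rest_card by (simp add: algebra_simps)
  have "{..<n} = (A \<union> B) \<union> rest" "(A \<union> B) \<inter> rest = {}" using AB(1,2) unfolding rest_def by auto
  hence e: "sqn x {..<n} = sqn x (A \<union> B) + sqn x rest" using finAB by (simp add: sqn_Un)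
  \<comment> \<open>The factor 11.8 lies just below 4.05 + 7.77, the total coefficient of
    \<open>z\<^sup>2\<close> in the bounds for \<open>T\<close> and for the remainder. What is left
    is 1 - 1/11.8 - 27.64/187, which exceeds 0.767.\<close>
  have sq: "0 \<le> 13924 / 100 * z\<^sup>2 - 236 / 10 * (?n * z) + ?n * ?n"
    using zero_le_power2[of "118 / 10 * z - ?n"] by (simp add: power2_eq_square algebra_simps)
  have kn: "?n * (187 * ?k) \<le> ?n * ?n" using nR by (intro mult_left_mono) auto
  have "?n * (767 / 1000 * ?n) \<le> ?n * sqn x (A \<union> B)"
  proof -
    have num: "767 / 1000 * nn \<le> sa"
      if "nn - 2 * nz - 4 * kn - 4050 / 1000 * (2 * kn - zz) \<le> sa + sr" "sr \<le> 6475 / 10000 * (24 * kn - 12 * zz)"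
        "0 \<le> 13924 / 100 * zz - 236 / 10 * nz + nn" "187 * kn \<le> nn" "0 \<le> zz" "0 \<le> nn" for nn nz kn zz sa sr :: real
    proof -
      have "nn - 2 * nz - 4 * kn - (81 / 10 * kn - 405 / 100 * zz) \<le> sa + sr" using that(1) by (simp add: field_simps)
      moreover have "sr \<le> 1554 / 100 * kn - 777 / 100 * zz" using that(2) by (simp add: field_simps)
      ultimately show ?thesis using that(3-6) by linarith
    qed
    have "767 / 1000 * (?n * ?n) \<le> ?n * sqn x (A \<union> B)"
      using V R sq kn unfolding e by (intro num[of _ "?n * z" "?k * ?n" "z\<^sup>2" _ "?n * sqn x rest"]) (simp_all add: algebra_simps)
    thus ?thesis by simp
  qed
  thus ?thesis using nR by simp
qed

text \<open>Every vertex outside the bipartite part and the exceptional set \<open>P\<close> costs more than it contributes.\<close>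
lemma quant:
  fixes r0 :: nat and C :: real
  assumes part: "A1 \<union> B1 \<union> P \<union> R1 = {..<n}" "A1 \<inter> B1 = {}" "(A1 \<union> B1) \<inter> P = {}" "(A1 \<union> B1 \<union> P) \<inter> R1 = {}"
    and R1: "R1 \<subseteq> rest" and card: "card A1 + card B1 + r0 + 1 \<le> n" "card A1 + card B1 + r0 + card R1 \<le> n"
    and L: "(real n - real r0) / 2 - 1 / 50 \<le> L"
    and sq: "sqn x (A \<union> B) - 1 \<le> sqn x (A1 \<union> B1)"
    and C: "C \<le> 4 * real k"
    and form: "qf E x (A1 \<union> B1 \<union> P) (A1 \<union> B1 \<union> P) \<le> 2 * (sum x A1 * sum x B1) + C + L * sqn x P"
  shows False
proof -
  let ?Y = "A1 \<union> B1 \<union> P" and ?n = "real n"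
  have f: "finite A1" "finite B1" "finite P" "finite R1"
    by (rule finite_subset[of _ "{..<n}"]; use part(1) in blast)+
  have rn: "v < n" if "v \<in> R1" for v using that part(1) by blast
  have V: "{..<n} = ?Y \<union> R1" using part(1) by blast
  have fY: "finite ?Y" using f by simp
  have "L * sqn x {..<n} = qf E x {..<n} {..<n}" using eig by (intro qf_eigen[symmetric]) auto
  also have "\<dots> = qf E x ?Y ?Y + 2 * qf E x ?Y R1 + qf E x R1 R1"
    unfolding V using fY f part(4) by (intro qf_Un_square[OF G])
  finally have 1: "L * sqn x {..<n} = qf E x ?Y ?Y + 2 * qf E x ?Y R1 + qf E x R1 R1" .
  have "L * sqn x R1 = qf E x R1 {..<n}" using eig rn by (intro qf_eigen[symmetric]) auto
  also have "\<dots> = qf E x R1 ?Y + qf E x R1 R1" unfolding V using fY f part(4) by (intro qf_Un_right)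
  also have "qf E x R1 ?Y = qf E x ?Y R1" by (rule qf_commute[OF G])
  finally have 2: "L * sqn x R1 = qf E x ?Y R1 + qf E x R1 R1" .
  have 3: "0 \<le> qf E x R1 R1" using x0 by (rule qf_nonneg)
  have "sqn x {..<n} = sqn x ?Y + sqn x R1" unfolding V using fY f part(4) by (intro sqn_Un)
  also have "sqn x ?Y = sqn x (A1 \<union> B1) + sqn x P" using f part(3) by (intro sqn_Un) auto
  finally have "L * sqn x {..<n} = L * sqn x (A1 \<union> B1) + L * sqn x P + L * sqn x R1" by (simp add: algebra_simps)
  hence 4: "L * sqn x (A1 \<union> B1) \<le> 2 * (sum x A1 * sum x B1) + C + L * sqn x R1"
    using 1 2 3 form by linarith
  have "2 * (sum x A1 * sum x B1) \<le> (real (card A1) + real (card B1)) / 2 * (sqn x A1 + sqn x B1)"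
    using f x0 by (intro two_sums_le)
  also have "sqn x A1 + sqn x B1 = sqn x (A1 \<union> B1)" using f part(2) by (intro sqn_Un[symmetric])
  finally have "2 * (sum x A1 * sum x B1) \<le> (real (card A1) + real (card B1)) / 2 * sqn x (A1 \<union> B1)" .
  hence 5: "(L - (real (card A1) + real (card B1)) / 2) * sqn x (A1 \<union> B1) \<le> C + L * sqn x R1"
    unfolding left_diff_distrib using 4 by linarith
  \<comment> \<open>The number of vertices missing from the classes beyond \<open>r0\<close>; it
    also bounds the number of surplus vertices. As \<open>rho\<close> is at least 1, the error 1/50
    turns \<open>rho / 2\<close> into at worst \<open>48 / 100 * rho\<close>.\<close>
  define rho where "rho = ?n - real r0 - (real (card A1) + real (card B1))"
  have "real (card A1 + card B1 + r0 + 1) \<le> real n" "real (card A1 + card B1 + r0 + card R1) \<le> real n"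
    using card by (simp_all only: of_nat_le_iff)
  hence rho: "1 \<le> rho" "real (card R1) \<le> rho" unfolding rho_def by simp_all
  have "(real (card A1) + real (card B1)) = ?n - real r0 - rho" unfolding rho_def by simp
  moreover have "48 / 100 * q \<le> l - t / 2" if "s / 2 - 1 / 50 \<le> l" "1 \<le> q" "t = s - q" for l q s t :: real
    using that by linarith
  ultimately have "48 / 100 * rho \<le> L - (real (card A1) + real (card B1)) / 2" using L rho(1) by blast
  hence "48 / 100 * rho * sqn x (A1 \<union> B1) \<le> (L - (real (card A1) + real (card B1)) / 2) * sqn x (A1 \<union> B1)"
    by (rule mult_right_mono) simp
  hence "48 / 100 * rho * sqn x (A1 \<union> B1) \<le> C + L * sqn x R1"
    using 5 by (rule order_trans)
  moreover have "L * sqn x R1 \<le> rho * (3203 / 10000 * ?n)"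
  proof -
    have "L * sqn x R1 = (\<Sum>v\<in>R1. L * (x v)\<^sup>2)" unfolding sqn_def sum_distrib_left ..
    also have "\<dots> \<le> real (card R1) * (3203 / 10000 * ?n)"
      using R1 rest_x_square(2) by (intro sum_bounded_above) auto
    also have "\<dots> \<le> rho * (3203 / 10000 * ?n)" using rho by (intro mult_right_mono) auto
    finally show ?thesis .
  qed
  moreover have "48 / 100 * rho * (767 / 1000 * ?n - 1) \<le> 48 / 100 * rho * sqn x (A1 \<union> B1)"
    using sq sqn_AB rho by (intro mult_left_mono) auto
  ultimately have "rho * (48 / 100 * (767 / 1000 * ?n - 1) - 3203 / 10000 * ?n) \<le> C" by (simp add: algebra_simps)
  \<comment> \<open>Here \<open>n\<close> at least \<open>187 * k\<close> enters: 0.36816 - 0.3203 =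
    0.04786, and 187 times this is above 8, which covers \<open>4 * k\<close> and the
    constants.\<close>
  moreover have "4 * real k + 1 / 10 \<le> 48 / 100 * (767 / 1000 * ?n - 1) - 3203 / 10000 * ?n" 
  proof -
    have "4 * real k + 1 / 10 \<le> 36816 / 100000 * ?n - 48 / 100 - 3203 / 10000 * ?n" using nR by linarith
    thus ?thesis by (simp add: field_simps)
  qed
  moreover have False if "rho * W \<le> C" "q \<le> W" "C < q" "0 \<le> q" for W q :: real
  proof -
    have "1 * W \<le> rho * W" using rho(1) that by (intro mult_right_mono) auto
    thus False using that by simp
  qed
  ultimately show False using C nR by fastforce
qed

end

section \<open>Bounding the quadratic form of a graph of shape \<open>typeS\<close>\<close>

lemma typeSI:
  assumes "A \<union> B \<union> set ps \<subseteq> {..<n}" "A \<inter> B = {}" "set ps \<inter> (A \<union> B) = {}" "distinct ps" "ps \<noteq> []"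
    "\<And>u v. u \<in> A \<Longrightarrow> v \<in> A \<Longrightarrow> \<not> E u v" "\<And>u v. u \<in> B \<Longrightarrow> v \<in> B \<Longrightarrow> \<not> E u v"
    "\<And>p a. p \<in> set ps \<Longrightarrow> a \<in> A \<Longrightarrow> E p a \<Longrightarrow> p = hd ps" "\<And>p b. p \<in> set ps \<Longrightarrow> b \<in> B \<Longrightarrow> E p b \<Longrightarrow> p = last ps"
    "\<And>a b. a \<in> A \<Longrightarrow> b \<in> B \<Longrightarrow> E (hd ps) a \<Longrightarrow> E (last ps) b \<Longrightarrow> \<not> E a b"
    "\<exists>a\<in>A. E (hd ps) a" "\<exists>b\<in>B. E (last ps) b"
  shows "typeS n E A B ps"
  unfolding typeS_def using assms by (intro conjI ballI impI) (assumption | blast)+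

text \<open>When \<open>last ps\<close> outweighs all neighbours of \<open>hd ps\<close> in
  \<open>A\<close> together, the missing edges do not pay for its many edges to \<open>B\<close>. It
  then joins \<open>A\<close> in place of one such neighbour \<open>a\<close>, and its large
  contribution becomes part of the product of the class sums. The exchange lowers the squared norm
  of the classes by at most 1.\<close>

lemma typeS_form_swap:
  assumes G: "simple_graph n E" and S: "typeS n E A B ps" and x: "\<And>v. 0 \<le> x v" "\<And>v. x v \<le> 1"
    and sw: "sum x {a\<in>A. E (hd ps) a} < x (last ps)" "x (hd ps) \<le> sum x {b\<in>B. E (last ps) b}"
  shows "\<exists>A1 P1. A1 \<union> B \<union> P1 = A \<union> B \<union> set ps \<and> A1 \<inter> B = {} \<and> (A1 \<union> B) \<inter> P1 = {} \<and> card A1 = card A \<and>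
    sqn x (A \<union> B) - 1 \<le> sqn x (A1 \<union> B) \<and>
    qf E x (A \<union> B \<union> set ps) (A \<union> B \<union> set ps) \<le> 2 * (sum x A1 * sum x B) + (2 * real (length ps) + 2) + real (length ps) * sqn x P1"
proof -
  let ?c = "hd ps" and ?d = "last ps" and ?P = "set ps"
  let ?A = "{a\<in>A. E ?c a}" and ?B = "{b\<in>B. E ?d b}"
  note fin = typeS_finite[OF G S] and SD = typeSD[OF S]
  obtain a where a: "a \<in> A" "E ?c a" using SD(11) by blast
  have dA: "?d \<notin> A" "?d \<notin> B" "a \<notin> ?P" "a \<notin> B" "a \<noteq> ?d" using fin a by auto
  define A1 where "A1 = insert ?d (A - {a})"
  define P1 where "P1 = insert a (?P - {?d})"
  have aA: "x a \<le> sum x ?A" using a fin x(1) by (intro member_le_sum) auto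
  have sA1: "sum x A1 = sum x A - x a + x ?d" unfolding A1_def using fin dA a by (simp add: sum_diff1)
  have BB: "sum x ?B \<le> sum x B" using fin x(1) by (intro sum_mono2) auto
  have sq1: "sqn x A1 = sqn x A - (x a)\<^sup>2 + (x ?d)\<^sup>2" unfolding A1_def sqn_def using fin dA a by (simp add: sum_diff1)
  have xa1: "(x a)\<^sup>2 \<le> 1" using x by (simp add: power_le_one)
  have sets: "A1 \<union> B \<union> P1 = A \<union> B \<union> ?P" "A1 \<inter> B = {}" "(A1 \<union> B) \<inter> P1 = {}"
    using fin dA a unfolding A1_def P1_def by auto
  have cA1: "card A1 = card A" unfolding A1_def using fin dA a card_Suc_Diff1[OF fin(1) a(1)] by simp
  have finA1: "finite A1" unfolding A1_def using fin by simp
  have sqAB: "sqn x (A \<union> B) - 1 \<le> sqn x (A1 \<union> B)"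
  proof -
    have "sqn x (A1 \<union> B) = sqn x A1 + sqn x B" using fin finA1 sets(2) by (intro sqn_Un)
    moreover have "sqn x (A \<union> B) = sqn x A + sqn x B" using fin by (intro sqn_Un)
    moreover have "0 \<le> (x ?d)\<^sup>2" by simp
    ultimately show ?thesis using xa1 sq1 by linarith
  qed
  have P: "?P = (?P - {?d}) \<union> {?d}" using fin by auto
  have "qf E x ?P ?P = qf E x (?P - {?d}) (?P - {?d}) + 2 * qf E x (?P - {?d}) {?d} + qf E x {?d} {?d}"
    by (subst (1 2) P, rule qf_Un_square[OF G]) auto
  also have "qf E x {?d} {?d} = 0" using simple_graph_irrefl[OF G] by (intro qf_eq_0) auto
  also have "qf E x (?P - {?d}) {?d} \<le> sum x (?P - {?d}) * sum x {?d}" using x by (intro qf_le_sum_mult) auto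
  also have "\<dots> \<le> real (length ps) * 1"
  proof (rule mult_mono)
    have "sum x (?P - {?d}) \<le> real (card (?P - {?d})) * 1" using x by (intro sum_bounded_above) auto
    also have "\<dots> \<le> real (length ps)" using card_length[of ps] card_Diff1_le[of ?P ?d] by simp
    finally show "sum x (?P - {?d}) \<le> real (length ps)" .
  qed (use x in \<open>auto intro: sum_nonneg\<close>)
  also have "qf E x (?P - {?d}) (?P - {?d}) \<le> real (card (?P - {?d})) * sqn x (?P - {?d})"
    using x by (intro qf_square_le) auto
  also have "\<dots> \<le> real (length ps) * sqn x P1"
  proof (rule mult_mono)
    show "real (card (?P - {?d})) \<le> real (length ps)" using card_length[of ps] card_Diff1_le[of ?P ?d] by simp
    show "sqn x (?P - {?d}) \<le> sqn x P1" unfolding sqn_def P1_def by (intro sum_mono2) auto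
  qed auto
  finally have qP: "qf E x ?P ?P \<le> real (length ps) * sqn x P1 + 2 * real (length ps)" by simp
  have "(x ?d - x a) * sum x ?B \<le> (x ?d - x a) * sum x B" using BB aA sw by (intro mult_left_mono) auto
  moreover have "x a * sum x ?B \<le> sum x ?A * sum x ?B" using aA x by (intro mult_right_mono) (auto intro: sum_nonneg)
  moreover have "x ?c * sum x ?A \<le> 1 * 1"
    using sw(1) x(1) x(2)[of ?c] x(2)[of ?d] by (intro mult_mono) (auto intro: sum_nonneg)
  moreover have "qf E x A B \<le> sum x A * sum x B - sum x ?A * sum x ?B" by (rule qf_AB_le[OF G S x(1)])
  ultimately have "2 * qf E x A B + 2 * x ?c * sum x ?A + 2 * x ?d * sum x ?B \<le> 2 * (sum x A1 * sum x B) + 2"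
    unfolding sA1 by (simp add: algebra_simps)
  hence "qf E x (A \<union> B \<union> ?P) (A \<union> B \<union> ?P) \<le> 2 * (sum x A1 * sum x B) + (2 * real (length ps) + 2) + real (length ps) * sqn x P1"
    unfolding qf_typeS[OF G S, of x] using qP by simp
  thus ?thesis using sets cA1 sqAB by blast
qed

text \<open>Write \<open>c\<close>, \<open>d\<close> for the weights of the path ends and
  \<open>A\<close>, \<open>B\<close> for the sums over their class neighbours. The gain over a
  complete bipartite graph is \<open>c * A + d * B - A * B\<close>, which equals
  \<open>c * d - (A - d) * (B - c)\<close>. It is bounded unless the two factors have opposite
  signs, and then the exchange of a path end with a class vertex applies.\<close>

lemma typeS_form:
  assumes G: "simple_graph n E" and S: "typeS n E A B ps" and x: "\<And>v. 0 \<le> x v" "\<And>v. x v \<le> 1"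
  shows "\<exists>A1 B1 P1. A1 \<union> B1 \<union> P1 = A \<union> B \<union> set ps \<and> A1 \<inter> B1 = {} \<and> (A1 \<union> B1) \<inter> P1 = {} \<and>
    card A1 = card A \<and> card B1 = card B \<and> sqn x (A \<union> B) - 1 \<le> sqn x (A1 \<union> B1) \<and>
    qf E x (A \<union> B \<union> set ps) (A \<union> B \<union> set ps) \<le> 2 * (sum x A1 * sum x B1) + (2 * real (length ps) + 2) + real (length ps) * sqn x P1"
proof -
  let ?c = "hd ps" and ?d = "last ps" and ?P = "set ps"
  let ?A = "{a\<in>A. E ?c a}" and ?B = "{b\<in>B. E ?d b}"
  note fin = typeS_finite[OF G S] and SD = typeSD[OF S]
  have hl: "hd (rev ps) = ?d" "last (rev ps) = ?c" using SD(5) by (simp_all add: hd_rev last_rev)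
  have len1: "1 \<le> real (length ps)" using SD(5) by (cases ps) auto
  have case12: ?thesis if gain: "x ?c * sum x ?A + x ?d * sum x ?B - sum x ?A * sum x ?B \<le> 2"
  proof -
    have "qf E x ?P ?P \<le> real (card ?P) * sqn x ?P" using x by (intro qf_square_le) auto
    also have "\<dots> \<le> real (length ps) * sqn x ?P" by (intro mult_right_mono) (simp_all add: card_length)
    finally have "qf E x (A \<union> B \<union> ?P) (A \<union> B \<union> ?P) \<le> 2 * (sum x A * sum x B) + (2 * real (length ps) + 2) + real (length ps) * sqn x ?P"
      unfolding qf_typeS[OF G S, of x] using qf_AB_le[OF G S, of x, OF x(1)] gain len1 by simp
    thus ?thesis using fin SD(2,3) by (intro exI[of _ A] exI[of _ B] exI[of _ ?P]) auto
  qed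
  have s0: "0 \<le> sum x ?A" "0 \<le> sum x ?B" using x(1) by (auto intro: sum_nonneg)
  have cd1: "x ?c * x ?d \<le> 1" using x by (simp add: mult_le_one)
  consider (a) "x ?d \<le> sum x ?A" "x ?c \<le> sum x ?B" | (b) "sum x ?A \<le> x ?d" "sum x ?B \<le> x ?c"
    | (c) "sum x ?A < x ?d" "x ?c \<le> sum x ?B" | (d) "sum x ?B < x ?c" "x ?d \<le> sum x ?A" by linarith
  thus ?thesis
  proof cases
    case a
    hence "0 \<le> (sum x ?A - x ?d) * (sum x ?B - x ?c)" by simp
    thus ?thesis using cd1 by (intro case12) (simp add: algebra_simps)
  next
    case b
    have "x ?c * sum x ?A \<le> x ?c * x ?d" using b x by (intro mult_left_mono) auto
    moreover have "x ?d * sum x ?B \<le> x ?d * x ?c" using b x by (intro mult_left_mono) auto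
    moreover have "0 \<le> sum x ?A * sum x ?B" using s0 by simp
    moreover have "x ?d * x ?c = x ?c * x ?d" by simp
    ultimately show ?thesis using cd1 by (intro case12) linarith
  next
    case c
    from typeS_form_swap[OF G S x c] show ?thesis by blast
  next
    case d
    from typeS_form_swap[OF G typeS_swap[OF G S] x, unfolded hl set_rev length_rev, OF d]
    obtain B1 P1 where "B1 \<union> A \<union> P1 = B \<union> A \<union> ?P" "B1 \<inter> A = {}" "(B1 \<union> A) \<inter> P1 = {}" "card B1 = card B"
      "sqn x (B \<union> A) - 1 \<le> sqn x (B1 \<union> A)"
      "qf E x (B \<union> A \<union> ?P) (B \<union> A \<union> ?P) \<le> 2 * (sum x B1 * sum x A) + (2 * real (length ps) + 2) + real (length ps) * sqn x P1"
      by blast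
    thus ?thesis
      by (intro exI[of _ A] exI[of _ B1] exI[of _ P1]) (simp add: Un_commute Int_commute mult.commute)
  qed
qed

section \<open>Excluding surplus vertices for each kind of obstruction\<close>

context perron_graph
begin

lemma V_eq: "{..<n} = A \<union> B \<union> rest" "(A \<union> B) \<inter> rest = {}"
  using AB(1,2) unfolding rest_def by auto

lemma card_V: "card A + card B + card rest = n"
proof -
  have "n = card (A \<union> B \<union> rest)" using V_eq(1) by (metis card_lessThan)
  also have "\<dots> = card (A \<union> B) + card rest" using finAB V_eq(2) by (intro card_Un_disjoint) auto
  also have "card (A \<union> B) = card A + card B" using finAB AB(3) by (intro card_Un_disjoint) auto
  finally show ?thesis by simp
qed

text \<open>Serves obstructions that barely touch the classes: the form inside \<open>R0\<close> is
  at most \<open>card R0\<close> times its squared norm, and \<open>card R0\<close> is at most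
  \<open>L\<close>.\<close>

lemma quant_R0:
  assumes R0: "R0 \<subseteq> rest" and att: "qf E x (A \<union> B) R0 \<le> 2" and c: "r0 \<le> card R0" "r0 + 1 \<le> card rest"
    and L: "(real n - real r0) / 2 - 1 / 50 \<le> L"
  shows False
proof (rule quant[of A B R0 "rest - R0" r0 4])
  have fR: "finite R0" using R0 finAB finite_subset by blast
  have "card (rest - R0) = card rest - card R0" using R0 fR by (intro card_Diff_subset)
  thus "card A + card B + r0 + card (rest - R0) \<le> n" "card A + card B + r0 + 1 \<le> n"
    using c card_V by linarith+
  show "A \<union> B \<union> R0 \<union> (rest - R0) = {..<n}" using V_eq R0 by auto
  show "A \<inter> B = {}" "(A \<union> B) \<inter> R0 = {}" "(A \<union> B \<union> R0) \<inter> (rest - R0) = {}" using AB(3) V_eq(2) R0 by auto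
  show "4 \<le> 4 * real k" using nR by simp
  have "qf E x (A \<union> B \<union> R0) (A \<union> B \<union> R0) = qf E x (A \<union> B) (A \<union> B) + 2 * qf E x (A \<union> B) R0 + qf E x R0 R0"
    using finAB fR V_eq(2) R0 by (intro qf_Un_square[OF G]) auto
  also have "qf E x (A \<union> B) (A \<union> B) = qf E x A A + 2 * qf E x A B + qf E x B B"
    using finAB AB(3) by (intro qf_Un_square[OF G]) auto
  also have "qf E x A A = 0" using indep by (intro qf_eq_0) auto
  also have "qf E x B B = 0" using indep by (intro qf_eq_0) auto
  also have "qf E x A B \<le> sum x A * sum x B" using finAB x0 by (intro qf_le_sum_mult) auto
  also have "qf E x R0 R0 \<le> real (card R0) * sqn x R0" using fR x0 by (intro qf_square_le)
  also have "\<dots> \<le> L * sqn x R0"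
  proof (rule mult_right_mono)
    have "card R0 \<le> card rest" using R0 finAB by (intro card_mono)
    thus "real (card R0) \<le> L" using rest_card_L by linarith
  qed simp
  finally show "qf E x (A \<union> B \<union> R0) (A \<union> B \<union> R0) \<le> 2 * (sum x A * sum x B) + 4 + L * sqn x R0"
    using att by simp
qed (use L in auto)

text \<open>Combines \<open>typeS_form\<close> with \<open>quant\<close>. The error
  \<open>2 * length ps + 2\<close> is exactly \<open>4 * k\<close>, the amount that
  \<open>quant\<close> tolerates.\<close>

lemma quant_S:
  assumes S: "typeS n E A2 B2 ps" and len: "length ps = 2 * k - 1"
    and R1: "R1 \<subseteq> rest" and part: "A2 \<union> B2 \<union> set ps \<union> R1 = {..<n}" "(A2 \<union> B2 \<union> set ps) \<inter> R1 = {}"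
    and sq: "sqn x (A \<union> B) \<le> sqn x (A2 \<union> B2)" and r0: "r0 \<le> 2 * k - 1" and c: "card A2 + card B2 + r0 + 1 \<le> n"
    and L: "(real n - real r0) / 2 - 1 / 50 \<le> L"
  shows False
proof -
  obtain A1 B1 P1 where r: "A1 \<union> B1 \<union> P1 = A2 \<union> B2 \<union> set ps" "A1 \<inter> B1 = {}" "(A1 \<union> B1) \<inter> P1 = {}"
    "card A1 = card A2" "card B1 = card B2" "sqn x (A2 \<union> B2) - 1 \<le> sqn x (A1 \<union> B1)"
    "qf E x (A2 \<union> B2 \<union> set ps) (A2 \<union> B2 \<union> set ps) \<le> 2 * (sum x A1 * sum x B1) + (2 * real (length ps) + 2) + real (length ps) * sqn x P1"
    using typeS_form[where x = x, OF G S x0 x1] by (elim exE conjE) (rule that)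
  note SD = typeSD[OF S] and f = typeS_finite[OF G S]
  have fR: "finite R1" using R1 finAB finite_subset by blast
  have cc: "card A2 + card B2 + (2 * k - 1) + card R1 = n"
  proof -
    have "card (A2 \<union> B2 \<union> set ps \<union> R1) = card (A2 \<union> B2 \<union> set ps) + card R1"
      using f fR part(2) by (intro card_Un_disjoint) auto
    also have "card (A2 \<union> B2 \<union> set ps) = card (A2 \<union> B2) + card (set ps)" using f by (intro card_Un_disjoint) auto
    also have "card (A2 \<union> B2) = card A2 + card B2" using f by (intro card_Un_disjoint) auto
    also have "card (set ps) = 2 * k - 1" using SD(4) len by (simp add: distinct_card)
    finally show ?thesis unfolding part(1) by simp
  qed
  have lenr: "real (length ps) = 2 * real k - 1" unfolding len using k1 by (simp add: of_nat_diff)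
  show False
  proof (rule quant[of A1 B1 P1 R1 r0 "2 * real (length ps) + 2"])
    show "A1 \<union> B1 \<union> P1 \<union> R1 = {..<n}" "(A1 \<union> B1 \<union> P1) \<inter> R1 = {}" unfolding r(1) using part by auto
    show "card A1 + card B1 + r0 + 1 \<le> n" "card A1 + card B1 + r0 + card R1 \<le> n" using r cc c r0 by linarith+
    show "sqn x (A \<union> B) - 1 \<le> sqn x (A1 \<union> B1)" using r(6) sq by linarith
    show "2 * real (length ps) + 2 \<le> 4 * real k" using lenr by simp
    have "real (length ps) * sqn x P1 \<le> L * sqn x P1"
      using lenr L_pos nR by (intro mult_right_mono) auto
    thus "qf E x (A1 \<union> B1 \<union> P1) (A1 \<union> B1 \<union> P1) \<le> 2 * (sum x A1 * sum x B1) + (2 * real (length ps) + 2) + L * sqn x P1"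
      unfolding r(1) using r(7) by linarith
    show "A1 \<inter> B1 = {}" "(A1 \<union> B1) \<inter> P1 = {}" by (fact r(2), fact r(3))
    show "(real n - real r0) / 2 - 1 / 50 \<le> L" by (fact L)
    show "R1 \<subseteq> rest" by (fact R1)
  qed
qed

text \<open>A vertex of the remainder has no majority in either core set, so at least half of each
  is not adjacent to it. Two nonneighbours are what the strict switching of
  \<open>typeS_exact\<close> uses.\<close>

lemma many_nonneighbours:
  assumes "v \<in> rest"
  shows "2 \<le> card {a\<in>A. \<not> E v a}" "2 \<le> card {b\<in>B. \<not> E v b}"
proof -
  have c: "4 \<le> card A0" "4 \<le> card B0" using core0 unfolding core_def by auto
  have "v < n" "v \<notin> A" "v \<notin> B" using assms unfolding rest_def by auto
  hence "\<not> maj E B0 v" "\<not> maj E A0 v" unfolding A_def B_def by auto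
  hence "card A0 \<le> 2 * card {a\<in>A0. \<not> E v a}" "card B0 \<le> 2 * card {b\<in>B0. \<not> E v b}"
    using card_split_pred[OF sub0(3), of "E v"] card_split_pred[OF sub0(4), of "E v"] unfolding maj_def by linarith+
  moreover have "card {a\<in>A0. \<not> E v a} \<le> card {a\<in>A. \<not> E v a}" "card {b\<in>B0. \<not> E v b} \<le> card {b\<in>B. \<not> E v b}"
    using core_in finAB by (auto intro!: card_mono)
  ultimately show "2 \<le> card {a\<in>A. \<not> E v a}" "2 \<le> card {b\<in>B. \<not> E v b}" using c by linarith+
qed

lemma card_AB_2: "2 \<le> card A" "2 \<le> card B"
proof -
  have c: "4 \<le> card A0" "4 \<le> card B0" using core0 unfolding core_def by auto
  have "card A0 \<le> card A" "card B0 \<le> card B" using core_in finAB by (auto intro!: card_mono)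
  thus "2 \<le> card A" "2 \<le> card B" using c by linarith+
qed

context
  fixes N :: nat
  assumes least: "\<forall>ws. odd_str ws \<longrightarrow> N \<le> length ws"
begin

lemma induced_path:
  assumes ws: "odd_str ws" "length ws = N" and cl: "odd N \<Longrightarrow> \<not> E (last ws) (hd ws)"
    and uv: "v \<in> set ws" "w \<in> set ws"
  shows "E v w \<longleftrightarrow> path_edge ws v w"
proof
  have ne: "ws \<noteq> []" and suc: "successively E ws" using ws unfolding odd_str_def closed_odd_def bad_ear_def rwalk_def by auto
  assume "path_edge ws v w"
  thus "E v w" using suc sE unfolding path_edge_def by (auto simp: successively_conv_nth)
next
  assume e: "E v w"
  have ne: "ws \<noteq> []" using ws unfolding odd_str_def closed_odd_def bad_ear_def rwalk_def by auto
  obtain i j where ij: "i < N" "j < N" "v = ws ! i" "w = ws ! j" using uv ws(2) by (metis in_set_conv_nth)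
  have *: "j = Suc i" if "i < j" "j < N" "E (ws ! i) (ws ! j)" for i j
  proof -
    have "j = Suc i \<or> (i = 0 \<and> j = N - 1 \<and> odd N)" by (rule no_chord[OF least ws that])
    moreover have "\<not> (i = 0 \<and> j = N - 1 \<and> odd N)"
    proof
      assume a: "i = 0 \<and> j = N - 1 \<and> odd N"
      have "hd ws = ws ! 0" "last ws = ws ! (N - 1)" using ne ws(2) by (simp_all add: hd_conv_nth last_conv_nth)
      hence "E (last ws) (hd ws)" using that(3) a sE by metis
      thus False using cl a by blast
    qed
    ultimately show ?thesis by blast
  qed
  have "i \<noteq> j" using e ij irr by auto
  then consider "i < j" | "j < i" by linarith
  thus "path_edge ws v w"
  proof cases
    case 1
    hence "j = Suc i" using * ij e by blast
    thus ?thesis unfolding path_edge_def using ij ws(2) by auto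
  next
    case 2
    hence "i = Suc j" using *[of j i] ij e sE by blast
    thus ?thesis unfolding path_edge_def using ij ws(2) by auto
  qed
qed

lemma ear_attached_ends:
  assumes ear: "bad_ear v ws w" and len: "length ws = N" and p: "p \<in> set ws" and q: "q \<in> A \<union> B" "E p q"
  shows "p = hd ws \<or> p = last ws"
proof (rule ccontr)
  assume neg: "\<not> ?thesis"
  have ne: "ws \<noteq> []" using ear unfolding bad_ear_def rwalk_def by blast
  obtain i where i: "i < N" "p = ws ! i" using p len by (metis in_set_conv_nth)
  have "hd ws = ws ! 0" "last ws = ws ! (N - 1)" using ne len by (simp_all add: hd_conv_nth last_conv_nth)
  hence "i \<noteq> 0" "i \<noteq> N - 1" using neg i(2) by metis+
  hence "0 < i" "i < N - 1" using i(1) by linarith+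
  thus False using ear_interior_unattached[OF least ear len, of i q] i q by simp
qed

lemma ear_typeS:
  assumes ear: "bad_ear v ws w" and len: "length ws = N" and N: "N = 2 * k - 1" and vw: "v \<in> A" "w \<in> B"
  shows "typeS n E A B ws"
proof -
  have os: "odd_str ws" using ear unfolding odd_str_def by blast
  have d: "distinct ws" by (rule least_distinct[OF least os len])
  have ws: "ws \<noteq> []" "set ws \<subseteq> rest" "successively E ws" and e: "E v (hd ws)" "E (last ws) w"
    using ear unfolding bad_ear_def rwalk_def by auto
  have dis: "set ws \<inter> (A \<union> B) = {}" using ws(2) V_eq(2) by auto
  have pA: "p = hd ws" if "p \<in> set ws" "a \<in> A" "E p a" for p a
  proof (cases "N \<ge> 2")
    case True
    have "p = hd ws \<or> p = last ws" using ear_attached_ends[OF ear len that(1) _ that(3)] that(2) by blast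
    moreover have "p \<noteq> last ws"
      using ear_last_side[OF least ear len True, of a] that vw AB(3) by auto
    ultimately show ?thesis by blast
  next
    \<comment> \<open>Only \<open>N = 1\<close> remains, where both ends of the ear are the same
      vertex.\<close>
    case False
    hence "length ws = 1" using len ws(1) by (cases ws) auto
    thus ?thesis using that(1) by (cases ws) auto
  qed
  have pB: "p = last ws" if "p \<in> set ws" "b \<in> B" "E p b" for p b
  proof (cases "N \<ge> 2")
    case True
    have "p = hd ws \<or> p = last ws" using ear_attached_ends[OF ear len that(1) _ that(3)] that(2) by blast
    moreover have "p \<noteq> hd ws"
      using ear_first_side[OF least ear len True, of b] that vw AB(3) by auto
    ultimately show ?thesis by blast
  next
    case False
    hence "length ws = 1" using len ws(1) by (cases ws) auto
    thus ?thesis using that(1) by (cases ws) auto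
  qed
  have nAB: "\<not> E a b" if ab: "a \<in> A" "b \<in> B" "E (hd ws) a" "E (last ws) b" for a b
  proof
    assume eab: "E a b"
    let ?c = "a # ws @ [b]"
    have "distinct ?c" using d dis ab AB(3) by auto
    moreover have "successively E ?c"
      using ws ab sE by (auto simp: successively_Cons successively_append_iff)
    moreover have "set ?c \<subseteq> {..<n}" using V_eq(1) ws(2) ab by auto
    moreover have "E (last ?c) (hd ?c)" using eab sE by simp
    moreover have "length ?c = 2 * k + 1" using len N k1 by simp
    ultimately show False using cycle_of_path by blast
  qed
  have "A \<union> B \<union> set ws \<subseteq> {..<n}" using V_eq(1) ws(2) by auto
  moreover have "\<exists>a\<in>A. E (hd ws) a" "\<exists>b\<in>B. E (last ws) b" using e vw sE by blast+
  ultimately show ?thesis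
    unfolding typeS_def using AB(3) dis d ws(1) indep pA pB nAB by blast
qed

text \<open>An ear with an even number of inner vertices starts and ends on the same side
  \<open>X\<close>. Its first vertex has class neighbours in \<open>X\<close> only, so it can be
  counted to the other side \<open>Y\<close>; the remaining \<open>2 * k - 1\<close> vertices form
  an ear between different sides. The reversal puts the end attached to \<open>X\<close>
  first.\<close>

lemma ear_absorb_typeS:
  assumes ear: "bad_ear v ws w" and len: "length ws = N" and N: "N = 2 * k"
    and XY: "X \<union> Y = A \<union> B" "X \<inter> Y = {}" "(X = A \<and> Y = B) \<or> (X = B \<and> Y = A)" and vw: "v \<in> X" "w \<in> X"
  shows "typeS n E X (insert (hd ws) Y) (rev (tl ws))"
    "\<And>y y'. y \<in> set (rev (tl ws)) \<Longrightarrow> y' \<in> set (rev (tl ws)) \<Longrightarrow> E y y' \<longleftrightarrow> path_edge (rev (tl ws)) y y'"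
    "2 \<le> card {b\<in>insert (hd ws) Y. \<not> E (last (rev (tl ws))) b}"
proof -
  have os: "odd_str ws" using ear unfolding odd_str_def by blast
  have d: "distinct ws" by (rule least_distinct[OF least os len])
  have ws: "ws \<noteq> []" "set ws \<subseteq> rest" "successively E ws" and e: "E v (hd ws)" "E (last ws) w"
    using ear unfolding bad_ear_def rwalk_def by auto
  have N2: "2 \<le> N" using N k1 by simp
  define c where "c = hd ws"
  define us where "us = tl ws"
  have wsc: "ws = c # us" unfolding c_def us_def using ws(1) by simp
  have usne: "us \<noteq> []" using len N2 unfolding wsc by auto
  have lastu: "last ws = last us" using usne unfolding wsc by simp
  have dis: "set ws \<inter> (A \<union> B) = {}" using ws(2) V_eq(2) by auto
  have XYin: "X \<subseteq> A \<union> B" "Y \<subseteq> A \<union> B" using XY(1) by auto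
  have side: "q \<in> X \<longleftrightarrow> (q \<in> A \<longleftrightarrow> v \<in> A)" if "q \<in> A \<union> B" for q using that XY vw AB(3) by auto
  have side': "q \<in> X \<longleftrightarrow> (q \<in> A \<longleftrightarrow> w \<in> A)" if "q \<in> A \<union> B" for q using that XY vw AB(3) by auto
  have cX: "q \<in> X" if "q \<in> A \<union> B" "E c q" for q
    using ear_first_side[OF least ear len N2, of q] that side unfolding c_def by auto
  have lX: "q \<in> X" if "q \<in> A \<union> B" "E (last us) q" for q
    using ear_last_side[OF least ear len N2, of q] that side' unfolding lastu by auto
  have ind: "E y y' \<longleftrightarrow> path_edge ws y y'" if "y \<in> set ws" "y' \<in> set ws" for y y'
    using induced_path[OF os len _ that] N by simp
  have cu: "c \<notin> set us" using d unfolding wsc by simp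
  have pc: "E c y \<longleftrightarrow> y = hd us" if "y \<in> set us" for y
    using ind[of c y] that path_edge_hd[of c us y] d usne unfolding wsc by simp
  have uatt: "y = last us \<and> q \<in> X" if "y \<in> set us" "q \<in> A \<union> B" "E y q" for y q
  proof -
    have "y = hd ws \<or> y = last ws" using ear_attached_ends[OF ear len _ that(2,3)] that(1) unfolding wsc by auto
    hence "y = last us" using that(1) cu lastu unfolding wsc by auto
    thus ?thesis using lX that by blast
  qed
  have hl: "hd (rev us) = last us" "last (rev us) = hd us" using usne by (simp_all add: hd_rev last_rev)
  have iX: "\<not> E y y'" if "y \<in> X" "y' \<in> X" for y y' using that XY(3) indep by blast
  have iY: "\<not> E y y'" if yy: "y \<in> insert c Y" "y' \<in> insert c Y" for y y'
  proof
    assume e: "E y y'"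
    consider "y = c" "y' = c" | "y = c" "y' \<in> Y" | "y \<in> Y" "y' = c" | "y \<in> Y" "y' \<in> Y" using yy by blast
    thus False
    proof cases
      case 1 thus ?thesis using e irr by simp
    next
      case 2 thus ?thesis using cX[of y'] e XYin XY(2) by blast
    next
      case 3 thus ?thesis using cX[of y] e XYin XY(2) sE by blast
    next
      case 4 thus ?thesis using e XY(3) indep by blast
    qed
  qed
  have pX: "y = last us" if "y \<in> set us" "q \<in> X" "E y q" for y q using uatt that XYin by blast
  have pY: "y = hd us" if "y \<in> set us" "q \<in> insert c Y" "E y q" for y q
  proof (cases "q = c")
    case True thus ?thesis using pc[OF that(1)] that(3) sE by blast
  next
    case False
    hence "q \<in> X" "q \<in> Y" using uatt[OF that(1) _ that(3)] that(2) XYin by auto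
    thus ?thesis using XY(2) by blast
  qed
  \<comment> \<open>Such a \<open>q\<close> can only be \<open>c\<close>, and an edge from
    \<open>y\<close> to \<open>c\<close> would close the list \<open>y # ws\<close> with its
    \<open>2 * k + 1\<close> vertices.\<close>
  have nc: "\<not> E y q" if "y \<in> X" "q \<in> insert c Y" "E (last us) y" "E (hd us) q" for y q
  proof
    assume e': "E y q"
    have "q \<noteq> c \<Longrightarrow> False"
    proof -
      assume "q \<noteq> c"
      hence "q \<in> X" "q \<in> Y" using uatt[of "hd us" q] that(2,4) usne XYin by auto
      thus False using XY(2) by blast
    qed
    hence "E y c" using e' by blast
    have "distinct (y # ws)" using d dis that(1) XYin by auto
    moreover have "successively E (y # ws)" using ws \<open>E y c\<close> unfolding c_def by (simp add: successively_Cons)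
    moreover have "set (y # ws) \<subseteq> {..<n}" using V_eq(1) ws(2) that(1) XYin by auto
    moreover have "E (last (y # ws)) (hd (y # ws))" using that(3) lastu ws(1) by simp
    ultimately show False using cycle_of_path[of "y # ws"] len N by simp
  qed
  have cdis: "c \<notin> A \<union> B" using dis unfolding wsc by auto
  have udis: "set us \<inter> (A \<union> B) = {}" using dis unfolding wsc by auto
  have Xd: "X \<union> insert c Y \<union> set us \<subseteq> {..<n}" using V_eq(1) ws(2) XYin unfolding wsc by auto
  have X2: "X \<inter> insert c Y = {}" "set us \<inter> (X \<union> insert c Y) = {}" using XY(2) cdis udis cu XYin by auto
  have exX: "\<exists>a\<in>X. E (last us) a" using e(2) vw lastu by auto
  have exY: "\<exists>b\<in>insert c Y. E (hd us) b" using pc[of "hd us"] usne sE by auto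
  show "typeS n E X (insert (hd ws) Y) (rev (tl ws))"
    unfolding c_def[symmetric] us_def[symmetric]
  proof (rule typeSI; (unfold hl set_rev distinct_rev rev_is_Nil_conv)?)
    show "distinct us" using d unfolding wsc by simp
  qed (fact Xd X2 usne iX iY pX pY nc exX exY)+
  show "E y y' \<longleftrightarrow> path_edge (rev (tl ws)) y y'" if "y \<in> set (rev (tl ws))" "y' \<in> set (rev (tl ws))" for y y'
  proof -
    have y: "y \<in> set us" "y' \<in> set us" using that unfolding us_def by auto
    obtain b vs where us: "us = b # vs" using usne by (cases us) auto
    have "path_edge ws y y' \<longleftrightarrow> path_edge us y y'"
      using y cu unfolding wsc us by (auto simp: path_edge_Cons)
    thus ?thesis using ind[of y y'] y unfolding path_edge_rev us_def[symmetric] wsc by simp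
  qed
  have "Y \<subseteq> {b\<in>insert c Y. \<not> E (hd us) b}"
    using uatt[of "hd us"] usne XYin XY(2) by auto
  hence "card Y \<le> card {b\<in>insert c Y. \<not> E (hd us) b}" using XY(3) finAB by (intro card_mono) auto
  thus "2 \<le> card {b\<in>insert (hd ws) Y. \<not> E (last (rev (tl ws))) b}"
    using card_AB_2 XY(3) unfolding c_def[symmetric] us_def[symmetric] hl by auto
qed

text \<open>At most one vertex of a shortest odd cycle is attached to the classes; without it the
  cycle has no contact with them. The lost vertex is the 1 in \<open>r0 + 1 \<le> N\<close>.\<close>

lemma quant_T0:
  assumes co: "closed_odd ws" and len: "length ws = N"
    and noear: "\<forall>v us w. bad_ear v us w \<longrightarrow> length us \<noteq> N"
    and r0: "r0 + 1 \<le> N" and L: "(real n - real r0) / 2 - 1 / 50 \<le> L"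
  shows False
proof -
  have os: "odd_str ws" using co unfolding odd_str_def by blast
  have d: "distinct ws" by (rule least_distinct[OF least os len])
  have wr: "set ws \<subseteq> rest" using co unfolding closed_odd_def rwalk_def by blast
  let ?X = "{p\<in>set ws. \<exists>q\<in>A \<union> B. E p q}"
  have X1: "p = p'" if pX: "p \<in> ?X" "p' \<in> ?X" for p p'
  proof (rule ccontr)
    assume ne: "p \<noteq> p'"
    obtain q q' where q: "q \<in> A \<union> B" "E p q" "q' \<in> A \<union> B" "E p' q'" using pX by blast
    obtain i j where ij: "i < N" "j < N" "p = ws ! i" "p' = ws ! j" using pX len by (auto simp: in_set_conv_nth)
    have "i \<noteq> j" using ne ij by auto
    then consider "i < j" | "j < i" by linarith
    thus False
    proof cases
      case 1 thus ?thesis using closed_odd_attached_once[OF least co len noear 1 ij(2) q(1,3)] q ij by blast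
    next
      case 2 thus ?thesis using closed_odd_attached_once[OF least co len noear 2 ij(1) q(3,1)] q ij by blast
    qed
  qed
  have cX: "card ?X \<le> 1" using X1 by (auto simp: card_le_Suc0_iff_eq)
  let ?R = "set ws - ?X"
  have "card ?R = card (set ws) - card ?X" by (intro card_Diff_subset) auto
  hence cR: "r0 \<le> card ?R" using cX r0 d len by (simp add: distinct_card)
  have "card (set ws) \<le> card rest" using wr finAB by (intro card_mono)
  hence cr: "r0 + 1 \<le> card rest" using r0 d len by (simp add: distinct_card)
  have "qf E x (A \<union> B) ?R = 0" using sE by (intro qf_eq_0) blast
  thus False using quant_R0[of ?R r0] wr cR cr L by auto
qed

text \<open>Only the two ends of the ear touch the classes, and only at \<open>a\<close>; each
  contact is worth at most 1, so the whole ear can serve as exceptional set.\<close>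

lemma quant_T1:
  assumes ear: "bad_ear a ws a" and len: "length ws = N" and N2: "2 \<le> N"
    and noear: "\<forall>v us w. bad_ear v us w \<longrightarrow> v \<noteq> w \<longrightarrow> length us \<noteq> N"
    and r0: "r0 \<le> N" "r0 + 1 \<le> card rest" and L: "(real n - real r0) / 2 - 1 / 50 \<le> L"
  shows False
proof -
  have os: "odd_str ws" using ear unfolding odd_str_def by blast
  have d: "distinct ws" by (rule least_distinct[OF least os len])
  have wr: "set ws \<subseteq> rest" using ear unfolding bad_ear_def rwalk_def by blast
  have at: "q = a \<and> (p = hd ws \<or> p = last ws)" if "p \<in> set ws" "q \<in> A \<union> B" "E p q" for p q
  proof -
    have "p = hd ws \<or> p = last ws" using ear_attached_ends[OF ear len that] .
    moreover have "q = a"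
      using closed_ear_attached_at[OF least ear len N2 noear that(2)] that(3) calculation by blast
    ultimately show ?thesis by blast
  qed
  have "qf E x (A \<union> B) (set ws) = qf E x (set ws) (A \<union> B)" by (rule qf_commute[OF G])
  also have "\<dots> \<le> (\<Sum>p\<in>set ws. if p \<in> {hd ws, last ws} then 1 else 0)"
    unfolding qf_def
  proof (rule sum_mono)
    fix p assume p: "p \<in> set ws"
    show "x p * nsum E x (A \<union> B) p \<le> (if p \<in> {hd ws, last ws} then 1 else 0)"
    proof (cases "p \<in> {hd ws, last ws}")
      case True
      have "nsum E x (A \<union> B) p \<le> sum x {a}"
      proof -
        have "nsum E x (A \<union> B) p = sum x {w\<in>A \<union> B. E p w}" using finAB by (intro nsum_eq_sum_filter) simp
        also have "\<dots> \<le> sum x {a}" using at[OF p] x0 by (intro sum_mono2) auto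
        finally show ?thesis .
      qed
      hence "x p * nsum E x (A \<union> B) p \<le> 1 * 1"
        using x1[of a] x1[of p] x0 nsum_nonneg[of x E "A \<union> B" p] by (intro mult_mono) auto
      thus ?thesis using True by simp
    next
      case False
      hence "nsum E x (A \<union> B) p = 0" using at[OF p] by (intro nsum_eq_0) blast
      thus ?thesis using False by simp
    qed
  qed
  also have "\<dots> = real (card (set ws \<inter> {hd ws, last ws}))"
    by (simp only: sum.inter_restrict[symmetric, OF finite_set]) simp
  also have "\<dots> \<le> real (card {hd ws, last ws})" by (intro of_nat_mono card_mono) auto
  also have "\<dots> \<le> 2" by (simp add: card_insert_if)
  finally have "qf E x (A \<union> B) (set ws) \<le> 2" .
  thus False using quant_R0[OF wr _ _ r0(2) L] r0(1) d len by (simp add: distinct_card)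
qed

text \<open>The ends of an open ear may have many class neighbours and are discarded; the other
  inner vertices have none. The two lost vertices account for \<open>r0 + 2 \<le> N\<close>.\<close>

lemma quant_T2:
  assumes ear: "bad_ear v ws w" and len: "length ws = N" and r0: "r0 + 2 \<le> N"
    and L: "(real n - real r0) / 2 - 1 / 50 \<le> L"
  shows False
proof -
  have os: "odd_str ws" using ear unfolding odd_str_def by blast
  have d: "distinct ws" by (rule least_distinct[OF least os len])
  have wr: "set ws \<subseteq> rest" using ear unfolding bad_ear_def rwalk_def by blast
  let ?R = "set ws - {hd ws, last ws}"
  have "card (set ws) - card {hd ws, last ws} \<le> card ?R" by (rule diff_card_le_card_Diff) simp
  moreover have "card {hd ws, last ws} \<le> 2" by (simp add: card_insert_if)
  ultimately have cR: "r0 \<le> card ?R" using r0 d len by (simp add: distinct_card)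
  have "card (set ws) \<le> card rest" using wr finAB by (intro card_mono)
  hence cr: "r0 + 1 \<le> card rest" using r0 d len by (simp add: distinct_card)
  have "qf E x (A \<union> B) ?R = 0" using sE ear_attached_ends[OF ear len] by (intro qf_eq_0) blast
  thus False using quant_R0[of ?R r0] wr cR cr L by auto
qed

end

section \<open>Case analysis on the shortest obstruction\<close>

lemma cycle_T0: "closed_odd ws \<Longrightarrow> distinct ws \<Longrightarrow> has_cycle n E (length ws)"
  unfolding closed_odd_def rwalk_def using V_eq(1) by (intro has_cycle_of_list) auto

lemma cycle_T1:
  assumes "bad_ear a ws a" "distinct ws" shows "has_cycle n E (length ws + 1)"
proof -
  have ws: "ws \<noteq> []" "set ws \<subseteq> rest" "successively E ws" "a \<in> A \<union> B" "E a (hd ws)" "E (last ws) a"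
    using assms unfolding bad_ear_def rwalk_def by auto
  have "has_cycle n E (length (a # ws))"
    using ws assms(2) V_eq by (intro has_cycle_of_list) (auto simp: successively_Cons)
  thus ?thesis by simp
qed

lemma minimal_structure:
  assumes "\<not> bipartite n E"
  obtains N where "\<forall>ws. odd_str ws \<longrightarrow> N \<le> length ws" "\<exists>ws. odd_str ws \<and> length ws = N"
proof -
  obtain ws where "odd_str ws" using not_bipartite_odd_str[OF assms] by blast
  hence "\<exists>N ws. odd_str ws \<and> length ws = N" by blast
  hence "\<exists>ws. odd_str ws \<and> length ws = (LEAST N. \<exists>ws. odd_str ws \<and> length ws = N)" by (rule LeastI_ex)
  moreover have "(LEAST N. \<exists>ws. odd_str ws \<and> length ws = N) \<le> length ws" if "odd_str ws" for ws
    using that by (intro Least_le) blast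
  ultimately show ?thesis using that by blast
qed

text \<open>Among the shortest obstructions an ear with distinct ends is preferred, then a closed
  ear, then an odd cycle; the absence of the preferred kinds is what restricts the attachments of
  the others. The last two kinds contain a cycle of length \<open>2 * s + 1\<close>, so the
  forbidden lengths give \<open>l \<le> s\<close> and \<open>s \<noteq> k\<close>.\<close>

lemma structure_cases:
  assumes nb: "\<not> bipartite n E" and l: "1 \<le> l"
    and cyc: "\<forall>i. 1 \<le> i \<and> i \<le> l - 1 \<longrightarrow> \<not> has_cycle n E (2 * i + 1)"
  obtains (ear) N v ws w where "\<forall>ws. odd_str ws \<longrightarrow> N \<le> length ws" "bad_ear v ws w" "length ws = N" "v \<noteq> w" "2 * k - 1 \<le> N"
  | (closed_ear) N s a ws where "\<forall>ws. odd_str ws \<longrightarrow> N \<le> length ws" "bad_ear a ws a" "length ws = N"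
      "\<forall>v us w. bad_ear v us w \<longrightarrow> v \<noteq> w \<longrightarrow> length us \<noteq> N" "N = 2 * s" "l \<le> s" "s \<noteq> k"
  | (closed) N s ws where "\<forall>ws. odd_str ws \<longrightarrow> N \<le> length ws" "closed_odd ws" "length ws = N"
      "\<forall>v us w. bad_ear v us w \<longrightarrow> length us \<noteq> N" "N = 2 * s + 1" "l \<le> s" "s \<noteq> k"
proof -
  obtain N where least: "\<forall>ws. odd_str ws \<longrightarrow> N \<le> length ws" and ex: "\<exists>ws. odd_str ws \<and> length ws = N"
    using minimal_structure[OF nb] by blast
  have cyc': "l \<le> s \<and> s \<noteq> k" if "has_cycle n E (2 * s + 1)" "1 \<le> s" for s
    using that cyc nocyc l by (metis One_nat_def Suc_pred le_simps(3) linorder_not_le not_less_eq_eq less_eq_Suc_le)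
  show ?thesis
  proof (cases "\<exists>v us w. bad_ear v us w \<and> v \<noteq> w \<and> length us = N")
    case True
    then obtain v ws w where ws: "bad_ear v ws w" "v \<noteq> w" "length ws = N" by blast
    have "distinct ws" using least_distinct[OF least _ ws(3)] ws(1) unfolding odd_str_def by blast
    hence "2 * k - 1 \<le> N" using ear_length[OF ws(1) _ ws(2)] ws(3) by simp
    thus ?thesis using ear[OF least ws(1,3,2)] by blast
  next
    case noear: False
    show ?thesis
    proof (cases "\<exists>a us. bad_ear a us a \<and> length us = N")
      case True
      then obtain a ws where ws: "bad_ear a ws a" "length ws = N" by blast
      have d: "distinct ws" using least_distinct[OF least _ ws(2)] ws(1) unfolding odd_str_def by blast
      have "even N" using ws unfolding bad_ear_def by blast
      then obtain s where s: "N = 2 * s" by blast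
      have "ws \<noteq> []" using ws(1) unfolding bad_ear_def rwalk_def by blast
      hence "1 \<le> s" using s ws(2) by (cases s) auto
      thus ?thesis using closed_ear[OF least ws _ s] cyc'[of s] cycle_T1[OF ws(1) d] ws(2) s noear by auto
    next
      case False
      obtain ws where ws: "odd_str ws" "length ws = N" using ex by blast
      have none: "\<forall>v us w. bad_ear v us w \<longrightarrow> length us \<noteq> N" using noear False by blast
      hence co: "closed_odd ws" using ws unfolding odd_str_def by blast
      have d: "distinct ws" using least_distinct[OF least ws] .
      have "odd N" using co ws(2) unfolding closed_odd_def by blast
      then obtain s where s: "N = 2 * s + 1" by (elim oddE)
      have "s \<noteq> 0"
      proof
        assume "s = 0"
        hence "length ws = 1" using s ws(2) by simp
        then obtain c where "ws = [c]" by (cases ws) auto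
        thus False using co irr unfolding closed_odd_def by simp
      qed
      thus ?thesis using closed[OF least co ws(2) none s] cyc'[of s] cycle_T0[OF co d] ws(2) s by auto
    qed
  qed
qed

lemma L_gt_4: "4 < L"
  using L_pos by simp

text \<open>Here \<open>r0 = 2 * k - 1\<close>. An ear with \<open>2 * k - 1\<close> inner vertices
  has the extremal shape, one with \<open>2 * k\<close> has it after a vertex is absorbed into a
  class; any longer obstruction keeps too many vertices away from the classes.\<close>

theorem part_a:
  assumes L: "L = spec_rad n E" and nb: "\<not> bipartite n E"
    and cyc: "\<forall>i. 1 \<le> i \<and> i \<le> k - 1 \<longrightarrow> \<not> has_cycle n E (2 * i + 1)"
    and sr: "spec_rad n (S_graph n k) \<le> L"
  shows "graph_iso n E (S_graph n k)"
proof -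
  define m where "m = n - (2 * k - 1)"
  have m: "185 \<le> m" "m < n" using nk k1 unfolding m_def by auto
  have "real m / 2 - 1 / 50 \<le> L" using spec_rad_S_ge[OF m_def m] sr by linarith
  moreover have "real m = real n - real (2 * k - 1)" unfolding m_def using nk by (subst of_nat_diff) auto
  ultimately have Lr: "(real n - real (2 * k - 1)) / 2 - 1 / 50 \<le> L" by simp
  show ?thesis
  proof (rule structure_cases[OF nb k1 cyc])
    fix N v ws w
    assume least: "\<forall>ws. odd_str ws \<longrightarrow> N \<le> length ws" and ear: "bad_ear v ws w" and len: "length ws = N"
      and vw: "v \<noteq> w" and N: "2 * k - 1 \<le> N"
    have os: "odd_str ws" using ear unfolding odd_str_def by blast
    have d: "distinct ws" by (rule least_distinct[OF least os len])
    have ws: "ws \<noteq> []" "set ws \<subseteq> rest" and vwin: "v \<in> A \<union> B" "w \<in> A \<union> B" and par: "(v \<in> A \<longleftrightarrow> w \<in> A) \<longleftrightarrow> even N"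
      using ear len unfolding bad_ear_def rwalk_def by auto
    have cw: "card (set ws) = N" using d len by (simp add: distinct_card)
    consider "N = 2 * k - 1" | "N = 2 * k" | "2 * k + 1 \<le> N" using N by linarith
    thus ?thesis
    proof cases
      case 1
      have main: ?thesis if ear: "bad_ear v ws w" and len: "length ws = N" and vw: "v \<in> A" "w \<in> B" and d: "distinct ws" for v ws w
      proof -
        have S: "typeS n E A B ws" by (rule ear_typeS[OF least ear len 1 vw])
        have os: "odd_str ws" using ear unfolding odd_str_def by blast
        have ws: "ws \<noteq> []" "set ws \<subseteq> rest" using ear unfolding bad_ear_def rwalk_def by auto
        have cw: "card (set ws) = N" using d len by (simp add: distinct_card)
        have lw: "length ws = 2 * k - 1" using len 1 by simp
        show ?thesis
        proof (cases "set ws = rest")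
          case True
          \<comment> \<open>Adjacent ends would turn the path into a \<open>C_{2k-1}\<close>, which
            is excluded by \<open>cyc\<close>, or into a loop if \<open>k = 1\<close>.\<close>
          have cl: "\<not> E (last ws) (hd ws)"
          proof
            assume e: "E (last ws) (hd ws)"
            have "closed_odd ws" unfolding closed_odd_def using ear e lw k1 unfolding bad_ear_def by auto
            hence hc: "has_cycle n E (2 * k - 1)" using cycle_T0 d lw by metis
            show False
            proof (cases "k = 1")
              case True
              hence "length ws = 1" using lw by simp
              then obtain c where "ws = [c]" by (cases ws) auto
              thus False using e irr by simp
            next
              case False
              hence "2 * (k - 1) + 1 = 2 * k - 1" "1 \<le> k - 1" using k1 by auto
              thus False using cyc hc by (metis order_refl)
            qed
          qed
          have ends: "hd ws \<in> rest" "last ws \<in> rest" using ws by auto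
          show ?thesis
          proof (rule typeS_exact[OF G S _ _ lw k1 nk])
            show "A \<union> B \<union> set ws = {..<n}" using True V_eq(1) by simp
            show "E v w \<longleftrightarrow> path_edge ws v w" if "v \<in> set ws" "w \<in> set ws" for v w
              using induced_path[OF least os len _ that] cl by blast
            show "2 \<le> card {a \<in> A. \<not> E (hd ws) a}" using many_nonneighbours(1)[OF ends(1)] .
            show "2 \<le> card {b \<in> B. \<not> E (last ws) b}" using many_nonneighbours(2)[OF ends(2)] .
          qed (use sr L L_gt_4 in auto)
        next
          case False
          hence "set ws \<subset> rest" using ws by blast
          hence "N < card rest" using finAB cw psubset_card_mono by metis
          hence c: "card A + card B + (2 * k - 1) + 1 \<le> n" using card_V 1 by linarith
          have False
            by (rule quant_S[OF S lw, of "rest - set ws" "2 * k - 1"])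
               (use ws V_eq c Lr in auto)
          thus ?thesis ..
        qed
      qed
      have "odd N" using 1 k1 by auto
      hence "(v \<in> A \<and> w \<in> B) \<or> (v \<in> B \<and> w \<in> A)" using par vwin AB(3) by auto
      thus ?thesis
        using main[OF ear len _ _ d] main[OF bad_ear_rev[OF ear]] len d by auto
    next
      case 2
      define X where "X = (if v \<in> A then A else B)"
      define Y where "Y = (if v \<in> A then B else A)"
      have XY: "X \<union> Y = A \<union> B" "X \<inter> Y = {}" "(X = A \<and> Y = B) \<or> (X = B \<and> Y = A)"
        unfolding X_def Y_def using AB(3) by auto
      have vwX: "v \<in> X" "w \<in> X" using par vwin AB(3) 2 unfolding X_def by auto
      note ab = ear_absorb_typeS[OF least ear len 2 XY vwX]
      have lt: "length (rev (tl ws)) = 2 * k - 1" using len 2 by simp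
      have tlne: "tl ws \<noteq> []" using lt k1 by (cases "tl ws") auto
      have cons: "ws = hd ws # tl ws" using ws(1) by simp
      have "set ws = insert (hd ws) (set (tl ws))" by (subst cons) simp
      hence sw: "X \<union> insert (hd ws) Y \<union> set (rev (tl ws)) = A \<union> B \<union> set ws" using XY(1) by auto
      have "hd ws \<in> rest" using ws by (meson hd_in_set subsetD)
      hence hdr: "hd ws \<notin> A \<union> B" using V_eq(2) by blast
      have fXY: "finite X" "finite Y" unfolding X_def Y_def using finAB by simp_all
      show ?thesis
      proof (cases "set ws = rest")
        case True
        have l: "hd (rev (tl ws)) \<in> rest"
          using ws tlne by (metis hd_rev last_in_set last_tl subsetD)
        show ?thesis
        proof (rule typeS_exact[OF G ab(1) _ ab(2) lt k1 nk _ ab(3)])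
          show "X \<union> insert (hd ws) Y \<union> set (rev (tl ws)) = {..<n}" unfolding sw using True V_eq(1) by simp
          show "2 \<le> card {a \<in> X. \<not> E (hd (rev (tl ws))) a}" using many_nonneighbours[OF l] XY(3) by auto
        qed (use sr L L_gt_4 in auto)
      next
        case False
        hence "set ws \<subset> rest" using ws by blast
        hence "N < card rest" using finAB cw psubset_card_mono by metis
        moreover have "card X + card (insert (hd ws) Y) = card A + card B + 1"
          using XY(3) hdr fXY by auto
        ultimately have c: "card X + card (insert (hd ws) Y) + (2 * k - 1) + 1 \<le> n" using card_V 2 k1 by linarith
        have sq: "sqn x (A \<union> B) \<le> sqn x (X \<union> insert (hd ws) Y)"
          unfolding sqn_def using fXY finAB XY(1) by (intro sum_mono2) auto
        have False
        proof (rule quant_S[OF ab(1) lt, of "rest - set ws" "2 * k - 1"])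
          show "X \<union> insert (hd ws) Y \<union> set (rev (tl ws)) \<union> (rest - set ws) = {..<n}" unfolding sw using V_eq(1) ws by auto
          show "(X \<union> insert (hd ws) Y \<union> set (rev (tl ws))) \<inter> (rest - set ws) = {}" unfolding sw using V_eq(2) by auto
        qed (use sq c Lr in auto)
        thus ?thesis ..
      qed
    next
      case 3
      have False using quant_T2[OF least ear len, of "2 * k - 1"] 3 Lr k1 by auto
      thus ?thesis ..
    qed
  next
    fix N s a ws
    assume h: "\<forall>ws. odd_str ws \<longrightarrow> N \<le> length ws" "bad_ear a ws a" "length ws = N"
      "\<forall>v us w. bad_ear v us w \<longrightarrow> v \<noteq> w \<longrightarrow> length us \<noteq> N" "N = 2 * s" "k \<le> s" "s \<noteq> k"
    have N2: "2 \<le> N" "2 * k + 2 \<le> N" using h k1 by auto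
    have "distinct ws" using least_distinct[OF h(1) _ h(3)] h(2) unfolding odd_str_def by blast
    hence "card (set ws) = N" using h(3) by (simp add: distinct_card)
    moreover have "set ws \<subseteq> rest" using h(2) unfolding bad_ear_def rwalk_def by blast
    ultimately have "N \<le> card rest" using finAB card_mono by metis
    hence "2 * k - 1 \<le> N" "2 * k - 1 + 1 \<le> card rest" using N2 by linarith+
    hence False using quant_T1[OF h(1-3) N2(1) h(4) _ _ Lr] by blast
    thus ?thesis ..
  next
    fix N s ws
    assume h: "\<forall>ws. odd_str ws \<longrightarrow> N \<le> length ws" "closed_odd ws" "length ws = N"
      "\<forall>v us w. bad_ear v us w \<longrightarrow> length us \<noteq> N" "N = 2 * s + 1" "k \<le> s" "s \<noteq> k"
    have "2 * k - 1 + 1 \<le> N" using h(5,6) by linarith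
    hence False using quant_T0[OF h(1-4) _ Lr] by blast
    thus ?thesis ..
  qed
qed

text \<open>Here \<open>r0 = 2 * l\<close> is at most \<open>2 * k - 2\<close>, so an ear with
  distinct ends always has a surplus vertex. What survives is a closed ear with \<open>2 * l\<close>
  inner vertices that exhausts the remainder.\<close>

theorem part_b:
  assumes L: "L = spec_rad n E" and nb: "\<not> bipartite n E" and l: "1 \<le> l" "l \<le> k - 1"
    and cyc: "\<forall>i. 1 \<le> i \<and> i \<le> l - 1 \<longrightarrow> \<not> has_cycle n E (2 * i + 1)"
    and sr: "spec_rad n (C_graph n l) \<le> L"
  shows "graph_iso n E (C_graph n l)"
proof -
  define m where "m = n - 2 * l"
  have m: "185 \<le> m" "m < n" "185 + 2 * l \<le> n" using nk l unfolding m_def by auto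
  have "real m / 2 - 1 / 50 \<le> L" using spec_rad_C_ge[OF m_def m(1,2) l(1)] sr by linarith
  moreover have "real m = real n - real (2 * l)" unfolding m_def using m(3) by (subst of_nat_diff) auto
  ultimately have Lr: "(real n - real (2 * l)) / 2 - 1 / 50 \<le> L" by simp
  show ?thesis
  proof (rule structure_cases[OF nb l(1) cyc])
    fix N v ws w
    assume least: "\<forall>ws. odd_str ws \<longrightarrow> N \<le> length ws" and ear: "bad_ear v ws w" and len: "length ws = N"
      and vw: "v \<noteq> w" and N: "2 * k - 1 \<le> N"
    have os: "odd_str ws" using ear unfolding odd_str_def by blast
    have d: "distinct ws" by (rule least_distinct[OF least os len])
    have vwin: "v \<in> A \<union> B" "w \<in> A \<union> B" and par: "(v \<in> A \<longleftrightarrow> w \<in> A) \<longleftrightarrow> even N"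
      using ear len unfolding bad_ear_def rwalk_def by auto
    have False
    proof (cases "N = 2 * k - 1")
      case True
      have main: False if ear: "bad_ear v ws w" and len: "length ws = N" and vw: "v \<in> A" "w \<in> B" and d: "distinct ws" for v ws w
      proof -
        have S: "typeS n E A B ws" by (rule ear_typeS[OF least ear len True vw])
        have ws: "set ws \<subseteq> rest" using ear unfolding bad_ear_def rwalk_def by auto
        have lw: "length ws = 2 * k - 1" using len True by simp
        have "card (set ws) \<le> card rest" using ws finAB by (intro card_mono)
        hence "2 * k - 1 \<le> card rest" using d lw by (simp add: distinct_card)
        hence c: "card A + card B + 2 * l + 1 \<le> n" using card_V l by linarith
        have l2: "2 * l \<le> 2 * k - 1" using l by linarith
        show False
          by (rule quant_S[OF S lw, of "rest - set ws" "2 * l"]) (use ws V_eq c l2 Lr in auto)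
      qed
      have "odd N" using True k1 by auto
      hence "(v \<in> A \<and> w \<in> B) \<or> (v \<in> B \<and> w \<in> A)" using par vwin AB(3) by auto
      thus ?thesis
        using main[OF ear len _ _ d] main[OF bad_ear_rev[OF ear]] len d by auto
    next
      case False
      hence "2 * l + 2 \<le> N" using N l by linarith
      thus ?thesis using quant_T2[OF least ear len] Lr by blast
    qed
    thus ?thesis ..
  next
    fix N s a ws
    assume h: "\<forall>ws. odd_str ws \<longrightarrow> N \<le> length ws" "bad_ear a ws a" "length ws = N"
      "\<forall>v us w. bad_ear v us w \<longrightarrow> v \<noteq> w \<longrightarrow> length us \<noteq> N" "N = 2 * s" "l \<le> s" "s \<noteq> k"
    have N2: "2 \<le> N" "2 * l \<le> N" using h l by auto
    have os: "odd_str ws" using h(2) unfolding odd_str_def by blast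
    have d: "distinct ws" by (rule least_distinct[OF h(1) os h(3)])
    have cw: "card (set ws) = N" using d h(3) by (simp add: distinct_card)
    have ws: "ws \<noteq> []" "set ws \<subseteq> rest" and a: "a \<in> A \<union> B" and e: "E a (hd ws)" "E (last ws) a"
      using h(2) unfolding bad_ear_def rwalk_def by auto
    have Nr: "N \<le> card rest" using ws finAB card_mono cw by metis
    show ?thesis
    proof (cases "2 * l + 1 \<le> card rest")
      case True
      have False using quant_T1[OF h(1-3) N2(1) h(4) N2(2) True Lr] .
      thus ?thesis ..
    next
      case False
      hence N: "N = 2 * l" "card rest = N" using Nr N2 by auto
      hence sr': "set ws = rest" using ws finAB cw card_subset_eq by metis
      have ind: "E v w \<longleftrightarrow> path_edge ws v w" if "v \<in> set ws" "w \<in> set ws" for v w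
        using induced_path[OF h(1) os h(3) _ that] N by simp
      have att: "E p q \<longleftrightarrow> q = a \<and> (p = hd ws \<or> p = last ws)" if p: "p \<in> set ws" "q \<in> A \<union> B" for p q
      proof
        assume epq: "E p q"
        have "p = hd ws \<or> p = last ws" using ear_attached_ends[OF h(1-3) p epq] .
        moreover have "q = a" using closed_ear_attached_at[OF h(1-3) N2(1) h(4) p(2)] epq calculation by blast
        ultimately show "q = a \<and> (p = hd ws \<or> p = last ws)" by blast
      next
        assume "q = a \<and> (p = hd ws \<or> p = last ws)"
        thus "E p q" using e sE by blast
      qed
      have lw: "length ws = 2 * l" using h(3) N by simp
      \<comment> \<open>Either class may contain \<open>a\<close>; that it is the one of the smaller
        size comes out of \<open>typeC_exact\<close>.\<close>
      have main: ?thesis if XY: "(X = A \<and> Y = B) \<or> (X = B \<and> Y = A)" and aX: "a \<in> X" for X Y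
      proof (rule typeC_exact[OF G _ aX _ _ _ ind _ lw l(1) m(3)])
        show "arr n X Y ws" unfolding arr_def using XY V_eq AB(3) sr' ws(1) d by auto
        show "Y \<noteq> {}" using XY card_AB_2 by auto
        show "\<And>u v. u \<in> X \<Longrightarrow> v \<in> X \<Longrightarrow> \<not> E u v" "\<And>u v. u \<in> Y \<Longrightarrow> v \<in> Y \<Longrightarrow> \<not> E u v" using XY indep by blast+
        show "\<And>p v. p \<in> set ws \<Longrightarrow> v \<in> X \<union> Y \<Longrightarrow> E p v \<longleftrightarrow> v = a \<and> (p = hd ws \<or> p = last ws)" using att XY by blast
        show "spec_rad n (C_graph n l) \<le> spec_rad n E" using sr L by simp
      qed
      show ?thesis using a main by blast
    qed
  next
    fix N s ws
    assume h: "\<forall>ws. odd_str ws \<longrightarrow> N \<le> length ws" "closed_odd ws" "length ws = N"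
      "\<forall>v us w. bad_ear v us w \<longrightarrow> length us \<noteq> N" "N = 2 * s + 1" "l \<le> s" "s \<noteq> k"
    have "2 * l + 1 \<le> N" using h(5,6) by linarith
    hence False using quant_T0[OF h(1-4) _ Lr] by blast
    thus ?thesis ..
  qed
qed

end

theorem theorem2p1:
  fixes n k l :: nat and E :: "nat \<Rightarrow> nat \<Rightarrow> bool"
  assumes "1 \<le> l" "l \<le> k" "n \<ge> 187 * k"
    and "simple_graph n E"
    and "\<forall>i. 1 \<le> i \<and> i \<le> l - 1 \<longrightarrow> \<not> has_cycle n E (2*i + 1)"
    and "\<not> has_cycle n E (2*k + 1)"
  shows "(l = k \<and> spec_rad n E \<ge> spec_rad n (S_graph n k) \<longrightarrow>
            bipartite n E \<or> graph_iso n E (S_graph n k))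
       \<and> (l \<le> k - 1 \<and> spec_rad n E \<ge> spec_rad n (C_graph n l) \<longrightarrow>
            bipartite n E \<or> graph_iso n E (C_graph n l))"
proof -
  have n0: "0 < n" and k1: "1 \<le> k" using assms by auto
  obtain x u where x: "\<And>v. 0 \<le> x v" "\<And>v. x v \<le> 1" "u < n" "x u = 1"
    "\<And>v. v < n \<Longrightarrow> nsum E x {..<n} v = spec_rad n E * x v"
    using perron_normalized[OF assms(4) n0] by blast
  \<comment> \<open>The bound is met in both cases: in (a) \<open>m / 2\<close> is
    \<open>n / 2 - k + 1 / 2\<close>, in (b) it is at least \<open>n / 2 - k + 1\<close>, and the
    loss is only 1/50.\<close>
  have pg: "perron_graph n k E (spec_rad n E) x u" if "real n / 2 - real k \<le> spec_rad n E"
    using that x assms(3,4,6) k1 by unfold_locales auto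
  show ?thesis
  proof (intro conjI impI; elim conjE)
    assume lk: "l = k" and sr: "spec_rad n (S_graph n k) \<le> spec_rad n E"
    define m where "m = n - (2 * k - 1)"
    have m: "185 \<le> m" "m < n" "2 * k - 1 \<le> n" using assms k1 unfolding m_def by auto
    have "real m = real n - real (2 * k - 1)" unfolding m_def using m(3) by (rule of_nat_diff)
    moreover have "real (2 * k - 1) = 2 * real k - 1" using k1 by (simp add: of_nat_diff)
    ultimately have "real n / 2 - real k \<le> spec_rad n E"
      using spec_rad_S_ge[OF m_def m(1,2)] sr by (simp add: field_simps)
    from perron_graph.part_a[OF pg[OF this] refl _ _ sr] assms(5) lk
    show "bipartite n E \<or> graph_iso n E (S_graph n k)" by blast
  next
    assume lk: "l \<le> k - 1" and sr: "spec_rad n (C_graph n l) \<le> spec_rad n E"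
    define m where "m = n - 2 * l"
    have m: "185 \<le> m" "m < n" "2 * l \<le> n" using assms k1 lk unfolding m_def by auto
    have "real m = real n - real (2 * l)" unfolding m_def using m(3) by (rule of_nat_diff)
    moreover have "real l + 1 \<le> real k" using lk assms(1) by linarith
    ultimately have "real n / 2 - real k \<le> spec_rad n E"
      using spec_rad_C_ge[OF m_def m(1,2) assms(1)] sr by (simp add: field_simps)
    from perron_graph.part_b[OF pg[OF this] refl _ assms(1) lk assms(5) sr]
    show "bipartite n E \<or> graph_iso n E (C_graph n l)" by blast
  qed
qed

end
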